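(* Let $\Phi$ be the set of all functions on $(0,1)$ of the form $x\mapsto \sum_{k=1}^{n}c_{k}\left\{\frac{1}{a_{k}x}\right\}$ with $n\in\mathbb{N}$, $c_1,\dots,c_n\in\mathbb{R}$, real numbers $a_1,\dots,a_n\geq 1$, and $\sum_{k=1}^{n}c_{k}\left\{\frac{1}{a_{k}}\right\}=0$. Let $\overline{A}=(L^{1}(0,1),L^{2}(0,1))$. The following statements are equivalent: (a) The Riemann Hypothesis is true. (b) There is a function $M:(0,1)\to(0,\infty)$, tempered at $1$, with $M(\theta)=O(1)$ as $\theta\to 1$, such that $$\inf_{f\in\Phi}\left\Vert \chi_{(0,1)}-f\right\Vert_{\Delta_{0<\theta<1}\left(M(\theta)\overline{A}_{\theta,\infty}\right)}=0.$$ (b') There is a function $M:(0,1)\to(0,\infty)$, tempered at $1$, with $M(\theta)=O(1)$ as $\theta\to 1$, such that, with $\frac1p+\frac1{p'}=1$ and $\omega(p)=M\left(\frac{2}{p'}\right)=M\left(2-\frac{2}{p}\right)$ for $1<p<2$, $$\inf_{f\in\Phi}\left\Vert \chi_{(0,1)}-f\right\Vert_{\Delta_{1<p<2}\left(\omega(p)\,(L^{1}(0,1),L^{2}(0,1))_{\frac{2}{p'},\infty}\right)}=0.$$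
   Context: $\{t\}=t-\lfloor t\rfloor$ denotes the fractional part of $t$, and $\chi_{(0,1)}$ is the constant function $1$ on $(0,1)$. The Riemann Hypothesis is the statement that the Riemann zeta function $\zeta(s)$ has no zeros with $\frac12<\operatorname{Re}(s)<1$. A positive function $M$ on $(0,1)$ is tempered at $1$ if $M\left(\frac{1+\theta}{2}\right)\approx M(\theta)$ for $\theta$ close to $1$, i.e. there are constants $C\geq 1$ and $\theta_0\in(0,1)$ with $C^{-1}M(\theta)\leq M\left(\frac{1+\theta}{2}\right)\leq C\,M(\theta)$ for all $\theta\in(\theta_0,1)$. For a compatible pair of Banach spaces $\overline{X}=(X_0,X_1)$, $f\in X_0+X_1$ and $t>0$, the $K$-functional is $K(t,f,X_0,X_1)=\inf\{\Vert f_0\Vert_{X_0}+t\Vert f_1\Vert_{X_1}: f=f_0+f_1,\ f_0\in X_0,\ f_1\in X_1\}$. For $0<\theta<1$, $\overline{X}_{\theta,\infty}=(X_0,X_1)_{\theta,\infty}$ is the space of $f\in X_0+X_1$ with finite norm $\Vert f\Vert_{\theta,\infty}=\sup_{t>0}t^{-\theta}K(t,f,X_0,X_1)$. For a Banach space $X$ and $c>0$, $cX$ denotes the space $X$ with norm $c\Vert\cdot\Vert_X$. For a family of Banach spaces $\{A_\theta\}_{\theta\in\Theta}$ all contained in a common Banach space, $\Delta_{\theta\in\Theta}(A_\theta)$ is the space of $a\in\bigcap_\theta A_\theta$ with finite norm $\Vert a\Vert_{\Delta_{\theta\in\Theta}(A_\theta)}=\sup_{\theta\in\Theta}\Vert a\Vert_{A_\theta}$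 (the norm is taken to be $+\infty$ otherwise). Thus, for instance, $\Vert g\Vert_{\Delta_{0<\theta<1}(M(\theta)\overline{A}_{\theta,\infty})}=\sup_{0<\theta<1}\sup_{t>0}M(\theta)\,t^{-\theta}K(t,g,L^1(0,1),L^2(0,1))$. *)

theory Defs
  imports "HOL-Complex_Analysis.Complex_Analysis" "HOL-Library.Function_Algebras"
    "HOL-Library.Landau_Symbols"
begin

section \<open>The Riemann zeta function\<close>

definition is_zeta :: "(complex \<Rightarrow> complex) \<Rightarrow> bool" where
  "is_zeta f \<longleftrightarrow> f holomorphic_on - {1} \<and>
     (\<forall>s. Re s > 1 \<longrightarrow> f s = (\<Sum>n. 1 / of_nat (Suc n) powr s))"

text \<open>The continuation exists (\<open>is_zeta_zeta\<close>) and is unique off \<open>s = 1\<close> (\<open>zeta_unique\<close>).\<close>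

definition zeta :: "complex \<Rightarrow> complex" where
  "zeta = (SOME f. is_zeta f)"

definition Riemann_Hypothesis :: bool where
  "Riemann_Hypothesis \<longleftrightarrow> (\<forall>s. 1 / 2 < Re s \<and> Re s < 1 \<longrightarrow> zeta s \<noteq> 0)"

lemma holomorphic_suminf_powr_bound:
  fixes f :: "nat \<Rightarrow> complex \<Rightarrow> complex"
  assumes S: "open S" and hol: "\<And>n. f n holomorphic_on S"
    and bd: "\<And>s. s \<in> S \<Longrightarrow> \<exists>d>0. \<exists>C. \<exists>e>1. cball s d \<subseteq> S \<and>
              (\<forall>n. \<forall>x\<in>cball s d. norm (f n x) \<le> C * of_nat (Suc n) powr (-e))"
  shows "(\<lambda>s. \<Sum>n. f n s) holomorphic_on S" and "\<And>s. s \<in> S \<Longrightarrow> summable (\<lambda>n. f n s)"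
proof -
  have summ: "summable (\<lambda>n. C * of_nat (Suc n) powr (-e))" if "e > 1" for C e :: real
  proof -
    have "summable (\<lambda>n. of_nat n powr (-e) :: real)"
      using that by (subst summable_real_powr_iff) auto
    hence "summable (\<lambda>n. of_nat (Suc n) powr (-e) :: real)" by (subst summable_Suc_iff)
    thus ?thesis by (rule summable_mult)
  qed
  show "summable (\<lambda>n. f n s)" if s: "s \<in> S" for s
  proof -
    obtain d C e where "d > 0" "e > 1"
      "\<forall>n. \<forall>x\<in>cball s d. norm (f n x) \<le> C * of_nat (Suc n) powr (-e)"
      using bd[OF s] by blast
    thus ?thesis
      by (intro summable_comparison_test[OF _ summ[of e C]]) auto
  qed
  show "(\<lambda>s. \<Sum>n. f n s) holomorphic_on S"
  proof (rule holomorphic_uniform_sequence[OF S])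
    show "(\<lambda>s. \<Sum>i<n. f i s) holomorphic_on S" for n
      using hol by (intro holomorphic_intros)
    fix s assume s: "s \<in> S"
    obtain d C e where d: "d > 0" "e > 1" "cball s d \<subseteq> S"
      "\<forall>n. \<forall>x\<in>cball s d. norm (f n x) \<le> C * of_nat (Suc n) powr (-e)"
      using bd[OF s] by blast
    have "uniform_limit (cball s d) (\<lambda>n x. \<Sum>i<n. f i x) (\<lambda>x. \<Sum>i. f i x) sequentially"
      using d by (intro Weierstrass_m_test[OF _ summ[of e C]]) auto
    with d show "\<exists>d>0. cball s d \<subseteq> S \<and>
        uniform_limit (cball s d) (\<lambda>n s. \<Sum>i<n. f i s) (\<lambda>s. \<Sum>n. f n s) sequentially"
      by blast
  qed
qed

lemma Re_cball_gt:
  fixes s :: complex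
  assumes "Re s > a"
  shows "\<exists>d>0. \<exists>e>a. \<forall>x\<in>cball s d. Re x \<ge> e"
proof (intro exI conjI ballI)
  fix x assume "x \<in> cball s ((Re s - a) / 2)"
  hence "norm (s - x) \<le> (Re s - a) / 2" by (simp add: dist_norm)
  hence "Re (s - x) \<le> (Re s - a) / 2" using complex_Re_le_cmod order_trans by blast
  thus "Re x \<ge> (Re s + a) / 2" by (simp add: field_simps)
qed (use assms in \<open>auto simp: field_simps\<close>)

lemma zeta_series:
  shows zeta_series_holomorphic:
      "(\<lambda>s. \<Sum>n. 1 / of_nat (Suc n) powr s) holomorphic_on {s::complex. Re s > 1}"
    and zeta_series_summable: "Re s > 1 \<Longrightarrow> summable (\<lambda>n. 1 / of_nat (Suc n) powr (s::complex))"
proof -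
  let ?S = "{s::complex. Re s > 1}"
  have bd: "\<exists>d>0. \<exists>C. \<exists>e>1. cball s d \<subseteq> ?S \<and>
     (\<forall>n. \<forall>x\<in>cball s d. norm (1 / of_nat (Suc n) powr x) \<le> C * of_nat (Suc n) powr (-e))"
    if s: "s \<in> ?S" for s
  proof -
    obtain d e where de: "d > 0" "e > 1" "\<And>x. x \<in> cball s d \<Longrightarrow> Re x \<ge> e"
      using Re_cball_gt[OF s[unfolded mem_Collect_eq]] by blast
    have "norm (1 / of_nat (Suc n) powr x) \<le> 1 * of_nat (Suc n) powr (-e)"
      if "x \<in> cball s d" for n x
    proof -
      have "norm (1 / of_nat (Suc n) powr x) = of_nat (Suc n) powr (- Re x)"
        by (simp add: norm_divide norm_powr_real_powr powr_minus_divide del: of_nat_Suc)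
      also have "\<dots> \<le> of_nat (Suc n) powr (-e)"
        using de(3)[OF that] by (intro powr_mono) auto
      finally show ?thesis by simp
    qed
    moreover have "cball s d \<subseteq> ?S" using de(2,3) by fastforce
    ultimately show ?thesis using de(1,2) by blast
  qed
  have op: "open ?S" by (rule open_halfspace_Re_gt)
  have hol: "(\<lambda>s. 1 / of_nat (Suc n) powr s) holomorphic_on ?S" for n
    by (intro holomorphic_intros) (auto simp del: of_nat_Suc)
  show "(\<lambda>s. \<Sum>n. 1 / of_nat (Suc n) powr s) holomorphic_on ?S"
    by (rule holomorphic_suminf_powr_bound[OF op hol bd])
  show "summable (\<lambda>n. 1 / of_nat (Suc n) powr s)" if "Re s > 1" for s
    by (rule holomorphic_suminf_powr_bound[OF op hol bd]) (use that in auto)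
qed

definition zeta_rem :: "nat \<Rightarrow> nat \<Rightarrow> complex \<Rightarrow> complex" where
  "zeta_rem N n s = of_nat (Suc (Suc n)) powr (1 - s) -
     (\<Sum>k\<le>N. (-1) ^ k * pochhammer (s - 1) k * of_nat (Suc n) powr (1 - s - of_nat k) / fact k)"

lemma zeta_rem_bound:
  assumes "Re s + real N \<ge> 0"
  shows "norm (zeta_rem N n s) \<le>
           norm (pochhammer (s - 1) (Suc N)) * of_nat (Suc n) powr (- Re s - real N)"
proof -
  define f where "f = (\<lambda>i x. (-1) ^ i * pochhammer (s - 1) i * x powr (1 - s - of_nat i) :: complex)"
  define w where "w = (of_nat (Suc n) :: complex)"
  define S where "S = closed_segment w (w + 1)"
  have S: "\<exists>r. x = of_real r \<and> r \<ge> real (Suc n)" if "x \<in> S" for x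
  proof -
    from that obtain u where u: "0 \<le> u" "u \<le> 1" "x = (1 - u) *\<^sub>R w + u *\<^sub>R (w + 1)"
      unfolding S_def closed_segment_def by blast
    have "x = of_real (real (Suc n) + u)"
      unfolding u(3) w_def by (simp add: scaleR_conv_of_real algebra_simps)
    with u show ?thesis by (intro exI[of _ "real (Suc n) + u"]) auto
  qed
  have "cmod (f 0 (w + 1) - (\<Sum>i\<le>N. f i w * (w + 1 - w) ^ i / fact i)) \<le>
     (norm (pochhammer (s - 1) (Suc N)) * of_nat (Suc n) powr (- Re s - real N)) *
       cmod (w + 1 - w) ^ Suc N / fact N"
  proof (rule complex_Taylor[where S = S])
    show "convex S" "w \<in> S" "w + 1 \<in> S" by (auto simp: S_def)
    show "(f i has_field_derivative f (Suc i) x) (at x within S)" if x: "x \<in> S" for i x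
    proof -
      obtain r where r: "x = of_real r" "r \<ge> real (Suc n)" using S[OF x] by blast
      have "x \<notin> \<real>\<^sub>\<le>\<^sub>0" using r by (auto simp: complex_nonpos_Reals_iff)
      have "((\<lambda>x. x powr (1 - s - of_nat i)) has_field_derivative
          (1 - s - of_nat i) * x powr (1 - s - of_nat i - 1)) (at x)"
        by (rule has_field_derivative_powr) fact
      hence "(f i has_field_derivative (-1) ^ i * pochhammer (s - 1) i *
           ((1 - s - of_nat i) * x powr (1 - s - of_nat i - 1))) (at x)"
        unfolding f_def by (rule DERIV_cmult)
      also have "(-1) ^ i * pochhammer (s - 1) i *
           ((1 - s - of_nat i) * x powr (1 - s - of_nat i - 1)) = f (Suc i) x"
        by (simp add: f_def pochhammer_Suc algebra_simps)
      finally show ?thesis by (rule has_field_derivative_at_within)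
    qed
    show "cmod (f (Suc N) x) \<le>
       norm (pochhammer (s - 1) (Suc N)) * of_nat (Suc n) powr (- Re s - real N)" if x: "x \<in> S" for x
    proof -
      obtain r where r: "x = of_real r" "r \<ge> real (Suc n)" using S[OF x] by blast
      have "cmod (f (Suc N) x) = norm (pochhammer (s - 1) (Suc N)) * r powr (- Re s - real N)"
        using r by (simp add: f_def norm_mult norm_power norm_powr_real_powr)
      also have "r powr (- Re s - real N) \<le> of_nat (Suc n) powr (- Re s - real N)"
        using r assms by (intro powr_mono2') auto
      finally show ?thesis by (simp add: mult_left_mono)
    qed
  qed
  also have "(norm (pochhammer (s - 1) (Suc N)) * of_nat (Suc n) powr (- Re s - real N)) *
       cmod (w + 1 - w) ^ Suc N / fact N \<le>
       norm (pochhammer (s - 1) (Suc N)) * of_nat (Suc n) powr (- Re s - real N)"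
    using mult_left_mono[of 1 "fact N :: real" "norm (pochhammer (s - 1) (Suc N)) * of_nat (Suc n) powr (- Re s - real N)"]
    by (simp add: divide_le_eq fact_ge_1)
  also have "f 0 (w + 1) - (\<Sum>i\<le>N. f i w * (w + 1 - w) ^ i / fact i) = zeta_rem N n s"
    by (simp add: f_def w_def zeta_rem_def add_ac)
  finally show ?thesis .
qed

lemma zeta_rem_holomorphic [holomorphic_intros]:
  "(\<lambda>s. pochhammer (s - 1) k) holomorphic_on A" "zeta_rem N n holomorphic_on A"
proof -
  show *: "(\<lambda>s. pochhammer (s - 1) k) holomorphic_on A" for k
    unfolding pochhammer_prod by (intro holomorphic_intros)
  show "zeta_rem N n holomorphic_on A"
    unfolding zeta_rem_def
    by (intro holomorphic_intros *) (auto simp del: of_nat_Suc)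
qed

lemma zeta_rem_sum:
  shows zeta_rem_sum_holomorphic:
      "(\<lambda>s. \<Sum>n. zeta_rem N n s) holomorphic_on {s. Re s > 1 - real N}"
    and zeta_rem_summable: "Re s > 1 - real N \<Longrightarrow> summable (\<lambda>n. zeta_rem N n s)"
proof -
  let ?S = "{s::complex. Re s > 1 - real N}"
  have bd: "\<exists>d>0. \<exists>C. \<exists>e>1. cball s d \<subseteq> ?S \<and>
     (\<forall>n. \<forall>x\<in>cball s d. norm (zeta_rem N n x) \<le> C * of_nat (Suc n) powr (-e))"
    if s: "s \<in> ?S" for s
  proof -
    obtain d e where de: "d > 0" "e > 1 - real N" "\<And>x. x \<in> cball s d \<Longrightarrow> Re x \<ge> e"
      using Re_cball_gt[OF s[unfolded mem_Collect_eq]] by blast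
    have "continuous_on (cball s d) (\<lambda>x. pochhammer (x - 1) (Suc N))"
      by (intro holomorphic_on_imp_continuous_on holomorphic_intros)
    hence "bounded ((\<lambda>x. pochhammer (x - 1) (Suc N)) ` cball s d)"
      by (intro compact_imp_bounded compact_continuous_image) auto
    then obtain C where C: "\<And>x. x \<in> cball s d \<Longrightarrow> norm (pochhammer (x - 1) (Suc N)) \<le> C"
      unfolding bounded_iff by blast
    have "norm (zeta_rem N n x) \<le> C * of_nat (Suc n) powr (-(e + real N))"
      if x: "x \<in> cball s d" for n x
    proof -
      have "norm (zeta_rem N n x) \<le>
           norm (pochhammer (x - 1) (Suc N)) * of_nat (Suc n) powr (- Re x - real N)"
        using de(2) de(3)[OF x] by (intro zeta_rem_bound) auto
      also have "\<dots> \<le> C * of_nat (Suc n) powr (-(e + real N))"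
        using de(3)[OF x] C[OF x] order_trans[OF norm_ge_zero C[OF x]]
        by (intro mult_mono powr_mono) auto
      finally show ?thesis .
    qed
    moreover have "cball s d \<subseteq> ?S" using de(2,3) by fastforce
    moreover have "e + real N > 1" using de(2) by simp
    ultimately show ?thesis using de(1) by blast
  qed
  have op: "open ?S" by (rule open_halfspace_Re_gt)
  have hol: "zeta_rem N n holomorphic_on ?S" for n by (intro holomorphic_intros)
  show "(\<lambda>s. \<Sum>n. zeta_rem N n s) holomorphic_on ?S"
    by (rule holomorphic_suminf_powr_bound[OF op hol bd])
  show "summable (\<lambda>n. zeta_rem N n s)" if "Re s > 1 - real N" for s
    by (rule holomorphic_suminf_powr_bound[OF op hol bd]) (use that in auto)
qed

lemma zeta_recurrence:
  assumes s: "Re s > 1"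
  defines "D \<equiv> \<lambda>s::complex. \<Sum>n. 1 / of_nat (Suc n) powr s"
  shows "(s - 1) * D s = 1 + (\<Sum>n. zeta_rem (Suc N) n s) +
    (\<Sum>k=1..N. (-1) ^ Suc k * pochhammer (s - 1) k / fact (Suc k) * 
       ((s + of_nat k - 1) * D (s + of_nat k)))"
proof -
  define u where "u = (\<lambda>n. of_nat (Suc n) powr (1 - s) :: complex)"
  define c where "c = (\<lambda>k. (-1) ^ Suc k * pochhammer (s - 1) (Suc k) / fact (Suc k) :: complex)"
  have "(\<lambda>n. real (Suc n) powr (1 - Re s)) \<longlonglongrightarrow> 0"
    using s by real_asymp
  hence "u \<longlonglongrightarrow> 0"
    by (subst tendsto_norm_zero_iff [symmetric])
       (simp add: u_def norm_powr_real_powr del: of_nat_Suc)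
  hence "(\<lambda>n. u (Suc n) - u n) sums (0 - u 0)" by (rule telescope_sums)
  hence tel: "(\<lambda>n. u (Suc n) - u n) sums (-1)" by (simp add: u_def)
  have Dk: "(\<lambda>n. 1 / of_nat (Suc n) powr (s + of_nat k)) sums D (s + of_nat k)" for k
    unfolding D_def using s by (intro summable_sums zeta_series_summable) auto
  have eq: "zeta_rem (Suc N) n s =
      (u (Suc n) - u n) - (\<Sum>k\<le>N. c k * (1 / of_nat (Suc n) powr (s + of_nat k)))" for n
  proof -
    have "of_nat (Suc n) powr (1 - s - of_nat (Suc k)) = 1 / of_nat (Suc n) powr (s + of_nat k)"
      for k :: nat
      by (simp add: powr_minus_divide [symmetric] del: of_nat_Suc) (simp add: algebra_simps)
    thus ?thesis
      by (simp add: zeta_rem_def sum.atMost_Suc_shift u_def c_def del: of_nat_Suc sum.atMost_Suc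
            fact_Suc power_Suc) (simp add: mult_ac del: fact_Suc power_Suc of_nat_Suc)
  qed
  have "(\<lambda>n. zeta_rem (Suc N) n s) sums (-1 - (\<Sum>k\<le>N. c k * D (s + of_nat k)))"
    unfolding eq by (intro sums_diff tel sums_sum sums_mult Dk)
  hence "(\<Sum>n. zeta_rem (Suc N) n s) = -1 - (\<Sum>k\<le>N. c k * D (s + of_nat k))"
    by (rule sums_unique [symmetric])
  also have "(\<Sum>k\<le>N. c k * D (s + of_nat k)) =
      c 0 * D s + (\<Sum>k=1..N. c k * D (s + of_nat k))"
    by (simp add: sum.atLeast_Suc_atMost atMost_atLeast0)
  also have "c 0 = -(s - 1)" by (simp add: c_def)
  also have "(\<Sum>k=1..N. c k * D (s + of_nat k)) =
     (\<Sum>k=1..N. (-1) ^ Suc k * pochhammer (s - 1) k / fact (Suc k) * 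
       ((s + of_nat k - 1) * D (s + of_nat k)))"
  proof (intro sum.cong refl)
    fix k
    have "s - 1 + of_nat k = s + of_nat k - 1" by simp
    thus "c k * D (s + of_nat k) = (-1) ^ Suc k * pochhammer (s - 1) k / fact (Suc k) *
       ((s + of_nat k - 1) * D (s + of_nat k))"
      by (simp add: c_def pochhammer_Suc mult_ac del: fact_Suc)
  qed
  finally show ?thesis by (simp add: algebra_simps del: fact_Suc)
qed

lemma zeta_continuation_halfplane:
  "\<exists>Z. Z holomorphic_on {s. Re s > 1 - real N} \<and>
     (\<forall>s. Re s > 1 \<longrightarrow> Z s = (s - 1) * (\<Sum>n. 1 / of_nat (Suc n) powr s))"
proof (induction N)
  case 0
  show ?case
    by (rule exI[of _ "\<lambda>s. (s - 1) * (\<Sum>n. 1 / of_nat (Suc n) powr s)"])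
       (use zeta_series_holomorphic in \<open>auto intro!: holomorphic_intros\<close>)
next
  case (Suc N)
  then obtain Z where Z: "Z holomorphic_on {s. Re s > 1 - real N}"
     "\<And>s. Re s > 1 \<Longrightarrow> Z s = (s - 1) * (\<Sum>n. 1 / of_nat (Suc n) powr s)" by blast
  define Y where "Y = (\<lambda>s. 1 + (\<Sum>n. zeta_rem (Suc N) n s) +
    (\<Sum>k=1..N. (-1) ^ Suc k * pochhammer (s - 1) k / fact (Suc k) * Z (s + of_nat k)))"
  have "(Z \<circ> (\<lambda>s. s + of_nat k)) holomorphic_on {s. Re s > 1 - real (Suc N)}"
    if "k \<in> {1..N}" for k
    by (rule holomorphic_on_compose_gen[OF _ Z(1)]) (use that in \<open>auto intro!: holomorphic_intros\<close>)
  hence "Y holomorphic_on {s. Re s > 1 - real (Suc N)}"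
    unfolding Y_def o_def
    by (intro holomorphic_intros zeta_rem_sum_holomorphic) (auto simp del: fact_Suc)
  moreover have "Y s = (s - 1) * (\<Sum>n. 1 / of_nat (Suc n) powr s)" if "Re s > 1" for s
  proof -
    have "Y s = 1 + (\<Sum>n. zeta_rem (Suc N) n s) +
      (\<Sum>k=1..N. (-1) ^ Suc k * pochhammer (s - 1) k / fact (Suc k) *
       ((s + of_nat k - 1) * (\<Sum>n. 1 / of_nat (Suc n) powr (s + of_nat k))))"
      unfolding Y_def using that by (subst Z(2)) (auto simp del: fact_Suc of_nat_Suc)
    thus ?thesis using zeta_recurrence[OF that, of N] by simp
  qed
  ultimately show ?case by blast
qed

lemma is_zeta_exists: "\<exists>f. is_zeta f"
proof -
  let ?D = "\<lambda>s::complex. \<Sum>n. 1 / of_nat (Suc n) powr s"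
  let ?H = "\<lambda>N. {s::complex. Re s > 1 - real N}"
  obtain Z where Z: "\<And>N. Z N holomorphic_on ?H N"
     "\<And>N s. Re s > 1 \<Longrightarrow> Z N s = (s - 1) * ?D s"
    using zeta_continuation_halfplane by metis
  have Z_eq: "Z M s = Z N s" if "M \<le> N" "Re s > 1 - real M" for M N s
  proof (rule analytic_continuation_open[where s = "{s. Re s > 1}" and s' = "?H M" and f = "Z M" and g = "Z N"])
    show "open {s. 1 < Re s}" "open (?H M)" by (rule open_halfspace_Re_gt)+
    show "{s. 1 < Re s} \<noteq> {}" by (auto intro!: exI[of _ 2])
    show "connected (?H M)" by (intro convex_connected convex_halfspace_Re_gt)
    show "Z N holomorphic_on ?H M"
      by (rule holomorphic_on_subset[OF Z(1)]) (use that in auto)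
    show "Z M holomorphic_on ?H M" by (rule Z(1))
    show "Z M x = Z N x" if "x \<in> {s. Re s > 1}" for x
      using that by (simp add: Z(2) del: of_nat_Suc)
  qed (use that in auto)
  define n where "n = (\<lambda>s. nat \<lceil>2 - Re s\<rceil>)"
  define f where "f = (\<lambda>s. Z (n s) s / (s - 1))"
  have f_eq: "f s = Z N s / (s - 1)" if "Re s > 1 - real N" for N s
  proof -
    have "Re s > 1 - real (n s)" unfolding n_def by linarith
    hence "Z (n s) s = Z N s" using Z_eq that by (metis nle_le)
    thus ?thesis by (simp only: f_def)
  qed
  have "\<exists>f'. (f has_field_derivative f') (at s)" if s: "s \<noteq> 1" for s
  proof -
    let ?A = "?H (n s) - {1}"
    have A: "open ?A" by (intro open_Diff open_halfspace_Re_gt) auto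
    have "s \<in> ?A" using s unfolding n_def by auto linarith
    have "(\<lambda>s. Z (n s') s / (s - 1)) holomorphic_on ?H (n s') - {1}" for s'
      by (intro holomorphic_intros holomorphic_on_subset[OF Z(1)]) auto
    hence "f holomorphic_on ?A"
      by (rule holomorphic_transform) (use f_eq[of "n s"] in auto)
    thus ?thesis using A \<open>s \<in> ?A\<close> holomorphic_on_open by blast
  qed
  hence "f holomorphic_on -{1}"
    using holomorphic_on_open[of "-{1}" f] by (simp add: open_Compl)
  moreover have "f s = ?D s" if "Re s > 1" for s
    using f_eq[of 0 s] Z(2)[OF that, of 0] that by auto
  ultimately show ?thesis unfolding is_zeta_def by blast
qed

lemma is_zeta_zeta: "is_zeta zeta"
  unfolding zeta_def using is_zeta_exists by (rule someI_ex)

lemma zeta_unique: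
  assumes "is_zeta f" "s \<noteq> 1"
  shows "f s = zeta s"
proof (rule analytic_continuation_open[where s = "{s. Re s > 1}" and s' = "-{1}" and f = f and g = zeta])
  show "open {s. 1 < Re s}" by (rule open_halfspace_Re_gt)
  show "{s. 1 < Re s} \<noteq> {}" by (auto intro!: exI[of _ 2])
  show "connected (- {1::complex})" by (rule connected_punctured_universe) simp
  show "f holomorphic_on -{1}" "zeta holomorphic_on -{1}"
    using assms is_zeta_zeta unfolding is_zeta_def by blast+
  show "f x = zeta x" if "x \<in> {s. Re s > 1}" for x
    using assms is_zeta_zeta that unfolding is_zeta_def by simp
qed (use assms in auto)


section \<open>Real interpolation\<close>

text \<open>
  A (semi)normed space inside an ambient abelian group is given by its norm, extended by
  \<open>\<infinity>\<close> off the space. With the convention that the infimum over the empty set is \<open>\<infinity>\<close>,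
  the norms below are again of this kind; in particular \<open>interp_norm\<close> is \<open>\<infinity>\<close> off \<open>X0 + X1\<close>.
\<close>

definition K_functional ::
    "real \<Rightarrow> 'a::ab_group_add \<Rightarrow> ('a \<Rightarrow> ennreal) \<Rightarrow> ('a \<Rightarrow> ennreal) \<Rightarrow> ennreal" where
  "K_functional t f X0 X1 =
     (INF (f0, f1) \<in> {(f0, f1). f = f0 + f1 \<and> X0 f0 < \<infinity> \<and> X1 f1 < \<infinity>}. X0 f0 + ennreal t * X1 f1)"

definition interp_norm ::
    "('a::ab_group_add \<Rightarrow> ennreal) \<times> ('a \<Rightarrow> ennreal) \<Rightarrow> real \<Rightarrow> 'a \<Rightarrow> ennreal" where
  "interp_norm X \<theta> f = (SUP t\<in>{0<..}. ennreal (t powr (- \<theta>)) * K_functional t f (fst X) (snd X))"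

definition scaled_norm :: "real \<Rightarrow> ('a \<Rightarrow> ennreal) \<Rightarrow> 'a \<Rightarrow> ennreal" where
  "scaled_norm c X f = ennreal c * X f"

definition Delta_norm :: "'i set \<Rightarrow> ('i \<Rightarrow> 'a \<Rightarrow> ennreal) \<Rightarrow> 'a \<Rightarrow> ennreal" where
  "Delta_norm I A f = (SUP \<theta>\<in>I. A \<theta> f)"

text \<open>
  \<open>L\<^sup>p\<close> is taken on functions rather than almost-everywhere classes. This changes no \<open>K\<close>-functional:
  \<open>Lp_norm\<close> is invariant under modification on null sets, and a decomposition that holds almost
  everywhere becomes a pointwise one after changing one summand on a null set (or outside the
  space of the measure, whose points \<open>Lp_norm\<close> does not see).
\<close>

definition Lp_norm :: "real \<Rightarrow> 'a measure \<Rightarrow> ('a \<Rightarrow> real) \<Rightarrow> ennreal" where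
  "Lp_norm p M f =
     (if f \<in> borel_measurable M \<and> integrable M (\<lambda>x. \<bar>f x\<bar> powr p)
      then ennreal ((\<integral>x. \<bar>f x\<bar> powr p \<partial>M) powr (1 / p)) else \<infinity>)"

definition L1_L2_pair :: "((real \<Rightarrow> real) \<Rightarrow> ennreal) \<times> ((real \<Rightarrow> real) \<Rightarrow> ennreal)" where
  "L1_L2_pair = (Lp_norm 1 (lebesgue_on {0<..<1}), Lp_norm 2 (lebesgue_on {0<..<1}))"


section \<open>Beurling functions and weights\<close>

definition Beurling_functions :: "(real \<Rightarrow> real) set" where
  "Beurling_functions =
     {(\<lambda>x. \<Sum>k=1..n. c k * frac (1 / (a k * x))) | (n::nat) (c::nat \<Rightarrow> real) (a::nat \<Rightarrow> real).
        (\<forall>k\<in>{1..n}. a k \<ge> 1) \<and> (\<Sum>k=1..n. c k * frac (1 / a k)) = 0}"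

definition tempered_at_1 :: "(real \<Rightarrow> real) \<Rightarrow> bool" where
  "tempered_at_1 M \<longleftrightarrow>
     (\<exists>C\<ge>1. \<exists>\<theta>\<^sub>0\<in>{0<..<1}. \<forall>\<theta>\<in>{\<theta>\<^sub>0<..<1}.
        inverse C * M \<theta> \<le> M ((1 + \<theta>) / 2) \<and> M ((1 + \<theta>) / 2) \<le> C * M \<theta>)"

definition conjugate_exponent :: "real \<Rightarrow> real" where
  "conjugate_exponent p = p / (p - 1)"

lemma conjugate_exponent:
  assumes "p > 1"
  shows "1 / p + 1 / conjugate_exponent p = 1" "2 / conjugate_exponent p = 2 - 2 / p"
  using assms by (auto simp: conjugate_exponent_def field_simps)

end

theory Submission
  imports Defs
begin

text \<open>
  If \<open>\<rho>\<close> is a zero with \<open>1/2 < Re \<rho> < 1\<close>, then \<open>f \<mapsto> Im ((\<rho> - 1) \<integral> f x\<^bsup>\<rho>-1\<^esup> dx)\<close> vanishes on all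
  Beurling functions but not at the constant \<open>1\<close>, and it is bounded on \<open>(L\<^sup>1, L\<^sup>2)\<^bsub>\<theta>,\<infinity>\<^esub>\<close> once
  \<open>\<theta> > 2 (1 - Re \<rho>)\<close>; hence the infimum is positive for every weight.

  Conversely the weight \<open>M = 1\<close> works, since all interpolation norms are bounded by the \<open>L\<^sup>2\<close> norm
  and the Riemann Hypothesis puts \<open>1\<close> into the \<open>L\<^sup>2\<close> closure of the Beurling functions (Nyman). For this
  let \<open>g\<close> be orthogonal to them. Then \<open>\<integral> g(x) {1/(ax)} dx = \<kappa>/a\<close> for \<open>a > 1\<close>, and taking Mellin transforms
  in \<open>a\<close> gives \<open>G(w) (w-1)\<zeta>(w) = B(w)\<close> on \<open>0 < Re w < 1/2\<close>, where \<open>G(w) = \<integral> g(x) x\<^bsup>-w\<^esup> dx\<close> is holomorphic on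
  \<open>Re w < 1/2\<close> and \<open>B\<close> is holomorphic and polynomially bounded on \<open>Re w > 0\<close>. Under the Riemann
  Hypothesis \<open>G\<close> therefore continues to an entire function: zeros of \<open>\<zeta>\<close> on the critical line do not
  produce poles because \<open>G\<close> grows too slowly from the left. Removing the zeros of \<open>\<zeta>\<close> in a disc by
  Blaschke factors and applying Harnack's inequality shows that the quotient grows polynomially, so it
  is a polynomial; as it tends to \<open>0\<close> at \<open>-\<infinity>\<close>, it vanishes, and \<open>\<integral> g = G(0) = 0\<close>.
\<close>

section \<open>Mellin integrals and the regularized zeta function\<close>

text \<open>The imaginary part is forced by the parameter a = 1. Since {1} = 0, the linear
  constraint leaves the coefficient of {1/x} free, while at a zero s the Mellin transform of
  {1/(ax)} over (0,1) is 1/(a(s-1)) for every a >= 1. So (s-1) times the transform of a Beurling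
  function is the sum of the c_k/a_k: real, but in general not zero. The constant function is still
  detected because Im (-1/s) is nonzero, once real zeros in (0,1) are excluded. In the converse the
  obstacle is the growth of the continued quotient near the critical line, where no lower bound for
  zeta is at hand. The Harnack argument needs upper bounds for the denominator and the product only,
  plus one lower bound at the centre, so the discs are centred on Re s = 2 and reach left of Re s =
  1/4; further left the direct bound for G takes over. All upper bounds come from Mellin integrals
  of bounded functions, which is why (s-1) zeta(s) is handled in the form \<open>zeta_reg\<close>.
  Since \<open>Riemann_Hypothesis\<close> speaks only of 1/2 < Re s < 1, zeros on Re s = 1 are
  excluded by the classical 3-4-1 inequality.\<close>

lemma powr_set_integral_0:
  fixes a c :: real
  assumes "a > 0" "c > 0"
  shows "set_integrable lborel {0<..<c} (\<lambda>x. x powr (a - 1))"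
    and "(LBINT x:{0<..<c}. x powr (a - 1)) = c powr a / a"
proof -
  define F where "F = (\<lambda>x. x powr a / a)"
  have d: "(F has_real_derivative x powr (a - 1)) (at x)" if "0 < x" for x
    unfolding F_def using that assms by (auto intro!: derivative_eq_intros)
  have c: "isCont (\<lambda>x. x powr (a - 1)) x" if "0 < x" for x :: real
    using that by (auto intro!: continuous_intros)
  have A: "(F \<longlongrightarrow> 0) (at_right 0)"
    unfolding F_def using assms by real_asymp
  have B: "(F \<longlongrightarrow> c powr a / a) (at_left c)"
    unfolding F_def using assms by (auto intro!: tendsto_eq_intros)
  have A': "((F \<circ> real_of_ereal) \<longlongrightarrow> 0) (at_right (ereal 0))"
    using A by (subst ereal_tendsto_simps1)
  have B': "((F \<circ> real_of_ereal) \<longlongrightarrow> c powr a / a) (at_left (ereal c))"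
    using B by (subst ereal_tendsto_simps1)
  have *: "set_integrable lborel (einterval (ereal 0) (ereal c)) (\<lambda>x. x powr (a - 1))"
    "(LBINT x=ereal 0..ereal c. x powr (a - 1)) = c powr a / a - 0"
    using interval_integral_FTC_nonneg[of "ereal 0" "ereal c" F "\<lambda>x. x powr (a - 1)" 0 "c powr a / a"]
      d c A' B' assms by auto
  show "set_integrable lborel {0<..<c} (\<lambda>x. x powr (a - 1))"
    using *(1) by simp
  show "(LBINT x:{0<..<c}. x powr (a - 1)) = c powr a / a"
    using *(2) assms by (simp add: interval_lebesgue_integral_def)
qed

lemma powr_set_integral_infinity:
  fixes a :: real
  assumes "a < 0"
  shows "set_integrable lborel {1<..} (\<lambda>x. x powr (a - 1))"
proof -
  define F where "F = (\<lambda>x. x powr a / a)"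
  have d: "(F has_real_derivative x powr (a - 1)) (at x)" if "1 < x" for x
    unfolding F_def using that assms by (auto intro!: derivative_eq_intros)
  have c: "isCont (\<lambda>x. x powr (a - 1)) x" if "1 < x" for x :: real
    using that by (auto intro!: continuous_intros)
  have A: "(F \<longlongrightarrow> 1/a) (at_right 1)"
    unfolding F_def using assms by (auto intro!: tendsto_eq_intros)
  have B: "(F \<longlongrightarrow> 0) at_top"
    unfolding F_def using assms by real_asymp
  have A': "((F \<circ> real_of_ereal) \<longlongrightarrow> 1/a) (at_right (ereal 1))"
    using A by (subst ereal_tendsto_simps1)
  have B': "((F \<circ> real_of_ereal) \<longlongrightarrow> 0) (at_left \<infinity>)"
    using B by (subst ereal_tendsto_simps1)
  have *: "set_integrable lborel (einterval (ereal 1) \<infinity>) (\<lambda>x. x powr (a - 1))"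
    using interval_integral_FTC_nonneg(1)[of "ereal 1" "\<infinity>" F "\<lambda>x. x powr (a - 1)" "1/a" 0]
      d c A' B' assms by auto
  thus ?thesis by simp
qed

lemma norm_powr_of_real:
  "x > 0 \<Longrightarrow> norm (complex_of_real x powr s) = x powr Re s"
  by (simp add: norm_powr_real_powr)

lemma set_integrable_real_bound:
  fixes k :: "real \<Rightarrow> complex"
  assumes "set_integrable lborel A (\<lambda>x. g x)" "set_borel_measurable lborel A k" "A \<in> sets borel"
     "\<And>x. x \<in> A \<Longrightarrow> norm (k x) \<le> (g x::real)"
  shows "set_integrable lborel A k"
  using assms(1)
  by (rule set_integrable_bound) (use assms in \<open>auto intro!: AE_I2 order_trans[OF _ abs_ge_self]\<close>)

lemma powr_set_integral_0_complex:
  assumes "Re s > 0" "c > 0"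
  shows "set_integrable lborel {0<..<c} (\<lambda>x. complex_of_real x powr (s - 1))"
    and "(LBINT x:{0<..<c}. complex_of_real x powr (s - 1)) = of_real c powr s / s"
proof -
  show int: "set_integrable lborel {0<..<c} (\<lambda>x. complex_of_real x powr (s - 1))"
  proof (rule set_integrable_real_bound[OF powr_set_integral_0(1)[of "Re s" c]])
    show "set_borel_measurable lborel {0<..<c} (\<lambda>x. complex_of_real x powr (s - 1))"
      unfolding set_borel_measurable_def by measurable
  qed (use assms in \<open>auto simp: norm_powr_of_real\<close>)
  define F where "F = (\<lambda>x. complex_of_real x powr s / s)"
  have d: "(F has_vector_derivative complex_of_real x powr (s - 1)) (at x)" if "0 < x" for x
  proof -
    have "((\<lambda>z. z powr s / s) has_field_derivative (complex_of_real x powr (s - 1))) (at (of_real x))"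
      using that assms by (auto intro!: derivative_eq_intros simp: complex_nonpos_Reals_iff)
    thus ?thesis unfolding F_def
      by (rule has_vector_derivative_real_field)
  qed
  have c: "isCont (\<lambda>x. complex_of_real x powr (s - 1)) x" if "0 < x" for x :: real
    using that by (auto intro!: continuous_intros simp: complex_nonpos_Reals_iff)
  have A: "(F \<longlongrightarrow> 0) (at_right 0)"
  proof (rule Lim_null_comparison)
    show "\<forall>\<^sub>F x in at_right 0. norm (F x) \<le> x powr Re s / norm s"
      using eventually_at_right_less[of 0]
      by eventually_elim (auto simp: F_def norm_divide norm_powr_of_real)
    have "((\<lambda>x::real. x powr Re s) \<longlongrightarrow> 0) (at_right 0)"
      using assms by real_asymp
    thus "((\<lambda>x. x powr Re s / norm s) \<longlongrightarrow> 0) (at_right 0)"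
      by (rule tendsto_divide_zero)
  qed
  have "isCont F c" unfolding F_def using assms
    by (auto intro!: continuous_intros simp: complex_nonpos_Reals_iff)
  hence B: "(F \<longlongrightarrow> F c) (at_left c)"
    unfolding isCont_def by (rule filterlim_mono) (auto simp: at_le)
  have A': "((F \<circ> real_of_ereal) \<longlongrightarrow> 0) (at_right (ereal 0))"
    using A by (subst ereal_tendsto_simps1)
  have B': "((F \<circ> real_of_ereal) \<longlongrightarrow> F c) (at_left (ereal c))"
    using B by (subst ereal_tendsto_simps1)
  have "(LBINT x=ereal 0..ereal c. complex_of_real x powr (s - 1)) = F c - 0"
    by (rule interval_integral_FTC_integrable[where F=F])
      (use int d c A' B' assms in auto)
  thus "(LBINT x:{0<..<c}. complex_of_real x powr (s - 1)) = of_real c powr s / s"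
    using assms by (simp add: interval_lebesgue_integral_def F_def)
qed

lemma powr_set_integral_infinity_complex:
  assumes "Re s < 0"
  shows "set_integrable lborel {1<..} (\<lambda>x. complex_of_real x powr (s - 1))"
    and "(LBINT x:{1<..}. complex_of_real x powr (s - 1)) = - 1 / s"
proof -
  show int: "set_integrable lborel {1<..} (\<lambda>x. complex_of_real x powr (s - 1))"
  proof (rule set_integrable_real_bound[OF powr_set_integral_infinity(1)[of "Re s"]])
    show "set_borel_measurable lborel {1<..} (\<lambda>x. complex_of_real x powr (s - 1))"
      unfolding set_borel_measurable_def by measurable
  qed (use assms in \<open>auto simp: norm_powr_of_real\<close>)
  define F where "F = (\<lambda>x. complex_of_real x powr s / s)"
  have d: "(F has_vector_derivative complex_of_real x powr (s - 1)) (at x)" if "0 < x" for x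
  proof -
    have "((\<lambda>z. z powr s / s) has_field_derivative (complex_of_real x powr (s - 1))) (at (of_real x))"
      using that assms by (auto intro!: derivative_eq_intros simp: complex_nonpos_Reals_iff)
    thus ?thesis unfolding F_def
      by (rule has_vector_derivative_real_field)
  qed
  have c: "isCont (\<lambda>x. complex_of_real x powr (s - 1)) x" if "0 < x" for x :: real
    using that by (auto intro!: continuous_intros simp: complex_nonpos_Reals_iff)
  have A: "(F \<longlongrightarrow> 0) at_top"
  proof (rule Lim_null_comparison)
    show "\<forall>\<^sub>F x in at_top. norm (F x) \<le> x powr Re s / norm s"
      using eventually_gt_at_top[of 0]
      by eventually_elim (auto simp: F_def norm_divide norm_powr_of_real)
    have "((\<lambda>x::real. x powr Re s) \<longlongrightarrow> 0) at_top"
      using assms by real_asymp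
    thus "((\<lambda>x. x powr Re s / norm s) \<longlongrightarrow> 0) at_top"
      by (rule tendsto_divide_zero)
  qed
  have "isCont F 1" unfolding F_def using assms
    by (auto intro!: continuous_intros simp: complex_nonpos_Reals_iff)
  hence B: "(F \<longlongrightarrow> F 1) (at_right 1)"
    unfolding isCont_def by (rule filterlim_mono) (auto simp: at_le)
  have A': "((F \<circ> real_of_ereal) \<longlongrightarrow> 0) (at_left \<infinity>)"
    using A by (subst ereal_tendsto_simps1)
  have B': "((F \<circ> real_of_ereal) \<longlongrightarrow> F 1) (at_right (ereal 1))"
    using B by (subst ereal_tendsto_simps1)
  have "(LBINT x=ereal 1..\<infinity>. complex_of_real x powr (s - 1)) = 0 - F 1"
    by (rule interval_integral_FTC_integrable[where F=F])
      (use int d c A' B' assms in auto)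
  thus "(LBINT x:{1<..}. complex_of_real x powr (s - 1)) = - 1 / s"
    using assms by (simp add: interval_lebesgue_integral_def F_def)
qed

text \<open>Differentiation under the integral by dominated convergence along sequences. A local
  dominating function for \<open>f\<close> itself suffices: Cauchy's inequality on discs of half the
  radius turns it into a bound for the derivative in s, and hence for the difference
  quotients.\<close>

lemma holomorphic_on_lebesgue_integral:
  fixes f :: "complex \<Rightarrow> 'a \<Rightarrow> complex"
  assumes S: "open S"
    and meas: "\<And>s. s \<in> S \<Longrightarrow> f s \<in> borel_measurable M"
    and hol: "\<And>x. x \<in> space M \<Longrightarrow> (\<lambda>s. f s x) holomorphic_on S"
    and bd: "\<And>s. s \<in> S \<Longrightarrow> \<exists>r>0. \<exists>w. cball s r \<subseteq> S \<and> integrable M w \<and>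
       (\<forall>z\<in>cball s r. \<forall>x\<in>space M. norm (f z x) \<le> w x)"
  shows "(\<lambda>s. \<integral>x. f s x \<partial>M) holomorphic_on S"
proof -
  have "\<exists>D. ((\<lambda>s. \<integral>x. f s x \<partial>M) has_field_derivative D) (at s)" if s: "s \<in> S" for s
  proof -
    from bd[OF s] obtain r w where r: "r > 0" "cball s r \<subseteq> S" and w: "integrable M w"
      and le: "\<And>z x. z \<in> cball s r \<Longrightarrow> x \<in> space M \<Longrightarrow> norm (f z x) \<le> w x" by blast
    have int: "integrable M (f z)" if "z \<in> cball s r" for z
      by (rule Bochner_Integration.integrable_bound[OF w])
         (use that r meas le in \<open>auto intro!: AE_I2 order_trans[OF le abs_ge_self]\<close>)
    have db: "norm (deriv (\<lambda>s. f s x) z) \<le> w x / (r / 2)" if "z \<in> ball s (r/2)" "x \<in> space M" for z x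
    proof -
      have sub: "cball z (r/2) \<subseteq> cball s r"
      proof
        fix y assume "y \<in> cball z (r/2)"
        thus "y \<in> cball s r" using that dist_triangle[of s y z] by (auto simp: dist_commute)
      qed
      have h: "(\<lambda>s. f s x) holomorphic_on cball z (r/2)"
        by (rule holomorphic_on_subset[OF hol]) (use that sub r in auto)
      have "norm ((deriv ^^ 1) (\<lambda>s. f s x) z) \<le> fact 1 * w x / (r/2) ^ 1"
      proof (rule Cauchy_inequality)
        show "(\<lambda>s. f s x) holomorphic_on ball z (r/2)"
          using h holomorphic_on_subset ball_subset_cball by blast
        show "continuous_on (cball z (r/2)) (\<lambda>s. f s x)"
          using h by (rule holomorphic_on_imp_continuous_on)
        show "cmod (f y x) \<le> w x" if "cmod (z - y) = r / 2" for y
          by (rule le) (use that sub \<open>x \<in> space M\<close> in \<open>auto simp: dist_norm subset_iff\<close>)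
      qed (use r in auto)
      thus ?thesis by simp
    qed
    define D where "D = (\<integral>x. deriv (\<lambda>s. f s x) s \<partial>M)"
    have conv: "(\<lambda>n. (\<integral>x. f (z n) x \<partial>M - \<integral>x. f s x \<partial>M) / (z n - s)) \<longlonglongrightarrow> D"
      if z: "\<And>n. z n \<in> ball s (r/2) - {s}" "z \<longlonglongrightarrow> s" for z
    proof -
      have lim: "(\<lambda>n. (f (z n) x - f s x) / (z n - s)) \<longlonglongrightarrow> deriv (\<lambda>s. f s x) s" if "x \<in> space M" for x
      proof -
        have "((\<lambda>s. f s x) has_field_derivative deriv (\<lambda>s. f s x) s) (at s)"
          by (rule holomorphic_derivI[OF hol S s]) (rule that)
        thus ?thesis unfolding has_field_derivative_iff
          using z by (auto simp: tendsto_at_iff_sequentially o_def)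
      qed
      have b: "norm ((f (z n) x - f s x) / (z n - s)) \<le> w x / (r/2)" if "x \<in> space M" for x n
      proof -
        have "norm (f (z n) x - f s x) \<le> w x / (r/2) * norm (z n - s)"
        proof (rule field_differentiable_bound[where S = "ball s (r/2)"])
          fix y assume y: "y \<in> ball s (r/2)"
          have "y \<in> S" using y r by auto
          thus "((\<lambda>a. f a x) has_field_derivative deriv (\<lambda>s. f s x) y) (at y within ball s (r/2))"
            using holomorphic_derivI[OF hol[OF that] S] has_field_derivative_at_within by blast
          show "norm (deriv (\<lambda>s. f s x) y) \<le> w x / (r/2)" using db y that by blast
        qed (use z r in auto)
        thus ?thesis using z(1)[of n] by (simp add: norm_divide divide_le_eq)
      qed
      have zS: "z n \<in> S" "z n \<in> cball s r" for n using z(1)[of n] r by auto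
      have "(\<lambda>n. \<integral>x. (f (z n) x - f s x) / (z n - s) \<partial>M) \<longlonglongrightarrow> D"
        unfolding D_def
      proof (rule integral_dominated_convergence[where w = "\<lambda>x. w x / (r/2)"])
        show *: "(\<lambda>x. (f (z n) x - f s x) / (z n - s)) \<in> borel_measurable M" for n
          using meas[OF zS(1)[of n]] meas[OF s] by measurable
        \<comment> \<open>The derivative is measurable in x as a pointwise limit of difference
          quotients.\<close>
        show "(\<lambda>x. deriv (\<lambda>s. f s x) s) \<in> borel_measurable M"
          by (rule borel_measurable_LIMSEQ_metric[OF * lim])
      qed (use w lim b in auto)
      moreover have "(\<integral>x. (f (z n) x - f s x) / (z n - s) \<partial>M) =
          (\<integral>x. f (z n) x \<partial>M - \<integral>x. f s x \<partial>M) / (z n - s)" for n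
        using int[OF zS(2)[of n]] int[of s] r by simp
      ultimately show ?thesis by (simp only:)
    qed
    have "((\<lambda>z. (\<integral>x. f z x \<partial>M - \<integral>x. f s x \<partial>M) / (z - s)) \<longlongrightarrow> D) (at s within ball s (r/2))"
      unfolding tendsto_at_iff_sequentially o_def using conv by auto
    hence "((\<lambda>z. (\<integral>x. f z x \<partial>M - \<integral>x. f s x \<partial>M) / (z - s)) \<longlongrightarrow> D) (at s)"
      using r at_within_open[of s "ball s (r/2)"] by simp
    thus ?thesis unfolding has_field_derivative_iff by blast
  qed
  thus ?thesis using S holomorphic_on_open by blast
qed

section \<open>Mellin transforms over (0,1)\<close>

definition mellin :: "(real \<Rightarrow> real) \<Rightarrow> complex \<Rightarrow> complex" where
  "mellin k s = (LBINT x:{0<..<1}. of_real (k x) * of_real x powr (s - 1))"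

text \<open>On (0,1) powers of x decrease as the exponent grows, so absolute convergence at one
  abscissa \<sigma> controls the whole half-plane to its right.\<close>

lemma mellin_integrand_integrable:
  assumes [measurable]: "k \<in> borel_measurable borel"
    and k: "set_integrable lborel {0<..<1} (\<lambda>x. \<bar>k x\<bar> * x powr (\<sigma> - 1))" and s: "Re s \<ge> \<sigma>"
  shows "set_integrable lborel {0<..<1} (\<lambda>x. complex_of_real (k x) * of_real x powr (s - 1))"
proof (rule set_integrable_real_bound[OF k])
  show "set_borel_measurable lborel {0<..<1} (\<lambda>x. complex_of_real (k x) * of_real x powr (s - 1))"
    unfolding set_borel_measurable_def by measurable
  fix x :: real assume x: "x \<in> {0<..<1}"
  have "x powr (Re s - 1) \<le> x powr (\<sigma> - 1)"
    using x s by (intro powr_mono') auto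
  thus "norm (complex_of_real (k x) * of_real x powr (s - 1)) \<le> \<bar>k x\<bar> * x powr (\<sigma> - 1)"
    using x by (auto simp: norm_mult norm_powr_of_real intro!: mult_left_mono)
qed auto

lemma norm_mellin_le:
  assumes [measurable]: "k \<in> borel_measurable borel"
    and k: "set_integrable lborel {0<..<1} (\<lambda>x. \<bar>k x\<bar> * x powr (\<sigma> - 1))" and s: "Re s \<ge> \<sigma>"
  shows "norm (mellin k s) \<le> (LBINT x:{0<..<1}. \<bar>k x\<bar> * x powr (\<sigma> - 1))"
proof -
  have "norm (mellin k s) \<le> (LBINT x:{0<..<1}. norm (complex_of_real (k x) * of_real x powr (s - 1)))"
    unfolding mellin_def by (rule set_integral_norm_bound[OF mellin_integrand_integrable[OF assms]])
  also have "\<dots> \<le> (LBINT x:{0<..<1}. \<bar>k x\<bar> * x powr (\<sigma> - 1))"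
  proof (rule set_integral_mono[OF _ k])
    show "set_integrable lborel {0<..<1} (\<lambda>x. norm (complex_of_real (k x) * of_real x powr (s - 1)))"
      by (rule set_integrable_norm[OF mellin_integrand_integrable[OF assms]])
    fix x :: real assume x: "x \<in> {0<..<1}"
    have "x powr (Re s - 1) \<le> x powr (\<sigma> - 1)"
      using x s by (intro powr_mono') auto
    thus "norm (complex_of_real (k x) * of_real x powr (s - 1)) \<le> \<bar>k x\<bar> * x powr (\<sigma> - 1)"
      using x by (auto simp: norm_mult norm_powr_of_real intro!: mult_left_mono)
  qed
  finally show ?thesis .
qed

lemma mellin_holomorphic:
  assumes [measurable]: "k \<in> borel_measurable borel"
    and k: "\<And>\<sigma>. \<sigma> > a \<Longrightarrow> set_integrable lborel {0<..<1} (\<lambda>x. \<bar>k x\<bar> * x powr (\<sigma> - 1))"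
  shows "mellin k holomorphic_on {s. Re s > a}"
  unfolding mellin_def[abs_def] set_lebesgue_integral_def
proof (rule holomorphic_on_lebesgue_integral)
  show "open {s. Re s > a}" by (rule open_halfspace_Re_gt)
  show "(\<lambda>x. indicator {0<..<1} x *\<^sub>R (complex_of_real (k x) * of_real x powr (s - 1))) \<in> borel_measurable lborel" for s
    by measurable
  show "(\<lambda>s. indicator {0<..<1} x *\<^sub>R (complex_of_real (k x) * of_real x powr (s - 1)))
      holomorphic_on {s. a < Re s}" for x
    by (cases "x = 0") (auto intro!: holomorphic_intros)
  fix s assume "s \<in> {s. a < Re s}"
  then obtain d e where de: "d > 0" "e > a" "\<And>x. x \<in> cball s d \<Longrightarrow> Re x \<ge> e"
    using Re_cball_gt[of a s] by auto
  show "\<exists>r>0. \<exists>w. cball s r \<subseteq> {s. a < Re s} \<and> integrable lborel w \<and> (\<forall>z\<in>cball s r. \<forall>x\<in>space lborel.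
         norm (indicator {0<..<1} x *\<^sub>R (complex_of_real (k x) * of_real x powr (z - 1))) \<le> w x)"
  proof (intro exI conjI ballI)
    show "integrable lborel (\<lambda>x. indicator {0<..<1} x *\<^sub>R (\<bar>k x\<bar> * x powr (e - 1)))"
      using k[OF de(2)] unfolding set_integrable_def .
    fix z x assume z: "z \<in> cball s d"
    have "x powr (Re z - 1) \<le> x powr (e - 1)" if "x \<in> {0<..<1}" for x :: real
      using that de(3)[OF z] by (intro powr_mono') auto
    thus "norm (indicator {0<..<1} x *\<^sub>R (complex_of_real (k x) * of_real x powr (z - 1)))
            \<le> indicator {0<..<1} x *\<^sub>R (\<bar>k x\<bar> * x powr (e - 1))"
      by (auto simp: norm_mult norm_powr_of_real indicator_def intro!: mult_left_mono)
  qed (use de in fastforce)+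
qed

lemma bounded_mellin_integrable:
  fixes k :: "real \<Rightarrow> real"
  assumes [measurable]: "k \<in> borel_measurable borel" and bd: "\<And>x. \<bar>k x\<bar> \<le> C" and "\<sigma> > 0"
  shows "set_integrable lborel {0<..<1} (\<lambda>x. \<bar>k x\<bar> * x powr (\<sigma> - 1))"
    and "(LBINT x:{0<..<1}. \<bar>k x\<bar> * x powr (\<sigma> - 1)) \<le> C / \<sigma>"
proof -
  have "set_integrable lborel {0<..<1} (\<lambda>x. x powr (\<sigma> - 1))"
    by (rule powr_set_integral_0) (use assms in auto)
  hence i: "set_integrable lborel {0<..<1} (\<lambda>x. C * x powr (\<sigma> - 1))" by simp
  show j: "set_integrable lborel {0<..<1} (\<lambda>x. \<bar>k x\<bar> * x powr (\<sigma> - 1))"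
    by (rule set_integrable_bound[OF i])
       (use bd[of 0] in \<open>auto simp: set_borel_measurable_def abs_mult intro!: AE_I2 mult_right_mono bd order_trans[OF bd abs_ge_self]\<close>)
  have "(LBINT x:{0<..<1}. \<bar>k x\<bar> * x powr (\<sigma> - 1)) \<le> (LBINT x:{0<..<1}. C * x powr (\<sigma> - 1))"
    by (rule set_integral_mono[OF j i]) (auto intro!: mult_right_mono bd)
  also have "\<dots> = C / \<sigma>"
    using powr_set_integral_0(2)[of \<sigma> 1] assms by simp
  finally show "(LBINT x:{0<..<1}. \<bar>k x\<bar> * x powr (\<sigma> - 1)) \<le> C / \<sigma>" .
qed

lemma bounded_mellin:
  assumes "k \<in> borel_measurable borel" and "\<And>x. \<bar>k x\<bar> \<le> C"
  shows "mellin k holomorphic_on {s. Re s > 0}"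
    and "Re s > 0 \<Longrightarrow> norm (mellin k s) \<le> C / Re s"
  using bounded_mellin_integrable[OF assms, of "Re s"]
  by (auto intro!: mellin_holomorphic order_trans[OF norm_mellin_le[where \<sigma> = "Re s"]]
        bounded_mellin_integrable[where C = C] assms)

section \<open>The fractional part of 1/x and its relation to zeta\<close>

lemma frac_borel_measurable [measurable]: "(frac :: real \<Rightarrow> real) \<in> borel_measurable borel"
  unfolding frac_def by measurable

abbreviation frac_inverse :: "real \<Rightarrow> real" where "frac_inverse \<equiv> (\<lambda>x. frac (1 / x))"

lemma frac_abs_le_1: "\<bar>frac (x::real)\<bar> \<le> 1"
  using frac_lt_1[of x] frac_ge_0[of x] by linarith

text \<open>Counting: the integers n >= 1 with x \<le> 1/n are those up to 1/x. The indicators that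
  occur have the terms of the zeta series, divided by s, as Mellin transforms.\<close>

lemma floor_inverse_sums:
  fixes x :: real
  assumes "0 < x"
  shows "(\<lambda>n. indicator {0<..1 / real (Suc n)} x) sums (of_int \<lfloor>1/x\<rfloor> :: real)"
proof -
  define N where "N = nat \<lfloor>1/x\<rfloor>"
  have *: "x \<le> 1 / real (Suc n) \<longleftrightarrow> n < N" for n
  proof -
    have "x \<le> 1 / real (Suc n) \<longleftrightarrow> real (Suc n) \<le> 1 / x"
      using assms by (simp add: field_simps)
    also have "\<dots> \<longleftrightarrow> int (Suc n) \<le> \<lfloor>1/x\<rfloor>" by (simp add: le_floor_iff)
    finally show ?thesis unfolding N_def by linarith
  qed
  have "(\<lambda>n. indicator {0<..1 / real (Suc n)} x) = (\<lambda>n. if n \<in> {..<N} then 1 else 0 :: real)"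
    using * assms by (auto simp: fun_eq_iff indicator_def simp del: of_nat_Suc)
  moreover have "(\<lambda>n. if n \<in> {..<N} then 1 else 0 :: real) sums (\<Sum>n\<in>{..<N}. 1)"
    by (rule sums_If_finite_set) auto
  moreover have "(\<Sum>n\<in>{..<N}. 1::real) = of_int \<lfloor>1/x\<rfloor>"
    using assms by (simp add: N_def)
  ultimately show ?thesis by metis
qed

lemma set_integral_Ioc_eq_Ioo:
  fixes f :: "real \<Rightarrow> 'a :: {banach, second_countable_topology}"
  assumes [measurable]: "f \<in> borel_measurable borel"
  shows "set_integrable lborel {a<..b} f \<longleftrightarrow> set_integrable lborel {a<..<b} f"
    and "(LBINT x:{a<..b}. f x) = (LBINT x:{a<..<b}. f x)"
proof -
  have "AE x in lborel. x \<noteq> b" by (rule AE_lborel_singleton)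
  hence AE: "AE x in lborel. indicator {a<..b} x *\<^sub>R f x = indicator {a<..<b} x *\<^sub>R f x"
    by eventually_elim (auto simp: indicator_def)
  show "set_integrable lborel {a<..b} f \<longleftrightarrow> set_integrable lborel {a<..<b} f"
    unfolding set_integrable_def by (intro integrable_cong_AE AE) auto
  show "(LBINT x:{a<..b}. f x) = (LBINT x:{a<..<b}. f x)"
    unfolding set_lebesgue_integral_def by (intro integral_cong_AE AE) auto
qed

lemma of_real_inverse_powr:
  assumes "r > 0"
  shows "complex_of_real (1 / r) powr s = 1 / complex_of_real r powr s"
proof -
  have "complex_of_real (1 / r) powr s = exp (s * of_real (ln (1 / r)))"
    using assms by (subst powr_def, subst Ln_of_real) auto
  also have "\<dots> = exp (- (s * of_real (ln r)))"
    using assms by (simp add: ln_div)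
  also have "\<dots> = 1 / complex_of_real r powr s"
    using assms by (simp add: exp_minus powr_def Ln_of_real inverse_eq_divide)
  finally show ?thesis .
qed

text \<open>Termwise integration of the indicator expansion, where the interval (0, 1/n] contributes
  n^(-s)/s. The L1 norms of the terms are the same expressions at Re s, hence summable.\<close>

lemma mellin_floor:
  assumes s: "Re s > 1"
  shows "set_integrable lborel {0<..<1} (\<lambda>x. of_int \<lfloor>1/x\<rfloor> * complex_of_real x powr (s - 1))"
    and "(LBINT x:{0<..<1}. of_int \<lfloor>1/x\<rfloor> * complex_of_real x powr (s - 1)) = zeta s / s"
proof -
  define f where "f = (\<lambda>n x. indicator {0<..1 / real (Suc n)} x *\<^sub>R complex_of_real x powr (s - 1))"
  have int: "integrable lborel (f n)" for n
    using powr_set_integral_0_complex(1)[of s "1 / real (Suc n)"] s set_integral_Ioc_eq_Ioo(1)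
    unfolding f_def set_integrable_def[symmetric] by (subst set_integral_Ioc_eq_Ioo) auto
  have val: "integral\<^sup>L lborel (f n) = 1 / of_nat (Suc n) powr s / s" for n
  proof -
    have "integral\<^sup>L lborel (f n) = of_real (1 / real (Suc n)) powr s / s"
      unfolding f_def set_lebesgue_integral_def[symmetric]
      using s by (subst set_integral_Ioc_eq_Ioo, measurable, subst powr_set_integral_0_complex) auto
    also have "of_real (1 / real (Suc n)) powr s = 1 / of_nat (Suc n) powr s"
      using of_real_inverse_powr[of "real (Suc n)" s] by (simp del: of_nat_Suc)
    finally show ?thesis .
  qed
  have nval: "(\<integral>x. norm (f n x) \<partial>lborel) = real (Suc n) powr (- Re s) / Re s" for n
  proof -
    have "(\<integral>x. norm (f n x) \<partial>lborel) = (LBINT x:{0<..1 / real (Suc n)}. x powr (Re s - 1))"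
      unfolding set_lebesgue_integral_def f_def
      by (intro Bochner_Integration.integral_cong) (auto simp: indicator_def norm_powr_of_real)
    also have "\<dots> = (1 / real (Suc n)) powr Re s / Re s"
      using s by (subst set_integral_Ioc_eq_Ioo, measurable, subst powr_set_integral_0) auto
    also have "(1 / real (Suc n)) powr Re s = real (Suc n) powr (- Re s)"
      by (simp add: powr_divide powr_minus_divide del: of_nat_Suc)
    finally show ?thesis .
  qed
  have sm: "(\<lambda>n. f n x) sums (of_int \<lfloor>1/x\<rfloor> * complex_of_real x powr (s - 1) )" if "x > 0" for x
  proof -
    have "(\<lambda>n. of_real (indicator {0<..1 / real (Suc n)} x) * complex_of_real x powr (s - 1))
       sums (of_real (of_int \<lfloor>1/x\<rfloor>) * complex_of_real x powr (s - 1))"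
      by (intro sums_mult2 sums_of_real floor_inverse_sums that)
    thus ?thesis by (simp add: f_def scaleR_conv_of_real)
  qed
  have f0: "f n x = 0" if "x \<le> 0 \<or> x > 1" for n x
  proof -
    have "1 / real (Suc n) \<le> 1" by simp
    hence "\<not> (0 < x \<and> x \<le> 1 / real (Suc n))" using that by linarith
    hence "x \<notin> {0<..1 / real (Suc n)}" by simp
    thus ?thesis by (simp add: f_def del: of_nat_Suc)
  qed
  have nsm: "summable (\<lambda>n. norm (f n x))" for x
  proof (cases "x > 0")
    case True
    have "(\<lambda>n. indicator {0<..1 / real (Suc n)} x * x powr (Re s - 1))
       sums (of_int \<lfloor>1/x\<rfloor> * x powr (Re s - 1))"
      by (intro sums_mult2 floor_inverse_sums True)
    thus ?thesis using True
      by (auto simp: f_def norm_powr_of_real norm_mult sums_iff)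
  qed (use f0 in auto)
  have "summable (\<lambda>n. real n powr (- Re s))" using s by (subst summable_real_powr_iff) auto
  hence "summable (\<lambda>n. real (Suc n) powr (- Re s))" by (subst summable_Suc_iff)
  hence sn: "summable (\<lambda>n. \<integral>x. norm (f n x) \<partial>lborel)"
    unfolding nval by (rule summable_divide)
  have S: "(\<Sum>n. f n x) = indicator {0<..1} x *\<^sub>R (of_int \<lfloor>1/x\<rfloor> * complex_of_real x powr (s - 1))" for x
    using sm[of x] f0[of x] by (cases "0 < x \<and> x \<le> 1") (auto simp: sums_iff)
  have "set_integrable lborel {0<..1} (\<lambda>x. of_int \<lfloor>1/x\<rfloor> * complex_of_real x powr (s - 1))"
    using integrable_suminf[OF int AE_I2[OF nsm] sn] unfolding S set_integrable_def .
  thus "set_integrable lborel {0<..<1} (\<lambda>x. of_int \<lfloor>1/x\<rfloor> * complex_of_real x powr (s - 1))"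
    by (subst (asm) set_integral_Ioc_eq_Ioo) auto
  have "(\<lambda>n. integral\<^sup>L lborel (f n)) sums
      (LBINT x:{0<..1}. of_int \<lfloor>1/x\<rfloor> * complex_of_real x powr (s - 1))"
    using sums_integral[OF int AE_I2[OF nsm] sn] unfolding S set_lebesgue_integral_def .
  hence "(\<lambda>n. 1 / of_nat (Suc n) powr s / s) sums
      (LBINT x:{0<..<1}. of_int \<lfloor>1/x\<rfloor> * complex_of_real x powr (s - 1))"
    unfolding val by (subst (asm) set_integral_Ioc_eq_Ioo) auto
  moreover have "(\<lambda>n. 1 / of_nat (Suc n) powr s / s) sums (zeta s / s)"
    using is_zeta_zeta zeta_series_summable[OF s] s unfolding is_zeta_def
    by (intro sums_divide) (auto simp: sums_iff)
  ultimately show "(LBINT x:{0<..<1}. of_int \<lfloor>1/x\<rfloor> * complex_of_real x powr (s - 1)) = zeta s / s"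
    using sums_unique2 by blast
qed

text \<open>Split {1/x} = 1/x - floor(1/x). Both parts have a transform only for Re s > 1, while the
  left-hand side converges for Re s > 0; this difference is what continues zeta.\<close>

lemma mellin_frac_inverse_gt_1:
  assumes s: "Re s > 1"
  shows "mellin frac_inverse s = 1 / (s - 1) - zeta s / s"
proof -
  have i: "set_integrable lborel {0<..<1} (\<lambda>x. complex_of_real x powr ((s - 1) - 1))"
    "(LBINT x:{0<..<1}. complex_of_real x powr ((s - 1) - 1)) = 1 / (s - 1)"
    using powr_set_integral_0_complex[of "s - 1" 1] s by auto
  have "mellin frac_inverse s = (LBINT x:{0<..<1}. complex_of_real x powr ((s - 1) - 1) -
          of_int \<lfloor>1/x\<rfloor> * complex_of_real x powr (s - 1))"
    unfolding mellin_def
  proof (rule set_lebesgue_integral_cong)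
    show "\<forall>x. x \<in> {0<..<1::real} \<longrightarrow> complex_of_real (frac (1 / x)) * complex_of_real x powr (s - 1) =
       complex_of_real x powr (s - 1 - 1) - of_int \<lfloor>1 / x\<rfloor> * complex_of_real x powr (s - 1)"
    proof (intro allI impI)
      fix x :: real assume "x \<in> {0<..<1}"
      have "complex_of_real x powr (s - 1 - 1) = complex_of_real x powr (s - 1) / of_real x powr 1"
        by (rule powr_diff)
      also have "of_real x powr 1 = complex_of_real x"
        using \<open>x \<in> {0<..<1}\<close> by (subst powr_to_1) auto
      finally have *: "complex_of_real x powr (s - 1 - 1) = complex_of_real x powr (s - 1) / of_real x" .
      show "complex_of_real (frac (1 / x)) * complex_of_real x powr (s - 1) =
       complex_of_real x powr (s - 1 - 1) - of_int \<lfloor>1 / x\<rfloor> * complex_of_real x powr (s - 1)"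
        unfolding * by (simp add: frac_def left_diff_distrib)
    qed
  qed auto
  also have "\<dots> = 1 / (s - 1) - zeta s / s"
    using i mellin_floor[OF s] by (subst set_integral_diff) auto
  finally show ?thesis .
qed

text \<open>This is (s-1) zeta(s) on Re s > 0 with the pole at 1 removed (the value there is 1). In
  this form holomorphy and a polynomial bound are immediate, because the integrand contains a
  function with values in [0,1).\<close>

definition zeta_reg :: "complex \<Rightarrow> complex" where
  "zeta_reg s = s - s * (s - 1) * mellin frac_inverse s"

lemma frac_inverse_measurable [measurable]: "frac_inverse \<in> borel_measurable borel"
  by measurable

lemmas mellin_frac_inverse_holomorphic = bounded_mellin(1)[OF frac_inverse_measurable frac_abs_le_1]
  and norm_mellin_frac_inverse = bounded_mellin(2)[OF frac_inverse_measurable frac_abs_le_1]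

lemma zeta_reg_holomorphic: "zeta_reg holomorphic_on {s. Re s > 0}"
  unfolding zeta_reg_def[abs_def] by (intro holomorphic_intros mellin_frac_inverse_holomorphic)

lemma norm_zeta_reg_le:
  assumes "Re s > 0"
  shows "norm (zeta_reg s) \<le> norm s + norm s * norm (s - 1) / Re s"
proof -
  have "norm (zeta_reg s) \<le> norm s + norm (s * (s - 1) * mellin frac_inverse s)"
    unfolding zeta_reg_def by (rule norm_triangle_ineq4)
  also have "norm (s * (s - 1) * mellin frac_inverse s) \<le> norm (s * (s - 1)) * (1 / Re s)"
    unfolding norm_mult[of "s * (s - 1)"]
    by (intro mult_left_mono norm_mellin_frac_inverse assms) auto
  finally show ?thesis by (simp add: norm_mult)
qed

lemma zeta_reg_eq:
  assumes "Re s > 0" "s \<noteq> 1"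
  shows "zeta_reg s = (s - 1) * zeta s"
proof (rule analytic_continuation_open[where s = "{s. Re s > 1}" and s' = "{s. Re s > 0} - {1}"
      and f = zeta_reg and g = "\<lambda>s. (s - 1) * zeta s"])
  show "open {s. 1 < Re s}" by (rule open_halfspace_Re_gt)
  show "open ({s. Re s > 0} - {1})" by (intro open_Diff open_halfspace_Re_gt) auto
  show "{s. 1 < Re s} \<noteq> {}" by (auto intro!: exI[of _ 2])
  show "connected ({s. Re s > 0} - {1::complex})"
    by (intro connected_open_delete convex_connected convex_halfspace_Re_gt open_halfspace_Re_gt) auto
  show "zeta_reg holomorphic_on {s. Re s > 0} - {1}"
    by (rule holomorphic_on_subset[OF zeta_reg_holomorphic]) auto
  show "(\<lambda>s. (s - 1) * zeta s) holomorphic_on {s. Re s > 0} - {1}"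
    using is_zeta_zeta holomorphic_on_subset[of zeta "-{1}" "{s. Re s > 0} - {1}"]
    unfolding is_zeta_def by (intro holomorphic_intros) auto
  show "zeta_reg s = (s - 1) * zeta s" if "s \<in> {s. 1 < Re s}" for s
  proof -
    have "s \<noteq> 0" "s \<noteq> 1" using that by auto
    have "zeta_reg s = s - s * (s - 1) * (1 / (s - 1) - zeta s / s)"
      unfolding zeta_reg_def using mellin_frac_inverse_gt_1[of s] that by simp
    also have "\<dots> = (s - 1) * zeta s"
      using \<open>s \<noteq> 0\<close> \<open>s \<noteq> 1\<close> by (simp add: field_simps)
    finally show ?thesis .
  qed
qed (use assms in auto)

section \<open>A bound for quotients of holomorphic functions\<close>

text \<open>Harnack's inequality for the positive harmonic function ln (M / |f|), obtained from the
  Schwarz lemma. A zero-free f has a logarithm on the disc, which yields a holomorphic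
  \<open>L\<close> with positive real part ln M - ln |f|; its Cayley transform \<open>\<phi>\<close>
  maps the disc to itself and fixes 0.\<close>

lemma harnack_lower_bound:
  assumes hol: "f holomorphic_on ball 0 1" and nz: "\<And>z. z \<in> ball 0 1 \<Longrightarrow> f z \<noteq> 0"
    and le: "\<And>z. z \<in> ball 0 1 \<Longrightarrow> norm (f z) < M"
    and z: "norm z \<le> r" "0 < r" "r < 1"
  shows "norm (f z) \<ge> M * (norm (f 0) / M) powr ((1 + r) / (1 - r))"
proof -
  have M: "M > 0" by (rule order.strict_trans1[OF norm_ge_zero le[of 0]]) simp
  have z1: "norm z < 1" using z by simp
  obtain g where g: "g holomorphic_on ball 0 1" "\<And>x. x \<in> ball 0 1 \<Longrightarrow> exp (g x) = f x"
    using holomorphic_logarithm_exists[of "ball 0 1" f 0] hol nz by auto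
  \<comment> \<open>The added imaginary constant makes \<open>L 0\<close> the real number
    \<open>a\<close>, so that \<open>\<phi>\<close> vanishes at 0.\<close>
  define L where "L = (\<lambda>z. of_real (ln M) - g z + \<i> * Im (g 0))"
  have ReL: "Re (L x) = ln M - ln (norm (f x))" if "x \<in> ball 0 1" for x
    by (simp add: L_def flip: g(2)[OF that])
  have pos: "Re (L x) > 0" if "x \<in> ball 0 1" for x
    using ReL[OF that] le[OF that] nz[OF that] M by simp
  define a where "a = Re (L 0)"
  have a: "a > 0" unfolding a_def by (rule pos) simp
  have L0: "L 0 = of_real a" unfolding a_def by (simp add: L_def complex_eq_iff)
  have nz': "L x + of_real a \<noteq> 0" if "x \<in> ball 0 1" for x
    using pos[OF that] a by (auto simp: complex_eq_iff)
  define \<phi> where "\<phi> = (\<lambda>z. (L z - of_real a) / (L z + of_real a))"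
  have bound: "norm (\<phi> z) \<le> norm z"
  proof (rule Schwarz_Lemma(1))
    show "\<phi> holomorphic_on ball 0 1"
      unfolding \<phi>_def L_def by (intro holomorphic_intros g) (use nz' in \<open>auto simp: L_def\<close>)
    show "\<phi> 0 = 0" by (simp add: \<phi>_def L0)
    fix x :: complex assume "norm x < 1"
    hence x: "x \<in> ball 0 1" by simp
    have "norm (L x - of_real a) ^ 2 < norm (L x + of_real a) ^ 2"
      using mult_pos_pos[OF pos[OF x] a] unfolding cmod_power2
      by (simp add: power2_eq_square algebra_simps)
    hence "norm (L x - of_real a) < norm (L x + of_real a)"
      by (rule power2_less_imp_less) simp
    thus "norm (\<phi> x) < 1" using nz'[OF x] by (simp add: \<phi>_def norm_divide)
  qed fact
  have zb: "z \<in> ball 0 1" using z1 by simp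
  have "norm (L z - of_real a) \<le> r * norm (L z + of_real a)"
  proof -
    have "norm (L z - of_real a) \<le> norm z * norm (L z + of_real a)"
      using bound nz'[OF zb] by (simp add: \<phi>_def norm_divide divide_le_eq)
    also have "\<dots> \<le> r * norm (L z + of_real a)"
      using z by (intro mult_right_mono) auto
    finally show ?thesis .
  qed
  also have "\<dots> \<le> r * (norm (L z) + a)"
    using z a by (intro mult_left_mono order_trans[OF norm_triangle_ineq]) auto
  finally have "norm (L z - of_real a) \<le> r * (norm (L z) + a)" .
  moreover have "norm (L z) - a \<le> norm (L z - of_real a)"
    using norm_triangle_ineq2[of "L z" "of_real a"] a by simp
  \<comment> \<open>Solving |L| - a \<le> r (|L| + a) for |L| produces the Harnack factor
    (1+r)/(1-r).\<close>
  ultimately have "norm (L z) * (1 - r) \<le> (1 + r) * a" by (simp add: algebra_simps)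
  moreover have "Re (L z) * (1 - r) \<le> norm (L z) * (1 - r)"
    using z by (intro mult_right_mono complex_Re_le_cmod) auto
  ultimately have "Re (L z) \<le> (1 + r) / (1 - r) * a"
    using z by (simp add: field_simps)
  hence "ln M - ln (norm (f z)) \<le> (1 + r) / (1 - r) * (ln M - ln (norm (f 0)))"
    unfolding a_def using ReL[OF zb] ReL[of 0] by simp
  hence "ln M + (1 + r) / (1 - r) * (ln (norm (f 0)) - ln M) \<le> ln (norm (f z))"
    unfolding right_diff_distrib by linarith
  hence "exp (ln M + (1 + r) / (1 - r) * (ln (norm (f 0)) - ln M)) \<le> norm (f z)"
    using nz[OF zb] by (subst (asm) ln_ge_iff) auto
  thus ?thesis using M nz[of 0] by (simp add: exp_add powr_def ln_div mult_ac)
qed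

text \<open>Numerator and denominator of the Blaschke factor at \<open>p\<close> are conjugate up to
  the unimodular factor z when |z| = 1. Replacing (z - p) by (1 - cnj p z) therefore removes a zero
  without changing moduli on the circle.\<close>

lemma moebius_factor:
  fixes p z :: complex
  assumes "norm p < 1"
  shows "norm z \<le> 1 \<Longrightarrow> 1 - cnj p * z \<noteq> 0"
    and "norm z = 1 \<Longrightarrow> norm (z - p) = norm (1 - cnj p * z)"
proof -
  show "1 - cnj p * z \<noteq> 0" if "norm z \<le> 1"
  proof
    assume "1 - cnj p * z = 0"
    hence "norm (cnj p * z) = 1" by (metis eq_iff_diff_eq_0 norm_one)
    moreover have "norm (cnj p * z) \<le> norm p * 1"
      using that by (simp add: norm_mult mult_left_le)
    ultimately show False using assms by simp
  qed
  show "norm (z - p) = norm (1 - cnj p * z)" if "norm z = 1"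
  proof -
    have "z * cnj z = 1" using that complex_norm_square[of z] by simp
    hence "1 - cnj p * z = z * cnj (z - p)" by (simp add: algebra_simps)
    thus ?thesis using that by (simp add: norm_mult del: complex_cnj_diff)
  qed
qed

text \<open>The cofactor is glued from the local factorization near \<open>p\<close> and division by
  the power elsewhere; both agree off \<open>p\<close>. The order n = 0 is allowed, so
  \<open>p\<close> may be any point of the domain.\<close>

lemma holomorphic_factor_zero:
  assumes Z: "Z holomorphic_on U" and U: "open U" "connected U" and p: "p \<in> U"
    and nz: "\<exists>w\<in>U. Z w \<noteq> 0"
  obtains n D where "D holomorphic_on U" "\<And>w. w \<in> U \<Longrightarrow> Z w = (w - p) ^ n * D w" "D p \<noteq> (0::complex)"
proof -
  obtain r n g where r: "r > 0" "cball p r \<subseteq> U" "g holomorphic_on cball p r"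
    and g: "\<And>w. w \<in> cball p r \<Longrightarrow> Z w = g w * (w - p) ^ n \<and> g w \<noteq> 0"
    using zorder_exist_zero[OF Z U p nz] by metis
  define D where "D = (\<lambda>w. if w \<in> ball p r then g w else Z w / (w - p) ^ n)"
  have Deq: "D w = Z w / (w - p) ^ n" if "w \<noteq> p" for w
    using that g[of w] by (auto simp: D_def)
  have "D holomorphic_on ball p r"
    by (rule holomorphic_transform[of g]) (auto simp: D_def intro: holomorphic_on_subset[OF r(3)])
  moreover have "D holomorphic_on U - {p}"
    by (rule holomorphic_transform[of "\<lambda>w. Z w / (w - p) ^ n"])
       (auto simp: Deq intro!: holomorphic_intros holomorphic_on_subset[OF Z])
  ultimately have "D holomorphic_on (ball p r \<union> (U - {p}))"
    using U by (intro holomorphic_on_Un) auto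
  moreover have "U = ball p r \<union> (U - {p})" using r p by auto
  ultimately have "D holomorphic_on U" by simp
  moreover have "Z w = (w - p) ^ n * D w" if "w \<in> U" for w
    using g[of p] g[of w] r by (cases "w = p") (auto simp: Deq D_def)
  moreover have "D p \<noteq> 0" using g[of p] r by (simp add: D_def)
  ultimately show ?thesis using that by blast
qed

lemma norm_le_of_unit_circle:
  assumes "f holomorphic_on U" "cball 0 1 \<subseteq> U" "\<And>z. norm z = 1 \<Longrightarrow> norm (f z) \<le> M" "norm z \<le> 1"
  shows "norm (f z) \<le> M"
proof (rule maximum_modulus_frontier[of f "cball 0 1"])
  have f: "f holomorphic_on cball 0 1" using assms holomorphic_on_subset by blast
  show "f holomorphic_on interior (cball 0 1)"
    by (rule holomorphic_on_subset[OF f]) auto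
  show "continuous_on (closure (cball 0 1)) f" using f holomorphic_on_imp_continuous_on by simp
qed (use assms in auto)

text \<open>Dividing both functions by Blaschke factors removes the zeros of the denominator without
  affecting the bounds on the circle, which reduces the claim to Harnack's inequality.\<close>

lemma quotient_bound_unit_disc:
  assumes U: "open U" "connected U" "cball 0 1 \<subseteq> U"
    and "Z holomorphic_on U" "E holomorphic_on U"
    and "\<And>z. norm z = 1 \<Longrightarrow> norm (Z z) \<le> M" "\<And>z. norm z = 1 \<Longrightarrow> norm (E z * Z z) \<le> M"
    and m: "m > 0" "m \<le> norm (Z 0)" and z: "norm z \<le> r" "0 < r" "r < 1"
  shows "norm (E z) \<le> (2 * M / m) powr ((1 + r) / (1 - r))"
  using assms(4,6,7,9)
proof (induction "card {z \<in> ball 0 1. Z z = 0}" arbitrary: Z rule: less_induct)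
  case (less Z)
  let ?A = "{z \<in> ball 0 1. Z z = 0}"
  have in_U: "x \<in> U" if "norm x \<le> 1" for x using U(3) that by auto
  have Z0: "Z 0 \<noteq> 0" using less.prems m by auto
  have EZ: "(\<lambda>z. E z * Z z) holomorphic_on U" by (intro holomorphic_intros less assms)
  have ZM: "norm (Z x) \<le> M" if "norm x \<le> 1" for x
    by (rule norm_le_of_unit_circle[OF less(2) U(3) less(3) that])
  have EZM: "norm (E x * Z x) \<le> M" if "norm x \<le> 1" for x
    by (rule norm_le_of_unit_circle[OF EZ U(3) less(4) that])
  have M: "m \<le> M" "M > 0" using ZM[of 0] less.prems m by auto
  show ?case
  proof (cases "?A = {}")
    case True
    let ?K = "(1 + r) / (1 - r)"
    \<comment> \<open>\<open>harnack_lower_bound\<close> asks for a strict upper bound, hence 2M in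
      place of M.\<close>
    have "norm (Z z) \<ge> 2 * M * (norm (Z 0) / (2 * M)) powr ?K"
    proof (rule harnack_lower_bound)
      show "Z holomorphic_on ball 0 1"
        by (rule holomorphic_on_subset[OF less(2)]) (use in_U in auto)
      show "norm (Z x) < 2 * M" if "x \<in> ball 0 1" for x
        using ZM[of x] M that by auto
    qed (use True z in auto)
    moreover have "(m / (2 * M)) powr ?K \<le> (norm (Z 0) / (2 * M)) powr ?K"
      using M m z less.prems(4) by (intro powr_mono2 divide_right_mono) auto
    hence "M * (m / (2 * M)) powr ?K \<le> 2 * M * (norm (Z 0) / (2 * M)) powr ?K"
      using M by (intro mult_mono) auto
    ultimately have "norm (Z z) \<ge> M * (m / (2 * M)) powr ?K" by linarith
    hence "norm (E z) * (M * (m / (2 * M)) powr ?K) \<le> norm (E z) * norm (Z z)"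
      by (rule mult_left_mono) auto
    also have "\<dots> \<le> M" using EZM[of z] z by (simp add: norm_mult)
    finally have "norm (E z) * (m / (2 * M)) powr ?K \<le> 1" using M by (simp add: mult_ac)
    hence "norm (E z) \<le> 1 / (m / (2 * M)) powr ?K" using M m by (simp add: field_simps)
    also have "\<dots> = (2 * M / m) powr ?K" using M m by (simp add: powr_divide)
    finally show ?thesis .
  next
    case False
    then obtain p where p: "norm p < 1" "Z p = 0" by auto
    obtain n D where D: "D holomorphic_on U" "\<And>w. w \<in> U \<Longrightarrow> Z w = (w - p) ^ n * D w" "D p \<noteq> 0"
      by (rule holomorphic_factor_zero[OF less(2) U(1,2) in_U[of p]])
         (use p Z0 in_U[of 0] in auto)
    have n: "n > 0" using D(2)[of p] D(3) p in_U[of p] by (cases n) auto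
    \<comment> \<open>\<open>Z\<close> divided by the n-th power of the Blaschke factor at
      \<open>p\<close>, with n the full order of the zero. Thus \<open>p\<close> disappears
      altogether and the number of distinct zeros drops. At the origin the modulus can only grow,
      because |p|^n \<le> 1.\<close>
    define Z1 where "Z1 = (\<lambda>w. D w * (1 - cnj p * w) ^ n)"
    note mf = moebius_factor[OF p(1)]
    have sph: "norm (Z1 x) = norm (Z x)" if "norm x = 1" for x
      using D(2)[of x] in_U[of x] mf(2)[OF that] that
      by (simp add: Z1_def norm_mult norm_power mult_ac)
    have "\<not> Z constant_on U"
      using Z0 p in_U[of 0] in_U[of p] unfolding constant_on_def by force
    hence "finite {z \<in> cball 0 1. Z z = 0}"
      by (intro holomorphic_compact_finite_zeros[OF less(2) U(1,2) _ U(3)]) auto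
    hence fin: "finite ?A" by (rule rev_finite_subset) auto
    show ?thesis
    proof (rule less(1))
      show "card {z \<in> ball 0 1. Z1 z = 0} < card ?A"
      proof (rule psubset_card_mono[OF fin])
        have "{z \<in> ball 0 1. Z1 z = 0} \<subseteq> ?A"
          using D(2) in_U mf(1) by (auto simp: Z1_def)
        moreover have "p \<in> ?A" "p \<notin> {z \<in> ball 0 1. Z1 z = 0}"
          using p D(3) mf(1)[of p] by (auto simp: Z1_def)
        ultimately show "{z \<in> ball 0 1. Z1 z = 0} \<subset> ?A" by blast
      qed
      show "Z1 holomorphic_on U" unfolding Z1_def by (intro holomorphic_intros D)
      show "norm (Z1 x) \<le> M" if "norm x = 1" for x
        using less(3)[OF that] sph[OF that] by simp
      show "norm (E x * Z1 x) \<le> M" if "norm x = 1" for x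
        using less(4)[OF that] sph[OF that] by (simp add: norm_mult)
      have "norm (Z 0) = norm p ^ n * norm (D 0)"
        using D(2)[of 0] in_U[of 0] by (simp add: norm_mult norm_power)
      also have "\<dots> \<le> 1 * norm (D 0)"
        using p by (intro mult_right_mono power_le_one) auto
      finally show "m \<le> norm (Z1 0)" using less.prems(4) by (simp add: Z1_def)
    qed
  qed
qed

text \<open>The unit disc estimate transported by the affine map w -> c + R w.\<close>

lemma quotient_bound_disc:
  assumes R: "R > 0" and U: "open U" "connected U" "cball c R \<subseteq> U"
    and "Z holomorphic_on U" "E holomorphic_on U"
    and "\<And>z. z \<in> cball c R \<Longrightarrow> norm (Z z) \<le> M" "\<And>z. z \<in> cball c R \<Longrightarrow> norm (E z * Z z) \<le> M"
    and m: "m > 0" "m \<le> norm (Z c)" and z: "norm (z - c) \<le> r * R" "0 < r" "r < 1"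
  shows "norm (E z) \<le> (2 * M / m) powr ((1 + r) / (1 - r))"
proof -
  define T where "T = (\<lambda>w. c + of_real R * w)"
  \<comment> \<open>As an image of \<open>U\<close> the set is connected; the equivalence proved
    next identifies it with a preimage under \<open>T\<close>, which makes it open.\<close>
  define V where "V = (\<lambda>w. of_real (inverse R) * w + (- of_real (inverse R) * c)) ` U"
  have V: "w \<in> V \<longleftrightarrow> T w \<in> U" for w
  proof
    assume "T w \<in> U"
    moreover have "w = of_real (inverse R) * T w + (- of_real (inverse R) * c)"
      using R by (simp add: T_def field_simps)
    ultimately show "w \<in> V" unfolding V_def by blast
  next
    assume "w \<in> V"
    then obtain u where u: "u \<in> U" "w = of_real (inverse R) * u + (- of_real (inverse R) * c)"
      unfolding V_def by blast
    hence "T w = u" using R by (simp add: T_def field_simps)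
    thus "T w \<in> U" using u by simp
  qed
  have cb: "T w \<in> cball c R" if "norm w \<le> 1" for w
    using that R by (auto simp: T_def dist_norm norm_mult mult_left_le)
  have T: "T holomorphic_on V" unfolding T_def by (intro holomorphic_intros)
  have TV: "T ` V \<subseteq> U" using V by auto
  have "norm ((E \<circ> T) ((z - c) / of_real R)) \<le> (2 * M / m) powr ((1 + r) / (1 - r))"
  proof (rule quotient_bound_unit_disc[where U = V and Z = "Z \<circ> T" and E = "E \<circ> T"])
    have "V = T -` U" using V by auto
    moreover have "open (T -` U)"
      by (rule open_vimage) (auto simp: T_def U intro!: continuous_intros)
    ultimately show "open V" by simp
    show "connected V" unfolding V_def
      by (intro connected_continuous_image continuous_intros U)
    show "cball 0 1 \<subseteq> V" using V cb U(3) unfolding subset_iff by simp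
    show "Z \<circ> T holomorphic_on V" "E \<circ> T holomorphic_on V"
      by (rule holomorphic_on_compose_gen[OF T _ TV], fact)+
    show "m \<le> norm ((Z \<circ> T) 0)" using m by (simp add: T_def)
    show "norm ((z - c) / of_real R) \<le> r" using z R by (simp add: norm_divide field_simps)
  qed (use assms cb in auto)
  thus ?thesis using R by (simp add: T_def)
qed

section \<open>Non-vanishing of zeta on the half-plane Re s >= 1\<close>

definition coprime_nats :: "nat set \<Rightarrow> nat set" where
  "coprime_nats P = {n. n > 0 \<and> (\<forall>p\<in>P. \<not> p dvd n)}"

lemma zeta_has_sum:
  assumes "Re s > 1"
  shows "((\<lambda>n. complex_of_nat n powr (-s)) has_sum zeta s) {0<..}"
    and "(\<lambda>n. norm (complex_of_nat n powr (-s))) summable_on {0<..}"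
proof -
  have nrm: "norm (complex_of_nat (Suc n) powr (-s)) = real (Suc n) powr (- Re s)" for n
    by (simp add: norm_powr_real_powr del: of_nat_Suc)
  have "summable (\<lambda>n. real n powr (- Re s))" using assms by (subst summable_real_powr_iff) auto
  hence sn: "summable (\<lambda>n. norm (complex_of_nat (Suc n) powr (-s)))"
    unfolding nrm by (subst summable_Suc_iff)
  have "(\<lambda>n. 1 / complex_of_nat (Suc n) powr s) sums zeta s"
    using is_zeta_zeta zeta_series_summable[OF assms] assms unfolding is_zeta_def
    by (auto simp: sums_iff)
  hence "(\<lambda>n. complex_of_nat (Suc n) powr (-s)) sums zeta s"
    by (simp add: powr_minus_divide del: of_nat_Suc)
  hence *: "((\<lambda>n. complex_of_nat (Suc n) powr (-s)) has_sum zeta s) UNIV"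
    by (rule norm_summable_imp_has_sum[OF sn])
  have eq: "{0<..} = Suc ` UNIV"
    by (auto simp: image_iff gr0_conv_Suc)
  show "((\<lambda>n. complex_of_nat n powr (-s)) has_sum zeta s) {0<..}"
    unfolding eq using * by (subst has_sum_reindex) (auto simp: o_def simp del: of_nat_Suc)
  have "(\<lambda>n. norm (complex_of_nat (Suc n) powr (-s))) summable_on UNIV"
    using sn by (intro norm_summable_imp_summable_on) (auto simp del: of_nat_Suc)
  thus "(\<lambda>n. norm (complex_of_nat n powr (-s))) summable_on {0<..}"
    unfolding eq by (subst summable_on_reindex) (auto simp: o_def simp del: of_nat_Suc)
qed

lemma of_nat_mult_powr:
  "complex_of_nat (m * n) powr s = complex_of_nat m powr s * complex_of_nat n powr s"
  using powr_times_real[of "of_nat m" "of_nat n" s] by simp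

text \<open>An integer without factors in P either avoids p as well or is p times another integer
  without factors in P; the second class contributes p^(-s) times the full sum. Primality guarantees
  that multiplication by p introduces no factor from P.\<close>

lemma sieve_step:
  assumes s: "Re s > 1" and p: "prime p" "p \<notin> P" and P: "\<And>q. q \<in> P \<Longrightarrow> prime q"
  defines "D \<equiv> \<lambda>P. \<Sum>\<^sub>\<infinity>n\<in>coprime_nats P. complex_of_nat n powr (-s)"
  shows "D (insert p P) = (1 - complex_of_nat p powr (-s)) * D P"
proof -
  have split: "coprime_nats P = coprime_nats (insert p P) \<union> (\<lambda>n. p * n) ` coprime_nats P"
  proof (intro equalityI subsetI)
    fix n assume n: "n \<in> coprime_nats P"
    show "n \<in> coprime_nats (insert p P) \<union> (\<lambda>n. p * n) ` coprime_nats P"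
    proof (cases "p dvd n")
      case True
      then obtain m where m: "n = p * m" by blast
      hence "m \<in> coprime_nats P" using n by (auto simp: coprime_nats_def)
      thus ?thesis using m by blast
    qed (use n in \<open>auto simp: coprime_nats_def\<close>)
  next
    fix n assume "n \<in> coprime_nats (insert p P) \<union> (\<lambda>n. p * n) ` coprime_nats P"
    moreover have "p * m \<in> coprime_nats P" if "m \<in> coprime_nats P" for m
    proof -
      have "\<not> q dvd p * m" if "q \<in> P" for q
        using that P[OF that] p \<open>m \<in> coprime_nats P\<close> primes_dvd_imp_eq[of q p]
        by (auto simp: coprime_nats_def prime_dvd_mult_iff)
      thus ?thesis using that p by (auto simp: coprime_nats_def prime_gt_0_nat)
    qed
    ultimately show "n \<in> coprime_nats P" by (auto simp: coprime_nats_def)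
  qed
  have sub: "coprime_nats Q \<subseteq> {0<..}" for Q by (auto simp: coprime_nats_def)
  have sm: "(\<lambda>n. complex_of_nat n powr (-s)) summable_on A" if "A \<subseteq> {0<..}" for A
    using abs_summable_summable[OF zeta_has_sum(2)[OF s]] that by (rule summable_on_subset_banach)
  have "D P = D (insert p P) + (\<Sum>\<^sub>\<infinity>n\<in>(\<lambda>n. p * n) ` coprime_nats P. complex_of_nat n powr (-s))"
    unfolding D_def
    by (subst split, rule infsum_Un_disjoint)
       (use sub[of P] sub[of "insert p P"] p prime_gt_0_nat[of p] in \<open>auto intro!: sm simp: coprime_nats_def\<close>)
  also have "(\<Sum>\<^sub>\<infinity>n\<in>(\<lambda>n. p * n) ` coprime_nats P. complex_of_nat n powr (-s)) =
     (\<Sum>\<^sub>\<infinity>n\<in>coprime_nats P. complex_of_nat p powr (-s) * complex_of_nat n powr (-s))"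
    using prime_gt_0_nat[OF p(1)]
    by (subst infsum_reindex) (auto simp: inj_on_def o_def of_nat_mult_powr simp del: of_nat_mult)
  also have "\<dots> = complex_of_nat p powr (-s) * D P"
    unfolding D_def by (rule infsum_cmult_right')
  finally show ?thesis by (simp add: algebra_simps)
qed

lemma sieve:
  assumes s: "Re s > 1" and "finite P" and P: "\<And>q. q \<in> P \<Longrightarrow> prime q"
  shows "(\<Sum>\<^sub>\<infinity>n\<in>coprime_nats P. complex_of_nat n powr (-s)) =
     (\<Prod>p\<in>P. 1 - complex_of_nat p powr (-s)) * zeta s"
  using assms(2) P
proof (induction P rule: finite_induct)
  case empty
  have "coprime_nats {} = {0<..}" by (auto simp: coprime_nats_def)
  thus ?case using infsumI[OF zeta_has_sum(1)[OF s]] by simp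
next
  case (insert p P)
  thus ?case using sieve_step[OF s, of p P] by simp
qed

text \<open>After sieving by the primes up to N the remaining integers are 1 and integers exceeding
  N, so the error is at most a tail of an absolutely convergent series. With the factors kept on the
  same side as zeta no division is involved.\<close>

lemma euler_product:
  assumes s: "Re s > 1"
  shows "(\<lambda>N. (\<Prod>p | prime p \<and> p \<le> N. 1 - complex_of_nat p powr (-s)) * zeta s) \<longlonglongrightarrow> 1"
proof -
  let ?f = "\<lambda>n. complex_of_nat n powr (-s)"
  let ?P = "\<lambda>N. {p::nat. prime p \<and> p \<le> N}"
  have fin: "finite (?P N)" for N by (rule finite_subset[of _ "{..N}"]) auto
  note abs = zeta_has_sum(2)[OF s]
  have sm: "(\<lambda>n. norm (?f n)) summable_on A" if "A \<subseteq> {0<..}" for A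
    using abs that by (rule summable_on_subset_banach)
  have le: "norm ((\<Prod>p\<in>?P N. 1 - ?f p) * zeta s - 1) \<le>
      (\<Sum>\<^sub>\<infinity>n\<in>{0<..}. norm (?f n)) - (\<Sum>n\<in>{0<..N}. norm (?f n))" if "N \<ge> 1" for N
  proof -
    let ?C = "coprime_nats (?P N)"
    have C1: "1 \<in> ?C" by (auto simp: coprime_nats_def dest: prime_gt_1_nat)
    have C2: "?C - {1} \<subseteq> {N<..}"
    proof
      fix n assume n: "n \<in> ?C - {1}"
      then obtain p where "prime p" "p dvd n" using prime_factor_nat[of n] by auto
      moreover have "\<not> p \<le> N" using \<open>prime p\<close> \<open>p dvd n\<close> n by (auto simp: coprime_nats_def)
      moreover have "p \<le> n" using \<open>p dvd n\<close> n by (auto simp: coprime_nats_def intro: dvd_imp_le)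
      ultimately show "n \<in> {N<..}" by simp
    qed
    have C3: "?C - {1} \<subseteq> {0<..}" by (auto simp: coprime_nats_def)
    have "(\<Prod>p\<in>?P N. 1 - ?f p) * zeta s = (\<Sum>\<^sub>\<infinity>n\<in>?C. ?f n)"
      by (rule sieve[OF s fin, symmetric]) auto
    moreover have "(\<Sum>\<^sub>\<infinity>n\<in>?C. ?f n) = ?f 1 + (\<Sum>\<^sub>\<infinity>n\<in>?C - {1}. ?f n)"
    proof -
      have "(\<Sum>\<^sub>\<infinity>n\<in>{1} \<union> (?C - {1}). ?f n) = (\<Sum>\<^sub>\<infinity>n\<in>{1}. ?f n) + (\<Sum>\<^sub>\<infinity>n\<in>?C - {1}. ?f n)"
        by (rule infsum_Un_disjoint[OF summable_on_finite abs_summable_summable[OF sm[OF C3]]]) auto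
      moreover have "{1} \<union> (?C - {1}) = ?C" using C1 by blast
      ultimately show ?thesis by simp
    qed
    ultimately have "norm ((\<Prod>p\<in>?P N. 1 - ?f p) * zeta s - 1) = norm (\<Sum>\<^sub>\<infinity>n\<in>?C - {1}. ?f n)"
      by simp
    also have "\<dots> \<le> (\<Sum>\<^sub>\<infinity>n\<in>?C - {1}. norm (?f n))"
      by (rule norm_infsum_bound[OF sm[OF C3]])
    also have "\<dots> \<le> (\<Sum>\<^sub>\<infinity>n\<in>{N<..}. norm (?f n))"
      by (rule infsum_mono2[OF sm[OF C3] sm C2]) auto
    also have "\<dots> = (\<Sum>\<^sub>\<infinity>n\<in>{0<..}. norm (?f n)) - (\<Sum>n\<in>{0<..N}. norm (?f n))"
    proof -
      have "(\<Sum>\<^sub>\<infinity>n\<in>{0<..N} \<union> {N<..}. norm (?f n)) =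
          (\<Sum>\<^sub>\<infinity>n\<in>{0<..N}. norm (?f n)) + (\<Sum>\<^sub>\<infinity>n\<in>{N<..}. norm (?f n))"
        by (rule infsum_Un_disjoint[OF sm sm]) auto
      moreover have "{0<..N} \<union> {N<..} = {0<..}" by auto
      ultimately show ?thesis by simp
    qed
    finally show ?thesis .
  qed
  have hs: "((\<lambda>n. norm (?f n)) has_sum (\<Sum>\<^sub>\<infinity>n\<in>{0<..}. norm (?f n))) {0<..}"
    using abs by (rule has_sum_infsum)
  have lim: "(\<lambda>N. \<Sum>n\<in>{0<..N}. norm (?f n)) \<longlonglongrightarrow> (\<Sum>\<^sub>\<infinity>n\<in>{0<..}. norm (?f n))"
  proof -
    have "filterlim (\<lambda>N. {0<..N::nat}) (finite_subsets_at_top {0<..}) sequentially"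
      unfolding filterlim_finite_subsets_at_top
    proof (intro allI impI)
      fix X :: "nat set" assume X: "finite X \<and> X \<subseteq> {0<..}"
      have "\<forall>\<^sub>F N in sequentially. N \<ge> Max (insert 0 X)" by (rule eventually_ge_at_top)
      thus "\<forall>\<^sub>F N in sequentially. finite {0<..N} \<and> X \<subseteq> {0<..N} \<and> {0<..N} \<subseteq> {0<..}"
        by eventually_elim (use X in auto)
    qed
    thus ?thesis using hs unfolding has_sum_def by (rule filterlim_compose[rotated])
  qed
  have "(\<lambda>N. (\<Prod>p\<in>?P N. 1 - ?f p) * zeta s - 1) \<longlonglongrightarrow> 0"
  proof (rule Lim_null_comparison)
    show "\<forall>\<^sub>F N in sequentially. norm ((\<Prod>p\<in>?P N. 1 - ?f p) * zeta s - 1) \<le>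
      (\<Sum>\<^sub>\<infinity>n\<in>{0<..}. norm (?f n)) - (\<Sum>n\<in>{0<..N}. norm (?f n))"
      using eventually_ge_at_top[of 1] by eventually_elim (rule le)
    show "(\<lambda>N. (\<Sum>\<^sub>\<infinity>n\<in>{0<..}. norm (?f n)) - (\<Sum>n\<in>{0<..N}. norm (?f n))) \<longlonglongrightarrow> 0"
      using lim by (auto intro!: tendsto_eq_intros)
  qed
  thus ?thesis by (subst LIM_zero_iff[symmetric])
qed

text \<open>Real part of the logarithm series. The term n = 0 vanishes because division by zero
  yields 0, so this is the usual series over n >= 1.\<close>

lemma ln_norm_one_minus_sums:
  assumes "norm w < 1"
  shows "(\<lambda>n. - Re (w ^ n) / real n) sums ln (norm (1 - w))"
proof -
  have "(\<lambda>n. Re ((- 1) ^ Suc n / of_nat n * (- w) ^ n)) sums Re (ln (1 + - w))"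
    by (intro sums_Re Ln_series) (use assms in simp)
  moreover have "1 - w \<noteq> 0" using assms by auto
  hence "Re (ln (1 + - w)) = ln (norm (1 - w))" by simp
  moreover have "Re ((- 1) ^ Suc n / of_nat n * (- w) ^ n) = - Re (w ^ n) / real n" for n
  proof -
    have "(- 1) ^ n * (- w) ^ n = w ^ n" by (simp flip: power_mult_distrib)
    moreover have "(- 1) ^ Suc n / of_nat n * (- w) ^ n = - (((- 1) ^ n * (- w) ^ n) / of_nat n)" by simp
    ultimately show ?thesis by simp
  qed
  ultimately show ?thesis by (simp only:)
qed

text \<open>With z = exp(it), the logarithm of the left side has n-th term -(r^n/n) (3 + 4 cos nt +
  cos 2nt) = -(2 r^n/n) (1 + cos nt)^2, which is never positive.\<close>

lemma three_four_one_factor: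
  fixes z :: complex
  assumes r: "0 < r" "r < 1" and z: "norm z = 1"
  shows "norm (1 - complex_of_real r) ^ 3 * norm (1 - of_real r * z) ^ 4 * norm (1 - of_real r * z\<^sup>2) \<le> 1"
proof -
  let ?w = "\<lambda>k. of_real r * z ^ k"
  have lt: "norm (?w k) < 1" for k using r z by (simp add: norm_mult norm_power)
  have nz: "norm (1 - ?w k) > 0" for k using lt[of k] by auto
  let ?t = "\<lambda>n. 3 * (- Re (?w 0 ^ n) / real n) + 4 * (- Re (?w 1 ^ n) / real n) + (- Re (?w 2 ^ n) / real n)"
  have S: "?t sums (3 * ln (norm (1 - ?w 0)) + 4 * ln (norm (1 - ?w 1)) + ln (norm (1 - ?w 2)))"
    by (intro sums_add sums_mult ln_norm_one_minus_sums lt)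
  have "?t n \<le> 0" for n
  proof -
    have "(cmod (z ^ n))\<^sup>2 = 1" using z by (simp add: norm_power)
    hence sq: "(Re (z ^ n))\<^sup>2 + (Im (z ^ n))\<^sup>2 = 1" by (simp add: cmod_power2)
    have R: "Re (of_real a * x) = a * Re x" for a x by simp
    have w: "?w k ^ n = of_real (r ^ n) * (z ^ n) ^ k" for k
      by (simp add: power_mult_distrib mult.commute flip: power_mult)
    have "Re (?w 0 ^ n) = r ^ n" "Re (?w 1 ^ n) = r ^ n * Re (z ^ n)"
      "Re (?w 2 ^ n) = r ^ n * ((Re (z ^ n))\<^sup>2 - (Im (z ^ n))\<^sup>2)"
      unfolding w R by (auto simp: power2_eq_square)
    moreover have "3 * (- a / x) + 4 * (- b / x) + (- c / x) = - (3 * a + 4 * b + c) / x" for a b c x :: real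
      by (simp add: add_divide_distrib diff_divide_distrib)
    ultimately have "?t n = - (3 * r ^ n + 4 * (r ^ n * Re (z ^ n)) +
        r ^ n * ((Re (z ^ n))\<^sup>2 - (Im (z ^ n))\<^sup>2)) / real n"
      by presburger
    also have "3 * r ^ n + 4 * (r ^ n * Re (z ^ n)) + r ^ n * ((Re (z ^ n))\<^sup>2 - (Im (z ^ n))\<^sup>2) =
        r ^ n * (3 + 4 * Re (z ^ n) + ((Re (z ^ n))\<^sup>2 - (Im (z ^ n))\<^sup>2))"
      by (simp add: algebra_simps)
    also have "3 + 4 * Re (z ^ n) + ((Re (z ^ n))\<^sup>2 - (Im (z ^ n))\<^sup>2) = 2 * (1 + Re (z ^ n))\<^sup>2"
      using sq by (simp add: power2_eq_square algebra_simps)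
    finally have "?t n = - (r ^ n * (2 * (1 + Re (z ^ n))\<^sup>2)) / real n" .
    thus ?thesis using r by simp
  qed
  hence "3 * ln (norm (1 - ?w 0)) + 4 * ln (norm (1 - ?w 1)) + ln (norm (1 - ?w 2)) \<le> 0"
    using sums_le[OF _ S sums_zero] by simp
  also have "3 * ln (norm (1 - ?w 0)) + 4 * ln (norm (1 - ?w 1)) + ln (norm (1 - ?w 2)) =
      ln (norm (1 - ?w 0) ^ 3 * norm (1 - ?w 1) ^ 4 * norm (1 - ?w 2))"
    using nz[of 0] nz[of 1] nz[of 2] by (simp add: ln_mult ln_realpow)
  finally show ?thesis using nz[of 0] nz[of 1] nz[of 2] by (simp add: ln_le_zero_iff)
qed

text \<open>Take r = p^(-\<sigma>) and z = p^(-it) in \<open>three_four_one_factor\<close> and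
  multiply over the primes up to N. The sieved products are then at most the left side, and they
  converge to 1 by \<open>euler_product\<close>.\<close>

lemma three_four_one:
  assumes s: "\<sigma> > 1"
  shows "norm (zeta (of_real \<sigma>)) ^ 3 * norm (zeta (Complex \<sigma> t)) ^ 4 * norm (zeta (Complex \<sigma> (2 * t))) \<ge> 1"
proof -
  let ?G = "\<lambda>N s. \<Prod>p | prime p \<and> p \<le> N. 1 - complex_of_nat p powr (-s)"
  let ?a = "of_real \<sigma> :: complex" and ?b = "Complex \<sigma> t" and ?c = "Complex \<sigma> (2 * t)"
  have lim: "(\<lambda>N. norm (?G N ?a * zeta ?a) ^ 3 * norm (?G N ?b * zeta ?b) ^ 4 * norm (?G N ?c * zeta ?c))
      \<longlonglongrightarrow> norm (1::complex) ^ 3 * norm (1::complex) ^ 4 * norm (1::complex)"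
    using s by (intro tendsto_intros euler_product) auto
  have "norm (?G N ?a) ^ 3 * norm (?G N ?b) ^ 4 * norm (?G N ?c) \<le> 1" for N
  proof -
    have "norm (?G N ?a) ^ 3 * norm (?G N ?b) ^ 4 * norm (?G N ?c) =
      (\<Prod>p | prime p \<and> p \<le> N. norm (1 - complex_of_nat p powr (-?a)) ^ 3 *
          norm (1 - complex_of_nat p powr (-?b)) ^ 4 * norm (1 - complex_of_nat p powr (-?c)))"
      by (simp only: prod_norm[symmetric] prod_power_distrib prod.distrib)
    also have "\<dots> \<le> 1"
    proof (rule prod_le_1, safe)
      fix p :: nat assume p: "prime p"
      define r where "r = real p powr (-\<sigma>)"
      define z where "z = complex_of_nat p powr (Complex 0 (-t))"
      have p1: "real p > 1" using prime_gt_1_nat[OF p] by simp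
      have "r < real p powr 0" unfolding r_def using p1 s by (intro powr_less_mono) auto
      hence r: "0 < r" "r < 1" using p1 by (auto simp: r_def)
      have nz: "norm z = 1" using p1 by (simp add: z_def norm_powr_real_powr)
      have r': "complex_of_real r = of_nat p powr (-?a)"
        using powr_of_real[of "real p" "-\<sigma>"] p1 by (simp add: r_def)
      have "- ?b = - ?a + Complex 0 (-t)" by (simp add: complex_eq_iff)
      hence b: "of_nat p powr (-?b) = complex_of_real r * z"
        unfolding r' z_def by (simp only: powr_add)
      have "- ?c = - ?a + (Complex 0 (-t) + Complex 0 (-t))" by (simp add: complex_eq_iff)
      hence c: "of_nat p powr (-?c) = complex_of_real r * z\<^sup>2"
        unfolding r' z_def power2_eq_square by (simp only: powr_add)
      show "norm (1 - complex_of_nat p powr (-?a)) ^ 3 *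
          norm (1 - complex_of_nat p powr (-?b)) ^ 4 * norm (1 - complex_of_nat p powr (-?c)) \<le> 1"
        unfolding b c r'[symmetric] by (rule three_four_one_factor[OF r nz])
    qed auto
    finally show ?thesis .
  qed
  moreover have aux: "norm (g * a) ^ 3 * norm (h * b) ^ 4 * norm (k * c) \<le> norm a ^ 3 * norm b ^ 4 * norm c"
    if "norm g ^ 3 * norm h ^ 4 * norm k \<le> 1" for g h k a b c :: complex
  proof -
    have "norm (g * a) ^ 3 * norm (h * b) ^ 4 * norm (k * c) =
        (norm g ^ 3 * norm h ^ 4 * norm k) * (norm a ^ 3 * norm b ^ 4 * norm c)"
      by (simp add: norm_mult power_mult_distrib)
    also have "\<dots> \<le> 1 * (norm a ^ 3 * norm b ^ 4 * norm c)"
      by (intro mult_right_mono that) auto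
    finally show ?thesis by simp
  qed
  ultimately have le: "norm (?G N ?a * zeta ?a) ^ 3 * norm (?G N ?b * zeta ?b) ^ 4 * norm (?G N ?c * zeta ?c) \<le>
     norm (zeta ?a) ^ 3 * norm (zeta ?b) ^ 4 * norm (zeta ?c)" for N
    using aux by blast
  have "norm (1::complex) ^ 3 * norm (1::complex) ^ 4 * norm (1::complex) \<le>
     norm (zeta ?a) ^ 3 * norm (zeta ?b) ^ 4 * norm (zeta ?c)"
    by (rule LIMSEQ_le_const2[OF lim]) (use le in blast)
  thus ?thesis by simp
qed

text \<open>A zero at 1 + it would enter the 3-4-1 product to the fourth power and outweigh the cube
  of the simple pole at 1, so the product would tend to 0 as \<sigma> decreases to 1, although it
  stays at least 1.\<close>

lemma zeta_nonzero_line_1: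
  assumes t: "t \<noteq> 0"
  shows "zeta (Complex 1 t) \<noteq> 0"
proof
  assume z: "zeta (Complex 1 t) = 0"
  have hol: "zeta holomorphic_on -{1}" using is_zeta_zeta by (simp add: is_zeta_def)
  have op: "open (-{1::complex})" by (simp add: open_Compl)
  have ne: "Complex 1 t \<noteq> 1" "Complex 1 (2 * t) \<noteq> 1" using t by (auto simp: complex_eq_iff)
  \<comment> \<open>The 3-4-1 product regrouped so that every factor has a limit: three powers of
    \<sigma> - 1 go into \<open>zeta_reg\<close>, the division by four powers gives difference
    quotients at the supposed zero, and one factor \<sigma> - 1 is left over.\<close>
  define q where "q = (\<lambda>\<sigma>. norm (zeta_reg (of_real \<sigma>)) ^ 3 *
     norm (zeta (Complex \<sigma> t) / of_real (\<sigma> - 1)) ^ 4 * (\<sigma> - 1) * norm (zeta (Complex \<sigma> (2 * t))))"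
  have fl: "filterlim (\<lambda>\<sigma>. Complex \<sigma> u) (at (Complex 1 u)) (at_right 1)" for u
  proof -
    have "((\<lambda>\<sigma>. Complex \<sigma> u) \<longlongrightarrow> Complex 1 u) (at_right 1)" by (intro tendsto_intros)
    moreover have "\<forall>\<^sub>F \<sigma> in at_right 1. Complex \<sigma> u \<noteq> Complex 1 u"
      using eventually_at_right_less[of "1::real"] by eventually_elim (auto simp: complex_eq_iff)
    ultimately show ?thesis by (auto simp: filterlim_at)
  qed
  have "(zeta has_field_derivative deriv zeta (Complex 1 t)) (at (Complex 1 t))"
    by (rule holomorphic_derivI[OF hol op]) (use ne in auto)
  hence "((\<lambda>y. (zeta y - zeta (Complex 1 t)) / (y - Complex 1 t)) \<longlongrightarrow> deriv zeta (Complex 1 t)) (at (Complex 1 t))"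
    by (simp add: has_field_derivative_iff)
  note lim = filterlim_compose[OF this fl]
  have eq: "Complex \<sigma> t - Complex 1 t = of_real (\<sigma> - 1)" for \<sigma> by (simp add: complex_eq_iff)
  have 1: "((\<lambda>\<sigma>. zeta (Complex \<sigma> t) / of_real (\<sigma> - 1)) \<longlongrightarrow> deriv zeta (Complex 1 t)) (at_right 1)"
    using lim unfolding z eq by (simp only: diff_0_right)
  have "isCont zeta (Complex 1 (2 * t))"
    by (rule holomorphic_on_imp_continuous_on[OF hol, THEN continuous_on_interior])
       (use ne op in \<open>auto simp: interior_open\<close>)
  hence 2: "((\<lambda>\<sigma>. zeta (Complex \<sigma> (2 * t))) \<longlongrightarrow> zeta (Complex 1 (2 * t))) (at_right 1)"
    unfolding isCont_def by (rule filterlim_compose[OF _ fl])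
  have "isCont zeta_reg 1"
    by (rule holomorphic_on_imp_continuous_on[OF zeta_reg_holomorphic, THEN continuous_on_interior])
       (auto simp: interior_open open_halfspace_Re_gt)
  moreover have "filterlim (\<lambda>\<sigma>. complex_of_real \<sigma>) (at 1) (at_right 1)"
    using fl[of 0] by (simp add: complex_of_real_def one_complex.code)
  ultimately have 3: "((\<lambda>\<sigma>. zeta_reg (complex_of_real \<sigma>)) \<longlongrightarrow> zeta_reg 1) (at_right 1)"
    unfolding isCont_def by (rule filterlim_compose)
  have "(q \<longlongrightarrow> norm (zeta_reg 1) ^ 3 * norm (deriv zeta (Complex 1 t)) ^ 4 * (1 - 1) *
      norm (zeta (Complex 1 (2 * t)))) (at_right 1)"
    unfolding q_def by (intro tendsto_intros 1 2 3)
  moreover have "\<forall>\<^sub>F \<sigma> in at_right 1. q \<sigma> \<ge> 1"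
    using eventually_at_right_less[of "1::real"]
  proof eventually_elim
    case (elim \<sigma>)
    have "zeta_reg (of_real \<sigma>) = (of_real \<sigma> - 1) * zeta (of_real \<sigma>)"
      using elim by (intro zeta_reg_eq) auto
    hence "norm (zeta_reg (of_real \<sigma>)) = (\<sigma> - 1) * norm (zeta (of_real \<sigma>))"
      using elim norm_of_real[of "\<sigma> - 1", where 'a = complex] by (simp add: norm_mult)
    moreover have "norm (zeta (Complex \<sigma> t) / of_real (\<sigma> - 1)) = norm (zeta (Complex \<sigma> t)) / (\<sigma> - 1)"
      using elim by (simp add: norm_divide del: of_real_diff)
    ultimately have "q \<sigma> = norm (zeta (of_real \<sigma>)) ^ 3 * norm (zeta (Complex \<sigma> t)) ^ 4 *
        norm (zeta (Complex \<sigma> (2 * t)))"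
      using elim by (simp add: q_def power_mult_distrib power_divide eval_nat_numeral)
    thus ?case using three_four_one[OF elim] by simp
  qed
  ultimately have "norm (zeta_reg 1) ^ 3 * norm (deriv zeta (Complex 1 t)) ^ 4 * (1 - 1) *
      norm (zeta (Complex 1 (2 * t))) \<ge> 1"
    by (intro tendsto_lowerbound) auto
  thus False by simp
qed

lemma zeta_reg_nonzero:
  assumes "Re s \<ge> 1"
  shows "zeta_reg s \<noteq> 0"
proof (cases "s = 1")
  case False
  have "zeta s \<noteq> 0"
  proof (cases "Re s = 1")
    case True
    hence "s = Complex 1 (Im s)" by (simp add: complex_eq_iff)
    moreover from this have "Im s \<noteq> 0" using False by (auto simp: complex_eq_iff)
    ultimately show ?thesis using zeta_nonzero_line_1[of "Im s"] by metis
  next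
    case False
    \<comment> \<open>For Re s > 1 the inequality itself excludes a zero, since a product that is at
      least 1 has no vanishing factor.\<close>
    thus ?thesis using three_four_one[of "Re s" "Im s"] assms by (intro notI) simp
  qed
  thus ?thesis using zeta_reg_eq[of s] assms False by simp
qed (simp add: zeta_reg_def)

text \<open>Comparison with the series for pi^2/6; pi < 3.2 gives pi^2/6 - 1 < 3/4. This uniform
  lower bound serves at the centres of the discs in \<open>quotient_growth\<close>.\<close>

lemma norm_zeta_ge:
  assumes "Re s \<ge> 2"
  shows "norm (zeta s) \<ge> 1 / 4"
proof -
  let ?f = "\<lambda>n. 1 / complex_of_nat (Suc n) powr s"
  have "?f sums zeta s"
    using is_zeta_zeta zeta_series_summable[of s] assms unfolding is_zeta_def
    by (auto simp: sums_iff)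
  hence S1: "(\<lambda>n. ?f (Suc n)) sums (zeta s - 1)"
    by (subst sums_Suc_iff) simp
  have S2: "(\<lambda>n. 1 / (real (Suc n) + 1)\<^sup>2) sums (pi\<^sup>2 / 6 - 1)"
    using inverse_squares_sums by (subst sums_Suc_iff) (simp add: add_ac)
  have le: "norm (?f (Suc n)) \<le> 1 / (real (Suc n) + 1)\<^sup>2" for n
  proof -
    have "norm (?f (Suc n)) = 1 / (real (Suc n) + 1) powr Re s"
      by (simp add: norm_divide norm_powr_real_powr add_ac)
    moreover have "(real (Suc n) + 1) powr 2 \<le> (real (Suc n) + 1) powr Re s"
      using assms by (intro powr_mono) auto
    ultimately show ?thesis by (auto intro!: divide_left_mono mult_pos_pos)
  qed
  have "norm (zeta s - 1) \<le> pi\<^sup>2 / 6 - 1"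
    by (rule norm_sums_le[OF S1 S2 le])
  also have "pi\<^sup>2 \<le> (3.2)\<^sup>2" using pi_approx pi_gt_zero by (intro power_mono) auto
  finally have "norm (zeta s - 1) \<le> 3 / 4" by (simp add: power2_eq_square)
  moreover have "norm (1::complex) - norm (1 - zeta s) \<le> norm (1 - (1 - zeta s))"
    by (rule norm_triangle_ineq2)
  ultimately show ?thesis by (simp add: norm_minus_commute)
qed

section \<open>Mellin transforms of square-integrable functions\<close>

lemma set_integral_halfline_scale:
  fixes f :: "real \<Rightarrow> 'a :: {banach, second_countable_topology}"
  assumes c: "c > 0"
  shows "set_integrable lborel {0<..} (\<lambda>a. f (c * a)) \<longleftrightarrow> set_integrable lborel {0<..} f"
    and "(LBINT a:{0<..}. f (c * a)) = (1 / c) *\<^sub>R (LBINT v:{0<..}. f v)"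
proof -
  have ind: "indicator {0<..} (c * a) = (indicator {0<..} a :: real)" for a
    using c by (auto simp: indicator_def zero_less_mult_iff)
  show "set_integrable lborel {0<..} (\<lambda>a. f (c * a)) \<longleftrightarrow> set_integrable lborel {0<..} f"
    using lborel_integrable_real_affine_iff[of c "\<lambda>v. indicator {0<..} v *\<^sub>R f v" 0] c
    by (simp add: set_integrable_def ind)
  show "(LBINT a:{0<..}. f (c * a)) = (1 / c) *\<^sub>R (LBINT v:{0<..}. f v)"
    using lborel_integral_real_affine[of c "\<lambda>v. indicator {0<..} v *\<^sub>R f v" 0] c
    by (simp add: set_lebesgue_integral_def ind)
qed

lemma set_integral_halfline_split:
  fixes f :: "real \<Rightarrow> 'a :: {banach, second_countable_topology}"
  assumes "set_integrable lborel {0<..<1} f" "set_integrable lborel {1<..} f"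
    and [measurable]: "f \<in> borel_measurable borel"
  shows "set_integrable lborel {0<..} f"
    and "(LBINT x:{0<..}. f x) = (LBINT x:{0<..<1}. f x) + (LBINT x:{1<..}. f x)"
proof -
  have AE: "AE x in lborel. indicator {0<..} x *\<^sub>R f x =
      indicator {0<..<1} x *\<^sub>R f x + indicator {1<..} x *\<^sub>R f x"
    using AE_lborel_singleton[of "1::real"]
    by eventually_elim (auto simp: indicator_def)
  have int: "integrable lborel (\<lambda>x. indicator {0<..<1} x *\<^sub>R f x + indicator {1<..} x *\<^sub>R f x)"
    using assms unfolding set_integrable_def by (intro Bochner_Integration.integrable_add)
  show "set_integrable lborel {0<..} f"
    unfolding set_integrable_def
    by (rule integrable_cong_AE_imp[OF int]) (use AE in auto)
  have "(LBINT x:{0<..}. f x) = (\<integral>x. indicator {0<..<1} x *\<^sub>R f x + indicator {1<..} x *\<^sub>R f x \<partial>lborel)"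
    unfolding set_lebesgue_integral_def by (rule integral_cong_AE) (use AE in auto)
  thus "(LBINT x:{0<..}. f x) = (LBINT x:{0<..<1}. f x) + (LBINT x:{1<..}. f x)"
    using assms unfolding set_lebesgue_integral_def set_integrable_def by simp
qed

text \<open>For v > 1 the fractional part of 1/v is 1/v, which adds 1/(1-w) to the transform over
  (0,1). The value is the classical -zeta(w)/w, written without reference to the
  continuation.\<close>

lemma halfline_mellin_frac_inverse:
  assumes w: "0 < Re w" "Re w < 1"
  shows "set_integrable lborel {0<..} (\<lambda>v. complex_of_real (frac (1 / v)) * of_real v powr (w - 1))"
    and "(LBINT v:{0<..}. complex_of_real (frac (1 / v)) * of_real v powr (w - 1)) =
           zeta_reg w / (w * (1 - w))"
proof -
  let ?f = "\<lambda>v. complex_of_real (frac (1 / v)) * of_real v powr (w - 1)"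
  have 1: "set_integrable lborel {0<..<1} ?f"
    by (rule mellin_integrand_integrable[OF frac_inverse_measurable
          bounded_mellin_integrable(1)[OF frac_inverse_measurable frac_abs_le_1 w(1)]]) simp
  have eq: "?f v = of_real v powr ((w - 1) - 1)" if "v > 1" for v
  proof -
    have "frac (1 / v) = 1 / v" using that by (simp add: frac_eq)
    moreover have "complex_of_real v powr ((w - 1) - 1) = of_real v powr (w - 1) / of_real v powr 1"
      by (rule powr_diff)
    ultimately show ?thesis using that by (simp add: powr_to_1)
  qed
  have e2: "set_integrable lborel {1<..} ?f \<longleftrightarrow>
      set_integrable lborel {1<..} (\<lambda>v. complex_of_real v powr ((w - 1) - 1))"
    by (rule set_integrable_cong[OF refl refl]) (rule eq, simp)
  have e3: "(LBINT v:{1<..}. ?f v) = (LBINT v:{1<..}. complex_of_real v powr ((w - 1) - 1))"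
    by (rule set_lebesgue_integral_cong) (simp, intro allI impI eq, simp)
  have 2: "set_integrable lborel {1<..} ?f" "(LBINT v:{1<..}. ?f v) = 1 / (1 - w)"
    unfolding e2 e3 using powr_set_integral_infinity_complex[of "w - 1"] w
      minus_divide_right[of 1 "w - 1"] by auto
  show "set_integrable lborel {0<..} ?f"
    by (rule set_integral_halfline_split(1)[OF 1 2(1)]) measurable
  have "(LBINT v:{0<..}. ?f v) = mellin frac_inverse w + 1 / (1 - w)"
    unfolding mellin_def 2(2)[symmetric] by (rule set_integral_halfline_split(2)[OF 1 2(1)]) measurable
  also have "\<dots> = zeta_reg w / (w * (1 - w))"
  proof -
    have "w \<noteq> 0" "1 - w \<noteq> 0" using w by auto
    thus ?thesis by (simp add: zeta_reg_def field_simps)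
  qed
  finally show "(LBINT v:{0<..}. ?f v) = zeta_reg w / (w * (1 - w))" .
qed

lemma of_real_mult_powr:
  "0 \<le> x \<Longrightarrow> 0 \<le> y \<Longrightarrow> complex_of_real (x * y) powr s = of_real x powr s * of_real y powr s"
  using powr_times_real[of "of_real x" "of_real y" s] by simp

text \<open>On the half-line a dilation by c only produces the factor c^(-w). The version with norms
  supplies the absolute bound for Fubini in \<open>mellin_frac_correlation\<close>.\<close>

lemma halfline_mellin_frac_inverse_scaled:
  assumes w: "0 < Re w" "Re w < 1" and c: "c > 0"
  shows "set_integrable lborel {0<..} (\<lambda>v. complex_of_real (frac (1 / (c * v))) * of_real v powr (w - 1))"
    and "(LBINT v:{0<..}. complex_of_real (frac (1 / (c * v))) * of_real v powr (w - 1)) =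
           of_real c powr (-w) * (zeta_reg w / (w * (1 - w)))"
    and "(LBINT v:{0<..}. norm (complex_of_real (frac (1 / (c * v))) * of_real v powr (w - 1))) =
           c powr (- Re w) * (LBINT v:{0<..}. norm (complex_of_real (frac (1 / v)) * of_real v powr (w - 1)))"
proof -
  define f where "f = (\<lambda>v. complex_of_real (frac (1 / v)) * of_real v powr (w - 1))"
  let ?g = "\<lambda>v. complex_of_real (frac (1 / (c * v))) * of_real v powr (w - 1)"
  have eq: "?g v = of_real c powr (1 - w) * f (c * v)" if "v > 0" for v
  proof -
    have "of_real (c * v) powr (w - 1) = of_real c powr (w - 1) * complex_of_real v powr (w - 1)"
      using that c by (intro of_real_mult_powr) auto
    moreover have "complex_of_real c powr (1 - w) * of_real c powr (w - 1) = 1"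
      using c by (simp flip: powr_add)
    ultimately show ?thesis by (simp add: f_def mult_ac)
  qed
  have int: "set_integrable lborel {0<..} (\<lambda>v. f (c * v))"
    by (subst set_integral_halfline_scale[OF c])
       (use halfline_mellin_frac_inverse(1)[OF w] in \<open>simp add: f_def\<close>)
  have "set_integrable lborel {0<..} ?g \<longleftrightarrow>
      set_integrable lborel {0<..} (\<lambda>v. of_real c powr (1 - w) * f (c * v))"
    by (rule set_integrable_cong) (auto simp: eq)
  thus "set_integrable lborel {0<..} ?g" using int by simp
  have "(LBINT v:{0<..}. ?g v) = (LBINT v:{0<..}. of_real c powr (1 - w) * f (c * v))"
    by (rule set_lebesgue_integral_cong) (auto simp: eq)
  also have "\<dots> = of_real c powr (1 - w) * ((1 / c) *\<^sub>R (LBINT v:{0<..}. f v))"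
    by (simp only: set_integral_mult_right set_integral_halfline_scale[OF c])
  also have "(LBINT v:{0<..}. f v) = zeta_reg w / (w * (1 - w))"
    unfolding f_def by (rule halfline_mellin_frac_inverse(2)[OF w])
  also have "of_real c powr (1 - w) * ((1 / c) *\<^sub>R (zeta_reg w / (w * (1 - w)))) =
      (of_real c powr (1 - w) / of_real c) * (zeta_reg w / (w * (1 - w)))"
    by (simp add: scaleR_conv_of_real)
  also have "of_real c powr (1 - w) / of_real c = complex_of_real c powr (-w)"
    using c by (simp add: powr_diff powr_minus field_simps)
  finally show "(LBINT v:{0<..}. ?g v) = of_real c powr (-w) * (zeta_reg w / (w * (1 - w)))" .
  have "(LBINT v:{0<..}. norm (?g v)) = (LBINT v:{0<..}. c powr (1 - Re w) * norm (f (c * v)))"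
    by (rule set_lebesgue_integral_cong) (use c in \<open>auto simp: eq norm_mult norm_powr_of_real\<close>)
  also have "\<dots> = c powr (1 - Re w) * ((1 / c) *\<^sub>R (LBINT v:{0<..}. norm (f v)))"
    using set_integral_halfline_scale(2)[OF c, of "\<lambda>v. norm (f v)"]
    by (simp only: set_integral_mult_right)
  also have "\<dots> = c powr (- Re w) * (LBINT v:{0<..}. norm (f v))"
    using c by (simp add: powr_diff powr_minus field_simps)
  finally show "(LBINT v:{0<..}. norm (?g v)) = c powr (- Re w) * (LBINT v:{0<..}. norm (complex_of_real (frac (1 / v)) * of_real v powr (w - 1)))"
    by (simp add: f_def)
qed

text \<open>Weighted arithmetic-geometric inequality with weight d = sqrt(2\<sigma> - 1), chosen
  because the integral of x^(2\<sigma>-2) is 1/d^2. The resulting growth of order 1/d as \<sigma>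
  approaches 1/2 is weaker than a simple pole, which is decisive at zeros on the critical
  line.\<close>

lemma square_integrable_mellin:
  fixes g :: "real \<Rightarrow> real"
  assumes [measurable]: "g \<in> borel_measurable borel"
    and g: "set_integrable lborel {0<..<1} (\<lambda>x. (g x)\<^sup>2)" and \<sigma>: "\<sigma> > 1 / 2"
  shows "set_integrable lborel {0<..<1} (\<lambda>x. \<bar>g x\<bar> * x powr (\<sigma> - 1))"
    and "(LBINT x:{0<..<1}. \<bar>g x\<bar> * x powr (\<sigma> - 1)) \<le>
           ((LBINT x:{0<..<1}. (g x)\<^sup>2) + 1) / (2 * sqrt (2 * \<sigma> - 1))"
proof -
  define d where "d = sqrt (2 * \<sigma> - 1)"
  have d: "d > 0" "d\<^sup>2 = 2 * \<sigma> - 1" using \<sigma> by (auto simp: d_def)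
  have p: "set_integrable lborel {0<..<1} (\<lambda>x. x powr ((2 * \<sigma> - 1) - 1))"
    "(LBINT x:{0<..<1}. x powr ((2 * \<sigma> - 1) - 1)) = 1 / (2 * \<sigma> - 1)"
    using powr_set_integral_0[of "2 * \<sigma> - 1" 1] \<sigma> by auto
  let ?b = "\<lambda>x. (g x)\<^sup>2 / (2 * d) + x powr ((2 * \<sigma> - 1) - 1) * (d / 2)"
  have i: "set_integrable lborel {0<..<1} ?b"
    using g p(1) by (intro set_integral_add) auto
  have le: "\<bar>g x\<bar> * x powr (\<sigma> - 1) \<le> ?b x" if "x \<in> {0<..<1}" for x
  proof -
    have "x powr ((2 * \<sigma> - 1) - 1) = (x powr (\<sigma> - 1))\<^sup>2"
      using that by (simp add: power2_eq_square flip: powr_add)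
    moreover have "\<bar>g x\<bar> * x powr (\<sigma> - 1) \<le> (g x)\<^sup>2 / (2 * d) + (x powr (\<sigma> - 1))\<^sup>2 * (d / 2)"
    proof -
      have "0 \<le> (\<bar>g x\<bar> - d * x powr (\<sigma> - 1))\<^sup>2" by simp
      hence "2 * d * (\<bar>g x\<bar> * x powr (\<sigma> - 1)) \<le> (g x)\<^sup>2 + d\<^sup>2 * (x powr (\<sigma> - 1))\<^sup>2"
        by (simp add: power2_eq_square algebra_simps)
      hence "2 * d * (\<bar>g x\<bar> * x powr (\<sigma> - 1)) / (2 * d) \<le> ((g x)\<^sup>2 + d\<^sup>2 * (x powr (\<sigma> - 1))\<^sup>2) / (2 * d)"
        using d by (intro divide_right_mono) auto
      also have "\<dots> = (g x)\<^sup>2 / (2 * d) + (x powr (\<sigma> - 1))\<^sup>2 * (d / 2)"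
        using d(1) by (simp add: add_divide_distrib power2_eq_square)
      finally show ?thesis using d(1) by simp
    qed
    ultimately show ?thesis by simp
  qed
  have le': "norm (\<bar>g x\<bar> * x powr (\<sigma> - 1)) \<le> norm (?b x)" if "x \<in> {0<..<1}" for x
  proof -
    have "norm (\<bar>g x\<bar> * x powr (\<sigma> - 1)) = \<bar>g x\<bar> * x powr (\<sigma> - 1)" by (simp add: abs_mult)
    also note le[OF that]
    also have "?b x \<le> norm (?b x)" by simp
    finally show ?thesis .
  qed
  show j: "set_integrable lborel {0<..<1} (\<lambda>x. \<bar>g x\<bar> * x powr (\<sigma> - 1))"
    by (rule set_integrable_bound[OF i], simp add: set_borel_measurable_def)
       (intro AE_I2 impI le')
  have "(LBINT x:{0<..<1}. \<bar>g x\<bar> * x powr (\<sigma> - 1)) \<le> (LBINT x:{0<..<1}. ?b x)"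
    by (rule set_integral_mono[OF j i le])
  also have "\<dots> = (LBINT x:{0<..<1}. (g x)\<^sup>2) / (2 * d) + 1 / (2 * \<sigma> - 1) * (d / 2)"
    using g p by (subst set_integral_add) auto
  also have "\<dots> = ((LBINT x:{0<..<1}. (g x)\<^sup>2) + 1) / (2 * d)"
    unfolding d(2)[symmetric] using d(1) by (simp add: field_simps power2_eq_square)
  finally show "(LBINT x:{0<..<1}. \<bar>g x\<bar> * x powr (\<sigma> - 1)) \<le>
           ((LBINT x:{0<..<1}. (g x)\<^sup>2) + 1) / (2 * sqrt (2 * \<sigma> - 1))" by (simp add: d_def)
qed

definition frac_correlation :: "(real \<Rightarrow> real) \<Rightarrow> real \<Rightarrow> real" where
  "frac_correlation g a = (LBINT x:{0<..<1}. g x * frac (1 / (a * x)))"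

lemma set_integrable_mult_bounded:
  fixes g k :: "real \<Rightarrow> real"
  assumes "set_integrable lborel A g" "A \<in> sets borel"
    and [measurable]: "g \<in> borel_measurable borel" "k \<in> borel_measurable borel" and k: "\<And>x. \<bar>k x\<bar> \<le> C"
  shows "set_integrable lborel A (\<lambda>x. g x * k x)"
proof -
  have "set_integrable lborel A (\<lambda>x. g x * C)" using assms by simp
  thus ?thesis
  proof (rule set_integrable_bound)
    have "\<bar>g x * k x\<bar> \<le> \<bar>g x * C\<bar>" for x
      using mult_left_mono[OF order_trans[OF k abs_ge_self], of "\<bar>g x\<bar>"] by (simp add: abs_mult)
    thus "AE x in lborel. x \<in> A \<longrightarrow> norm (g x * k x) \<le> norm (g x * C)" by simp
  qed (use assms(2) in \<open>auto simp: set_borel_measurable_def\<close>)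
qed

lemma frac_correlation:
  assumes [measurable]: "g \<in> borel_measurable borel" and g: "set_integrable lborel {0<..<1} g"
  shows "frac_correlation g \<in> borel_measurable borel"
    and "\<bar>frac_correlation g a\<bar> \<le> (LBINT x:{0<..<1}. \<bar>g x\<bar>)"
proof -
  show "frac_correlation g \<in> borel_measurable borel"
    unfolding frac_correlation_def[abs_def] set_lebesgue_integral_def
    by (rule lborel.borel_measurable_lebesgue_integral[of _ borel, unfolded split_def]) measurable
  have i: "set_integrable lborel {0<..<1} (\<lambda>x. g x * frac (1 / (a * x)))"
    by (rule set_integrable_mult_bounded[OF g _ _ _ frac_abs_le_1]) auto
  have "\<bar>frac_correlation g a\<bar> \<le> (LBINT x:{0<..<1}. \<bar>g x * frac (1 / (a * x))\<bar>)"
    unfolding frac_correlation_def using set_integral_norm_bound[OF i] by simp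
  also have "\<dots> \<le> (LBINT x:{0<..<1}. \<bar>g x\<bar>)"
  proof (rule set_integral_mono)
    show "set_integrable lborel {0<..<1} (\<lambda>x. \<bar>g x\<bar>)" using set_integrable_norm[OF g] by simp
    show "set_integrable lborel {0<..<1} (\<lambda>x. \<bar>g x * frac (1 / (a * x))\<bar>)"
      using set_integrable_norm[OF i] by simp
    show "\<bar>g x * frac (1 / (a * x))\<bar> \<le> \<bar>g x\<bar>" for x
      using mult_left_mono[OF frac_abs_le_1[of "1 / (a * x)"], of "\<bar>g x\<bar>"] by (simp add: abs_mult)
  qed
  finally show "\<bar>frac_correlation g a\<bar> \<le> (LBINT x:{0<..<1}. \<bar>g x\<bar>)" .
qed

text \<open>Both sides are w(1-w) times the double integral of g(x) {1/(ax)} a^(w-1) over 0 < x < 1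
  and a > 0. Integrating first in a gives x^(-w) times the half-line transform; integrating first in
  x gives \<open>frac_correlation\<close>, whose part over a > 1 is explicit by the last assumption.
  The condition Re w < 1/2 makes g(x) x^(-w) integrable.\<close>

lemma mellin_frac_correlation:
  fixes g :: "real \<Rightarrow> real"
  assumes [measurable]: "g \<in> borel_measurable borel"
    and g: "set_integrable lborel {0<..<1} (\<lambda>x. (g x)\<^sup>2)"
    and w: "0 < Re w" "Re w < 1 / 2"
    and h: "\<And>a. a > 1 \<Longrightarrow> frac_correlation g a = \<kappa> / a"
  shows "mellin g (1 - w) * zeta_reg w = w * (1 - w) * mellin (frac_correlation g) w + of_real \<kappa> * w"
proof -
  define \<phi> where "\<phi> = (\<lambda>c v. complex_of_real (frac (1 / (c * v))) * of_real v powr (w - 1))"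
  define F where "F = (\<lambda>x a. (indicator {0<..<1} x * g x) *\<^sub>R (indicator {0<..} a *\<^sub>R \<phi> x a))"
  let ?J = "zeta_reg w / (w * (1 - w))"
  have w1: "Re w < 1" using w by simp
  note S = halfline_mellin_frac_inverse_scaled[OF w(1) w1]
  have [measurable]: "case_prod F \<in> borel_measurable (lborel \<Otimes>\<^sub>M lborel)"
    unfolding F_def \<phi>_def by measurable
  have int: "integrable (lborel \<Otimes>\<^sub>M lborel) (case_prod F)"
  proof (rule lborel_pair.Fubini_integrable)
    show "AE x in lborel. integrable lborel (\<lambda>y. case (x, y) of (x, y) \<Rightarrow> F x y)"
    proof (intro AE_I2)
      fix x :: real
      show "integrable lborel (\<lambda>y. case (x, y) of (x, y) \<Rightarrow> F x y)"
      proof (cases "x \<in> {0<..<1}")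
        case True
        have "integrable lborel (\<lambda>y. indicator {0<..} y *\<^sub>R \<phi> x y)"
          using True S(1)[of x] unfolding \<phi>_def set_integrable_def by auto
        hence "integrable lborel (\<lambda>y. g x *\<^sub>R (indicator {0<..} y *\<^sub>R \<phi> x y))"
          by (rule integrable_scaleR_right)
        thus ?thesis using True by (simp add: F_def)
      qed (simp add: F_def)
    qed
    define Jr where "Jr = (LBINT v:{0<..}. norm (complex_of_real (frac (1 / v)) * of_real v powr (w - 1)))"
    have eq: "(\<integral>y. norm (case (x, y) of (x, y) \<Rightarrow> F x y) \<partial>lborel) =
        (indicator {0<..<1} x *\<^sub>R (\<bar>g x\<bar> * x powr ((1 - Re w) - 1))) * Jr" for x
    proof (cases "x \<in> {0<..<1}")
      case True
      have "(\<integral>y. norm (F x y) \<partial>lborel) = (\<integral>y. \<bar>g x\<bar> * (indicator {0<..} y *\<^sub>R norm (\<phi> x y)) \<partial>lborel)"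
        using True by (intro Bochner_Integration.integral_cong) (auto simp: F_def indicator_def)
      also have "\<dots> = \<bar>g x\<bar> * (LBINT y:{0<..}. norm (\<phi> x y))"
        by (simp add: set_lebesgue_integral_def)
      also have "(LBINT y:{0<..}. norm (\<phi> x y)) = x powr (- Re w) * Jr"
        unfolding \<phi>_def Jr_def using True by (intro S(3)) auto
      finally show ?thesis using True by simp
    qed (simp add: F_def)
    have "set_integrable lborel {0<..<1} (\<lambda>x. \<bar>g x\<bar> * x powr ((1 - Re w) - 1))"
      using w by (intro square_integrable_mellin(1)[OF _ g]) auto
    thus "integrable lborel (\<lambda>x. \<integral>y. norm (case (x, y) of (x, y) \<Rightarrow> F x y) \<partial>lborel)"
      unfolding eq set_integrable_def by (intro integrable_mult_left)
  qed measurable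
  have "(\<integral>y. \<integral>x. F x y \<partial>lborel \<partial>lborel) = (\<integral>x. \<integral>y. F x y \<partial>lborel \<partial>lborel)"
    by (rule lborel_pair.Fubini_integral[OF int])
  also have "(\<lambda>x. \<integral>y. F x y \<partial>lborel) =
      (\<lambda>x. (indicator {0<..<1} x *\<^sub>R (of_real (g x) * of_real x powr ((1 - w) - 1))) * ?J)"
  proof (intro ext)
    fix x :: real
    show "(\<integral>y. F x y \<partial>lborel) = (indicator {0<..<1} x *\<^sub>R (of_real (g x) * of_real x powr ((1 - w) - 1))) * ?J"
    proof (cases "x \<in> {0<..<1}")
      case True
      have "(\<integral>y. F x y \<partial>lborel) = g x *\<^sub>R (LBINT y:{0<..}. \<phi> x y)"
        unfolding set_lebesgue_integral_def integral_scaleR_right[symmetric]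
        using True by (intro Bochner_Integration.integral_cong) (auto simp: F_def)
      also have "(LBINT y:{0<..}. \<phi> x y) = of_real x powr (-w) * ?J"
        unfolding \<phi>_def using True by (intro S(2)) auto
      finally show ?thesis using True by (simp add: scaleR_conv_of_real)
    qed (simp add: F_def)
  qed
  also have "(\<integral>x. (indicator {0<..<1} x *\<^sub>R (of_real (g x) * of_real x powr ((1 - w) - 1))) * ?J \<partial>lborel) =
      mellin g (1 - w) * ?J"
    unfolding mellin_def set_lebesgue_integral_def by (rule integral_mult_left_zero)
  finally have 1: "(\<integral>y. \<integral>x. F x y \<partial>lborel \<partial>lborel) = mellin g (1 - w) * ?J" .
  let ?h = "frac_correlation g"
  have g1: "set_integrable lborel {0<..<1} g"
  proof -
    have "set_integrable lborel {0<..<1} (\<lambda>x. \<bar>g x\<bar> * x powr (1 - 1))"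
      by (rule square_integrable_mellin(1)[OF _ g]) auto
    moreover have "set_integrable lborel {0<..<1} (\<lambda>x. \<bar>g x\<bar> * x powr (1 - 1)) \<longleftrightarrow>
        set_integrable lborel {0<..<1} (\<lambda>x. \<bar>g x\<bar>)"
      by (rule set_integrable_cong) auto
    ultimately show ?thesis
      by (subst (asm) set_integrable_abs_iff) (auto simp: set_borel_measurable_def)
  qed
  note fc[measurable] = frac_correlation(1)[OF _ g1, measurable]
  have hb: "\<bar>?h a\<bar> \<le> (LBINT x:{0<..<1}. \<bar>g x\<bar>)" for a by (rule frac_correlation(2)[OF _ g1]) auto
  let ?k = "\<lambda>a. complex_of_real (?h a) * of_real a powr (w - 1)"
  have Fh: "(\<integral>x. F x y \<partial>lborel) = indicator {0<..} y *\<^sub>R ?k y" for y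
  proof -
    have "(\<integral>x. F x y \<partial>lborel) = (\<integral>x. complex_of_real (indicator {0<..<1} x * (g x * frac (1 / (y * x)))) *
       (indicator {0<..} y *\<^sub>R complex_of_real y powr (w - 1)) \<partial>lborel)"
      by (intro Bochner_Integration.integral_cong)
         (auto simp: F_def \<phi>_def scaleR_conv_of_real mult_ac)
    also have "\<dots> = (\<integral>x. complex_of_real (indicator {0<..<1} x * (g x * frac (1 / (y * x)))) \<partial>lborel) *
       (indicator {0<..} y *\<^sub>R complex_of_real y powr (w - 1))"
      by (rule integral_mult_left_zero)
    also have "(\<integral>x. complex_of_real (indicator {0<..<1} x * (g x * frac (1 / (y * x)))) \<partial>lborel) = of_real (?h y)"
      unfolding integral_complex_of_real frac_correlation_def set_lebesgue_integral_def by simp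
    finally show ?thesis by simp
  qed
  have i1: "set_integrable lborel {0<..<1} ?k"
    by (rule mellin_integrand_integrable[OF _ bounded_mellin_integrable(1)[OF _ hb w(1)]]) auto
  have eq: "?k v = of_real \<kappa> * of_real v powr ((w - 1) - 1)" if "v > 1" for v
  proof -
    have "complex_of_real v powr ((w - 1) - 1) = of_real v powr (w - 1) / of_real v powr 1"
      by (rule powr_diff)
    thus ?thesis using that by (simp add: powr_to_1 h)
  qed
  have e2: "set_integrable lborel {1<..} ?k \<longleftrightarrow>
      set_integrable lborel {1<..} (\<lambda>v. of_real \<kappa> * complex_of_real v powr ((w - 1) - 1))"
    by (rule set_integrable_cong) (auto simp: eq)
  have e3: "(LBINT v:{1<..}. ?k v) = (LBINT v:{1<..}. of_real \<kappa> * complex_of_real v powr ((w - 1) - 1))"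
    by (rule set_lebesgue_integral_cong) (auto simp: eq)
  have i2: "set_integrable lborel {1<..} ?k" "(LBINT v:{1<..}. ?k v) = of_real \<kappa> * (1 / (1 - w))"
    unfolding e2 e3 using powr_set_integral_infinity_complex[of "w - 1"] w
      minus_divide_right[of 1 "w - 1"] by auto
  have "(\<integral>y. \<integral>x. F x y \<partial>lborel \<partial>lborel) = (LBINT y:{0<..}. ?k y)"
    unfolding Fh set_lebesgue_integral_def ..
  also have "\<dots> = mellin ?h w + of_real \<kappa> * (1 / (1 - w))"
    unfolding mellin_def i2(2)[symmetric]
    by (rule set_integral_halfline_split(2)[OF i1 i2(1)]) measurable
  finally have 2: "(\<integral>y. \<integral>x. F x y \<partial>lborel \<partial>lborel) = mellin ?h w + of_real \<kappa> * (1 / (1 - w))" .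
  have nz: "w \<noteq> 0" "1 - w \<noteq> 0" using w by auto
  have "mellin g (1 - w) * zeta_reg w = mellin g (1 - w) * ?J * (w * (1 - w))"
    using nz by (simp only: mult.assoc) simp
  also have "\<dots> = (mellin ?h w + of_real \<kappa> * (1 / (1 - w))) * (w * (1 - w))"
    using 1 2 by simp
  also have "\<dots> = w * (1 - w) * mellin ?h w + of_real \<kappa> * w * ((1 - w) / (1 - w))"
  proof -
    have "(x + k * (1 / u)) * (w * u) = w * u * x + k * w * (u / u)" for x k u :: complex
      by (cases "u = 0") (simp_all add: field_simps)
    thus ?thesis .
  qed
  also have "(1 - w) / (1 - w) = 1" using nz by simp
  finally show ?thesis by simp
qed

section \<open>Entire continuation of quotients\<close>

text \<open>\<open>e\<close> is continuous and equals B/Z away from \<open>p\<close>, so it is the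
  limit of B/Z at every point of \<open>A\<close>. Hence a globally defined quotient agrees with
  each local one.\<close>

lemma remove_sings_quotient_eq:
  assumes A: "open A" and e: "e holomorphic_on A" and p: "p \<in> A"
    and eq: "\<And>w. w \<in> A \<Longrightarrow> e w * Z w = B w" and nz: "\<And>w. w \<in> A - {p} \<Longrightarrow> Z w \<noteq> 0"
    and w: "w \<in> A"
  shows "remove_sings (\<lambda>u. B u / Z u) w = (e w :: complex)"
proof (rule remove_sings_eqI)
  have "isCont e w"
    by (rule continuous_on_interior[OF holomorphic_on_imp_continuous_on[OF e]])
       (use A w in \<open>simp add: interior_open\<close>)
  hence "e \<midarrow>w\<rightarrow> e w" by (simp add: isCont_def)
  moreover have "\<forall>\<^sub>F u in at w. u \<in> A - {p}"
    using eventually_at_in_open[of "A - {p}" w] eventually_at_in_open[OF A w] A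
    by (cases "w = p") (auto simp: eventually_conj_iff open_delete w elim!: eventually_mono)
  hence "\<forall>\<^sub>F u in at w. e u = B u / Z u"
    by eventually_elim (use eq nz in \<open>auto simp: field_simps\<close>)
  ultimately show "(\<lambda>u. B u / Z u) \<midarrow>w\<rightarrow> e w"
    by (rule Lim_transform_eventually)
qed

text \<open>At a zero of order \<open>n\<close> of \<open>Z\<close> on the critical line, the growth of \<open>G\<close> from the left allows
  only a pole of order below one, so \<open>B\<close> vanishes there to order at least \<open>n\<close>.\<close>

lemma local_quotient_critical_line:
  assumes Z: "Z holomorphic_on {w. Re w > 0}" and B: "B holomorphic_on {w. Re w > 0}"
    and GZ: "\<And>w. 0 < Re w \<Longrightarrow> Re w < 1 / 2 \<Longrightarrow> G w * Z w = B w"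
    and G: "\<And>w. Re w < 1 / 2 \<Longrightarrow> norm (G w) \<le> C / sqrt (1 / 2 - Re w)"
    and nz: "\<And>w. Re w > 1 / 2 \<Longrightarrow> Z w \<noteq> 0" and p: "Re p \<ge> 1 / 2"
  obtains r e where "r > 0" "ball p r \<subseteq> {w. Re w > 0}" "e holomorphic_on ball p r"
    "\<And>w. w \<in> ball p r \<Longrightarrow> e w * Z w = B w" "\<And>w. w \<in> ball p r - {p} \<Longrightarrow> Z w \<noteq> (0::complex)"
proof -
  let ?U = "{w::complex. Re w > 0}"
  have U: "open ?U" "connected ?U" "p \<in> ?U"
    using p by (auto intro: open_halfspace_Re_gt convex_connected convex_halfspace_Re_gt)
  have "\<exists>w\<in>?U. Z w \<noteq> 0" using nz[of 1] by force
  then obtain n D where D: "D holomorphic_on ?U" "\<And>w. w \<in> ?U \<Longrightarrow> Z w = (w - p) ^ n * D w" "D p \<noteq> 0"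
    using holomorphic_factor_zero[OF Z U] by metis
  have "isCont D p"
    by (rule continuous_on_interior[OF holomorphic_on_imp_continuous_on[OF D(1)]])
       (use U in \<open>simp add: interior_open\<close>)
  then obtain r0 where r0: "r0 > 0" "\<And>w. dist p w < r0 \<Longrightarrow> D w \<noteq> 0"
    using continuous_at_avoid[of p D 0] D(3) by auto
  obtain r1 where r1: "r1 > 0" "ball p r1 \<subseteq> ?U" using U by (meson openE)
  define r where "r = min r0 r1"
  have r: "r > 0" "ball p r \<subseteq> ?U" "\<And>w. w \<in> ball p r \<Longrightarrow> D w \<noteq> 0"
    using r0 r1 by (auto simp: r_def)
  have rnz: "Z w \<noteq> 0" if "w \<in> ball p r - {p}" for w
    using D(2)[of w] r that by auto
  show ?thesis
  proof (cases "\<exists>w\<in>?U. B w \<noteq> 0")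
    case False
    \<comment> \<open>If \<open>B\<close> vanishes identically it has no order at \<open>p\<close>,
      and the quotient is 0.\<close>
    show ?thesis by (rule that[of r "\<lambda>_. 0"]) (use False r rnz in auto)
  next
    case True
    then obtain m H where H: "H holomorphic_on ?U" "\<And>w. w \<in> ?U \<Longrightarrow> B w = (w - p) ^ m * H w" "H p \<noteq> 0"
      using holomorphic_factor_zero[OF B U] by metis
    have "n \<le> m"
    proof (rule ccontr)
      assume "\<not> n \<le> m"
      hence mn: "m < n" by simp
      have "Re p = 1 / 2"
      proof (rule ccontr)
        assume "Re p \<noteq> 1 / 2"
        hence "Z p \<noteq> 0" using p by (intro nz) auto
        thus False using D(2)[OF U(3)] mn by simp
      qed
      \<comment> \<open>Approach \<open>p\<close> horizontally from the left, where the bound on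
        \<open>G\<close> reads C / sqrt x. It gives x^m |H| \<le> C x^(n - 1/2) |D|; with n >= m + 1
        a factor sqrt x survives on the right, and H p = 0 follows in the limit.\<close>
      let ?q = "\<lambda>x. p - complex_of_real x"
      have q: "filterlim ?q (nhds p) (at_right 0)"
        by (auto intro!: tendsto_eq_intros)
      have H_lim: "((\<lambda>x. norm (H (?q x))) \<longlongrightarrow> norm (H p)) (at_right 0)"
      proof -
        have "isCont H p"
          by (rule continuous_on_interior[OF holomorphic_on_imp_continuous_on[OF H(1)]])
             (use U in \<open>simp add: interior_open\<close>)
        thus ?thesis using q by (intro tendsto_norm isCont_tendsto_compose[of p H]) auto
      qed
      have D_lim: "((\<lambda>x. C * sqrt x * norm (D (?q x))) \<longlongrightarrow> C * sqrt 0 * norm (D p)) (at_right 0)"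
        using q \<open>isCont D p\<close> by (intro tendsto_intros isCont_tendsto_compose[of p D]) auto
      have "\<forall>\<^sub>F x::real in at_right 0. x < 1 / 2"
        by (rule eventually_at_rightI[of 0 "1 / 2"]) auto
      with eventually_at_right_less[of "0::real"]
      have "\<forall>\<^sub>F x in at_right 0. norm (H (?q x)) \<le> C * sqrt x * norm (D (?q x))"
      proof eventually_elim
        case (elim x)
        let ?w = "?q x"
        have w: "0 < Re ?w" "Re ?w < 1 / 2" using elim \<open>Re p = 1 / 2\<close> by auto
        have nw: "norm (?w - p) = x" using elim by simp
        have "x ^ m * norm (H ?w) = norm (B ?w)"
          using H(2)[of ?w] w nw by (simp add: norm_mult norm_power)
        also have "\<dots> = norm (G ?w) * norm (Z ?w)" using GZ[OF w] by (simp flip: norm_mult)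
        also have "norm (Z ?w) = x ^ n * norm (D ?w)"
          using D(2)[of ?w] w nw by (simp add: norm_mult norm_power)
        also have "norm (G ?w) * (x ^ n * norm (D ?w)) \<le> C / sqrt x * (x ^ n * norm (D ?w))"
          using G[OF w(2)] elim \<open>Re p = 1 / 2\<close> by (intro mult_right_mono) auto
        also have "\<dots> = C * (x ^ n / sqrt x) * norm (D ?w)" by simp
        also have "\<dots> \<le> C * (x ^ m * sqrt x) * norm (D ?w)"
        proof -
          have "x ^ n \<le> x ^ Suc m" using mn elim by (intro power_decreasing) auto
          hence "x ^ n / sqrt x \<le> x ^ Suc m / sqrt x" using elim by (intro divide_right_mono) auto
          also have "\<dots> = x ^ m * (x / sqrt x)" by simp
          also have "x / sqrt x = sqrt x" using elim by (intro real_div_sqrt) auto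
          finally have "x ^ n / sqrt x \<le> x ^ m * sqrt x" .
          moreover have "C \<ge> 0" using order_trans[OF norm_ge_zero G[of 0]] by (simp add: zero_le_divide_iff)
          ultimately show ?thesis by (intro mult_right_mono mult_left_mono) auto
        qed
        finally have "x ^ m * norm (H ?w) \<le> x ^ m * (C * sqrt x * norm (D ?w))" by (simp add: mult_ac)
        thus ?case using elim by simp
      qed
      hence "norm (H p) \<le> C * sqrt 0 * norm (D p)"
        by (rule tendsto_le[OF _ D_lim H_lim, rotated]) simp
      thus False using H(3) by simp
    qed
    show ?thesis
    proof (rule that[of r "\<lambda>w. (w - p) ^ (m - n) * H w / D w"])
      have "H holomorphic_on ball p r" "D holomorphic_on ball p r"
        using H(1) D(1) r(2) holomorphic_on_subset by blast+
      thus "(\<lambda>w. (w - p) ^ (m - n) * H w / D w) holomorphic_on ball p r"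
        using r(3) by (intro holomorphic_intros)
      fix w assume w: "w \<in> ball p r"
      have "(w - p) ^ (m - n) * (w - p) ^ n = (w - p) ^ m"
        using \<open>n \<le> m\<close> by (simp flip: power_add)
      thus "(w - p) ^ (m - n) * H w / D w * Z w = B w"
        using D(2)[of w] H(2)[of w] r(2,3) w by (auto simp: field_simps subset_iff)
    qed (use r rnz in auto)
  qed
qed

text \<open>\<open>E\<close> is \<open>G\<close> to the left of the critical line and B/Z with
  singularities removed elsewhere. Around each point with Re >= 1/2 both definitions coincide with
  the local holomorphic quotient, since \<open>Z\<close> has no other zero nearby.\<close>

lemma entire_quotient:
  assumes Z: "Z holomorphic_on {w. Re w > 0}" and B: "B holomorphic_on {w. Re w > 0}"
    and Ghol: "G holomorphic_on {w. Re w < 1 / 2}"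
    and GZ: "\<And>w. 0 < Re w \<Longrightarrow> Re w < 1 / 2 \<Longrightarrow> G w * Z w = B w"
    and G: "\<And>w. Re w < 1 / 2 \<Longrightarrow> norm (G w) \<le> C / sqrt (1 / 2 - Re w)"
    and nz: "\<And>w. Re w > 1 / 2 \<Longrightarrow> Z w \<noteq> 0"
  obtains E where "E holomorphic_on UNIV" "\<And>w. Re w < 1 / 2 \<Longrightarrow> E w = G w"
    "\<And>w. Re w > 0 \<Longrightarrow> E w * Z w = (B w :: complex)"
proof -
  define E where "E = (\<lambda>w. if Re w < 1 / 2 then G w else remove_sings (\<lambda>u. B u / Z u) w)"
  have loc: "\<exists>r>0. E holomorphic_on ball p r \<and> E p * Z p = B p" if p: "Re p \<ge> 1 / 2" for p
  proof -
    obtain r e where e: "r > 0" "ball p r \<subseteq> {w. Re w > 0}" "e holomorphic_on ball p r"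
        "\<And>w. w \<in> ball p r \<Longrightarrow> e w * Z w = B w" "\<And>w. w \<in> ball p r - {p} \<Longrightarrow> Z w \<noteq> 0"
      using local_quotient_critical_line[OF Z B GZ G nz p] by metis
    have eq: "E w = e w" if w: "w \<in> ball p r" for w
    proof (cases "Re w < 1 / 2")
      case True
      have "Re w > 0" using w e(2) by auto
      hence "G w * Z w = e w * Z w" using GZ[of w] e(4)[OF w] True by simp
      moreover have "w \<noteq> p" using True p by auto
      hence "Z w \<noteq> 0" using e(5) w by blast
      ultimately show ?thesis using True by (simp add: E_def)
    next
      case False
      have "remove_sings (\<lambda>u. B u / Z u) w = e w"
        by (rule remove_sings_quotient_eq[OF open_ball e(3) _ e(4,5) w]) (use e(1) in auto)
      thus ?thesis using False by (simp add: E_def)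
    qed
    have "E holomorphic_on ball p r"
      by (rule holomorphic_transform[OF e(3)]) (simp add: eq)
    thus ?thesis using e(1) e(4)[of p] eq[of p] by auto
  qed
  have op: "open {w. Re w < 1 / 2}" by (rule open_halfspace_Re_lt)
  have "E holomorphic_on {w. Re w < 1 / 2}"
    by (rule holomorphic_transform[OF Ghol]) (simp add: E_def)
  hence "\<exists>d. (E has_field_derivative d) (at p)" for p
  proof (cases "Re p < 1 / 2")
    case True
    thus ?thesis using \<open>E holomorphic_on {w. Re w < 1 / 2}\<close> holomorphic_on_open[OF op] by blast
  next
    case False
    then obtain r where "r > 0" "E holomorphic_on ball p r" using loc[of p] by auto
    thus ?thesis using holomorphic_on_open[of "ball p r" E] by auto
  qed
  hence "E holomorphic_on UNIV" by (simp add: holomorphic_on_open)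
  moreover have "E w * Z w = B w" if "Re w > 0" for w
    using GZ[of w] loc[of w] that by (cases "Re w < 1 / 2") (auto simp: E_def)
  ultimately show ?thesis using that[of E] by (simp add: E_def)
qed

text \<open>By Liouville's theorem \<open>E\<close> is a polynomial. A nonconstant one would be
  unbounded along the negative real axis, so \<open>E\<close> is constant and equal to its
  limit.\<close>

lemma polynomial_growth_vanishing:
  assumes E: "E holomorphic_on UNIV" and bd: "\<And>w. norm (E w) \<le> A * (norm w + 5) ^ N"
    and lim: "((\<lambda>x. E (of_real x)) \<longlongrightarrow> 0) at_bot"
  shows "E w = 0"
proof -
  define y where "y = (norm (0::complex) + 5) ^ N"
  have y: "y > 0" unfolding y_def by (rule zero_less_power) simp
  have "0 \<le> A * y" unfolding y_def by (rule order_trans[OF norm_ge_zero bd])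
  hence "0 / y \<le> A" by (simp only: pos_divide_le_eq[OF y])
  hence A: "A \<ge> 0" by simp
  define c where "c = (\<lambda>k. (deriv ^^ k) E 0 / fact k)"
  \<comment> \<open>Beyond radius 5 the shift by 5 at most doubles the norm, whence the factor
    2^N.\<close>
  have E_le: "norm (E z) \<le> (A * 2 ^ N) * norm z ^ N" if "5 \<le> norm z" for z
  proof -
    have "(norm z + 5) ^ N \<le> (2 * norm z) ^ N" using that by (intro power_mono) auto
    hence "A * (norm z + 5) ^ N \<le> A * (2 * norm z) ^ N" by (rule mult_left_mono[OF _ A])
    also have "A * (2 * norm z) ^ N = (A * 2 ^ N) * norm z ^ N"
      by (simp only: power_mult_distrib mult.assoc)
    finally show ?thesis using bd[of z] by (rule order_trans[rotated])
  qed
  have E_eq: "E \<xi> = (\<Sum>k\<le>N. c k * \<xi> ^ k)" for \<xi>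
    unfolding c_def by (rule Liouville_polynomial[OF E E_le])
  have inf: "filterlim (\<lambda>x. complex_of_real x) at_infinity at_bot"
    unfolding filterlim_at_infinity_conv_norm_at_top norm_of_real by real_asymp
  have c0: "c k = 0" if "k \<noteq> 0" "k \<le> N" for k
  proof (rule ccontr)
    assume "c k \<noteq> 0"
    hence "eventually (\<lambda>z. norm (\<Sum>i\<le>N. c i * z ^ i) \<ge> 1) at_infinity"
      using that by (intro polyfun_extremal) auto
    hence "eventually (\<lambda>z. norm (E z) \<ge> 1) at_infinity" by (simp flip: E_eq)
    hence "eventually (\<lambda>x. norm (E (of_real x)) \<ge> 1) at_bot"
      using inf by (rule eventually_compose_filterlim)
    hence "norm (0::complex) \<ge> 1"
      by (intro tendsto_lowerbound[OF tendsto_norm[OF lim]]) auto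
    thus False by simp
  qed
  have const: "E \<xi> = c 0" for \<xi>
  proof -
    have "E \<xi> = (\<Sum>k\<le>N. if k = 0 then c 0 else 0)"
      unfolding E_eq by (intro sum.cong refl) (auto simp: c0)
    thus ?thesis by simp
  qed
  hence "((\<lambda>x::real. c 0) \<longlongrightarrow> 0) at_bot" using lim by simp
  hence "c 0 = 0" by (simp add: tendsto_const_iff)
  thus ?thesis using const by simp
qed

section \<open>Functions orthogonal to the Beurling functions\<close>

lemma zeta_reg_nonzero_of_RH:
  assumes "Riemann_Hypothesis" "Re s > 1 / 2"
  shows "zeta_reg s \<noteq> 0"
proof (cases "Re s < 1")
  case True
  hence "zeta s \<noteq> 0" using assms by (simp add: Riemann_Hypothesis_def)
  moreover have "s \<noteq> 1" "Re s > 0" using True assms by auto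
  ultimately show ?thesis by (simp add: zeta_reg_eq)
qed (simp add: zeta_reg_nonzero)

lemma norm_zeta_reg_ge:
  assumes "Re s \<ge> 2"
  shows "norm (zeta_reg s) \<ge> 1 / 4"
proof -
  have "1 * (1 / 4) \<le> norm (s - 1) * norm (zeta s)"
    using assms norm_zeta_ge[OF assms] complex_Re_le_cmod[of "s - 1"] by (intro mult_mono) auto
  moreover have "zeta_reg s = (s - 1) * zeta s" using assms by (intro zeta_reg_eq) auto
  ultimately show ?thesis by (simp add: norm_mult)
qed

lemma mellin_1:
  assumes [measurable]: "g \<in> borel_measurable borel"
  shows "mellin g 1 = of_real (LBINT x:{0<..<1}. g x)"
proof -
  have "mellin g 1 = (LBINT x:{0<..<1}. complex_of_real (g x))"
    unfolding mellin_def by (rule set_lebesgue_integral_cong) auto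
  thus ?thesis by (simp add: set_integral_complex_of_real)
qed

text \<open>No lower bound for \<open>zeta_reg\<close> near w is used. For 1/4 \<le> Re w < 2 the
  disc of radius 15/8 about 2 + i Im w stays in Re >= 1/8, and w lies within 7/4 = (14/15)(15/8) of
  the centre; r = 14/15 gives the exponent (1+r)/(1-r) = 29. With m = 1/4 the base 2M/m is 8K
  (|w|+5)^2, hence the degree 58.\<close>

lemma quotient_growth:
  assumes E: "E holomorphic_on {w. Re w > 0}"
    and EZ: "\<And>w. Re w > 0 \<Longrightarrow> E w * zeta_reg w = B w"
    and B: "\<And>w. Re w \<ge> 1 / 8 \<Longrightarrow> norm (B w) \<le> K * (norm w + 1)\<^sup>2" and K: "K \<ge> 9"
    and w: "Re w \<ge> 1 / 4"
  shows "norm (E w) \<le> (8 * K) ^ 29 * (norm w + 5) ^ 58"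
proof -
  \<comment> \<open>Division by Re w >= 1/8 costs a factor 8, and the linear term adds 1; this is
    the origin of the condition K >= 9.\<close>
  have Z: "norm (zeta_reg w) \<le> K * (norm w + 1)\<^sup>2" if w: "Re w \<ge> 1 / 8" for w
  proof -
    have "norm (zeta_reg w) \<le> norm w + norm w * norm (w - 1) / Re w"
      using w by (intro norm_zeta_reg_le) auto
    moreover have "norm w * norm (w - 1) / Re w \<le> norm w * norm (w - 1) / (1 / 8)"
      using w by (intro divide_left_mono) auto
    hence "norm w * norm (w - 1) / Re w \<le> 8 * (norm w * norm (w - 1))" by simp
    moreover have "norm w * norm (w - 1) \<le> (norm w + 1) * (norm w + 1)"
      using norm_triangle_ineq4[of w 1] by (intro mult_mono) auto
    moreover have "norm w \<le> (norm w + 1) * (norm w + 1)"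
      by (simp add: algebra_simps)
    moreover have "z \<le> n + b \<Longrightarrow> b \<le> 8 * x \<Longrightarrow> x \<le> y \<Longrightarrow> n \<le> y \<Longrightarrow> z \<le> 9 * y" for z n b x y :: real
      by linarith
    ultimately have "norm (zeta_reg w) \<le> 9 * (norm w + 1)\<^sup>2" unfolding power2_eq_square by blast
    also have "\<dots> \<le> K * (norm w + 1)\<^sup>2" using K by (intro mult_right_mono) auto
    finally show ?thesis .
  qed
  have conv: "((8 * K) * (norm w + 5)\<^sup>2) ^ 29 = (8 * K) ^ 29 * (norm w + 5) ^ 58"
    unfolding power_mult_distrib power_mult[symmetric] by simp
  have ge1: "1 \<le> (8 * K) * (norm w + 5)\<^sup>2"
    using K mult_mono[of 1 "8 * K" 1 "(norm w + 5)\<^sup>2"] one_le_power[of "norm w + 5" 2] by simp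
  show ?thesis
  proof (cases "Re w \<ge> 2")
    case True
    have "norm (E w) * (1 / 4) \<le> norm (E w) * norm (zeta_reg w)"
      using norm_zeta_reg_ge[OF True] by (intro mult_left_mono) auto
    also have "\<dots> = norm (B w)" using EZ[of w] True by (simp flip: norm_mult)
    also have "\<dots> \<le> K * (norm w + 1)\<^sup>2" using True by (intro B) auto
    also have "\<dots> \<le> K * (norm w + 5)\<^sup>2" using K by (intro mult_left_mono power_mono) auto
    finally have "norm (E w) \<le> 4 * (K * (norm w + 5)\<^sup>2)" by simp
    also have "\<dots> \<le> 8 * (K * (norm w + 5)\<^sup>2)" using K by (intro mult_right_mono) auto
    also have "\<dots> = ((8 * K) * (norm w + 5)\<^sup>2) ^ 1" by simp
    also have "\<dots> \<le> ((8 * K) * (norm w + 5)\<^sup>2) ^ 29"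
      by (rule power_increasing[OF _ ge1]) simp
    finally show ?thesis unfolding conv .
  next
    case False
    define c where "c = Complex 2 (Im w)"
    define M where "M = K * (norm w + 5)\<^sup>2"
    have wc: "w - c = of_real (Re w - 2)" by (simp add: c_def complex_eq_iff)
    have nwc: "norm (w - c) \<le> 7 / 4"
      unfolding wc norm_of_real using w False by auto
    have ball: "Re z \<ge> 1 / 8 \<and> K * (norm z + 1)\<^sup>2 \<le> M" if "z \<in> cball c (15 / 8)" for z
    proof
      have n: "norm (c - z) \<le> 15 / 8" using that by (simp add: dist_norm)
      have "Re (c - z) \<le> 15 / 8" using complex_Re_le_cmod[of "c - z"] n by linarith
      thus "Re z \<ge> 1 / 8" by (simp add: c_def)
      \<comment> \<open>The distances 7/4 and 15/8 add up to less than 4, which turns |z| + 1 into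
        at most |w| + 5.\<close>
      have "norm z \<le> norm w + norm (w - c) + norm (c - z)"
        using norm_triangle_ineq4[of w "w - z"] norm_triangle_ineq[of "w - c" "c - z"] by simp
      hence "norm z + 1 \<le> norm w + 5" using n nwc by simp
      thus "K * (norm z + 1)\<^sup>2 \<le> M" unfolding M_def using K by (intro mult_left_mono power_mono) auto
    qed
    have U: "open {w. Re w > 0}" "connected {w. Re w > 0}"
      by (intro open_halfspace_Re_gt convex_connected convex_halfspace_Re_gt)+
    have pos: "Re z > 0" if "z \<in> cball c (15 / 8)" for z using ball[OF that] by linarith
    have "norm (E w) \<le> (2 * M / (1 / 4)) powr ((1 + 14 / 15) / (1 - 14 / 15))"
    proof (rule quotient_bound_disc[where U = "{w. Re w > 0}" and c = c and R = "15 / 8" and Z = zeta_reg and E = E])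
      show "cball c (15 / 8) \<subseteq> {w. Re w > 0}" using pos by blast
      show "zeta_reg holomorphic_on {w. Re w > 0}" by (rule zeta_reg_holomorphic)
      show "norm (zeta_reg z) \<le> M" if "z \<in> cball c (15 / 8)" for z
        using Z[of z] ball[OF that] by linarith
      show "norm (E z * zeta_reg z) \<le> M" if "z \<in> cball c (15 / 8)" for z
        using B[of z] ball[OF that] EZ[OF pos[OF that]] by simp
      show "1 / 4 \<le> norm (zeta_reg c)" by (rule norm_zeta_reg_ge) (simp add: c_def)
      show "norm (w - c) \<le> 14 / 15 * (15 / 8)" using nwc by simp
    qed (use E U in auto)
    also have "(1 + 14 / 15) / (1 - 14 / 15) = real 29" by simp
    also have "2 * M / (1 / 4) = (8 * K) * (norm w + 5)\<^sup>2" by (simp add: M_def)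
    also have "((8 * K) * (norm w + 5)\<^sup>2) powr real 29 = ((8 * K) * (norm w + 5)\<^sup>2) ^ 29"
      using ge1 by (intro powr_realpow) linarith
    finally show ?thesis unfolding conv .
  qed
qed

text \<open>Orthogonality enters through the values of \<open>frac_correlation g\<close> beyond 1.
  The unspecified \<kappa> only adds a linear term to B, which affects neither holomorphy nor
  polynomial growth.\<close>

theorem integral_eq_0_of_orthogonal:
  fixes g :: "real \<Rightarrow> real"
  assumes RH: "Riemann_Hypothesis" and [measurable]: "g \<in> borel_measurable borel"
    and g: "set_integrable lborel {0<..<1} (\<lambda>x. (g x)\<^sup>2)"
    and g1: "set_integrable lborel {0<..<1} g"
    and h: "\<And>a. a > 1 \<Longrightarrow> frac_correlation g a = \<kappa> / a"
  shows "(LBINT x:{0<..<1}. g x) = 0"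
proof -
  let ?h = "frac_correlation g"
  define B where "B = (\<lambda>w. w * (1 - w) * mellin ?h w + of_real \<kappa> * w)"
  define G where "G = (\<lambda>w. mellin g (1 - w))"
  define C where "C = ((LBINT x:{0<..<1}. (g x)\<^sup>2) + 1) / 2"
  define c where "c = (LBINT x:{0<..<1}. \<bar>g x\<bar>)"
  have fc [measurable]: "?h \<in> borel_measurable borel"
    by (rule frac_correlation(1)[OF _ g1]) measurable
  have hb: "\<bar>?h a\<bar> \<le> c" for a unfolding c_def by (rule frac_correlation(2)[OF _ g1]) measurable
  note mh = bounded_mellin[OF fc hb]
  have c: "c \<ge> 0" using hb[of 0] by linarith
  have C: "C \<ge> 0" unfolding C_def set_lebesgue_integral_def by simp
  have Bhol: "B holomorphic_on {w. Re w > 0}"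
    unfolding B_def by (intro holomorphic_intros mh)
  have "mellin g holomorphic_on {s. Re s > 1 / 2}"
    by (intro mellin_holomorphic square_integrable_mellin g) auto
  hence "(mellin g \<circ> (\<lambda>w. 1 - w)) holomorphic_on {w. Re w < 1 / 2}"
    by (rule holomorphic_on_compose_gen[rotated]) (auto intro!: holomorphic_intros)
  hence Ghol: "G holomorphic_on {w. Re w < 1 / 2}" by (simp add: G_def o_def)
  have GZ: "G w * zeta_reg w = B w" if "0 < Re w" "Re w < 1 / 2" for w
    unfolding G_def B_def by (rule mellin_frac_correlation[OF _ g that h]) auto
  have G: "norm (G w) \<le> C / sqrt (1 / 2 - Re w)" if w: "Re w < 1 / 2" for w
  proof -
    have "norm (G w) \<le> (LBINT x:{0<..<1}. \<bar>g x\<bar> * x powr ((1 - Re w) - 1))"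
      unfolding G_def using w by (intro norm_mellin_le square_integrable_mellin(1) g) auto
    also have "\<dots> \<le> ((LBINT x:{0<..<1}. (g x)\<^sup>2) + 1) / (2 * sqrt (2 * (1 - Re w) - 1))"
      using w by (intro square_integrable_mellin(2) g) auto
    also have "\<dots> = C / sqrt (2 * (1 - Re w) - 1)" by (simp add: C_def)
    also have "\<dots> \<le> C / sqrt (1 / 2 - Re w)"
      using w C by (intro divide_left_mono mult_pos_pos) auto
    finally show ?thesis .
  qed
  obtain E where E: "E holomorphic_on UNIV" "\<And>w. Re w < 1 / 2 \<Longrightarrow> E w = G w"
    "\<And>w. Re w > 0 \<Longrightarrow> E w * zeta_reg w = B w"
    using entire_quotient[OF zeta_reg_holomorphic Bhol Ghol GZ G zeta_reg_nonzero_of_RH[OF RH]] by blast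
  \<comment> \<open>On Re w >= 1/8 the transform of \<open>?h\<close> is at most 8c; the summand 9
    is the minimum required by \<open>quotient_growth\<close>.\<close>
  define K where "K = 9 + 8 * c + \<bar>\<kappa>\<bar>"
  have K: "K \<ge> 9" using c by (simp add: K_def)
  have Ble: "norm (B w) \<le> K * (norm w + 1)\<^sup>2" if w: "Re w \<ge> 1 / 8" for w
  proof -
    have "norm (mellin ?h w) \<le> c / Re w" using w by (intro mh) auto
    also have "\<dots> \<le> c / (1 / 8)" using w c by (intro divide_left_mono) auto
    finally have m: "norm (mellin ?h w) \<le> 8 * c" by simp
    have "norm (B w) \<le> norm (w * (1 - w) * mellin ?h w) + norm (of_real \<kappa> * w)"
      unfolding B_def by (rule norm_triangle_ineq)
    also have "\<dots> = norm w * norm (1 - w) * norm (mellin ?h w) + \<bar>\<kappa>\<bar> * norm w" by (simp add: norm_mult)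
    also have "norm w * norm (1 - w) * norm (mellin ?h w) \<le> (norm w + 1) * (norm w + 1) * (8 * c)"
      using norm_triangle_ineq4[of 1 w] m by (intro mult_mono) auto
    also have "\<bar>\<kappa>\<bar> * norm w \<le> \<bar>\<kappa>\<bar> * ((norm w + 1) * (norm w + 1))"
      by (intro mult_left_mono) (auto simp: algebra_simps)
    finally have "norm (B w) \<le> (8 * c + \<bar>\<kappa>\<bar>) * (norm w + 1)\<^sup>2"
      by (simp add: power2_eq_square distrib_right mult_ac)
    also have "\<dots> \<le> K * (norm w + 1)\<^sup>2" by (intro mult_right_mono) (auto simp: K_def)
    finally show ?thesis .
  qed
  \<comment> \<open>The first summand covers Re w >= 1/4, the second the remaining half-plane, where
    E = G and C / sqrt(1/4) = 2C.\<close>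
  define A where "A = (8 * K) ^ 29 + 2 * C"
  have "norm (E w) \<le> A * (norm w + 5) ^ 58" for w
  proof (cases "Re w \<ge> 1 / 4")
    case True
    have "norm (E w) \<le> (8 * K) ^ 29 * (norm w + 5) ^ 58"
      by (rule quotient_growth[OF _ E(3) Ble K True]) (use E(1) holomorphic_on_subset in auto)
    also have "\<dots> \<le> A * (norm w + 5) ^ 58"
      unfolding A_def using C by (intro mult_right_mono) auto
    finally show ?thesis .
  next
    case False
    have "norm (E w) \<le> C / sqrt (1 / 2 - Re w)" using False E(2)[of w] G[of w] by simp
    also have "\<dots> \<le> C / sqrt (1 / 4)" using False C by (intro divide_left_mono) auto
    also have "\<dots> = (2 * C) * 1" by (simp add: real_sqrt_divide)
    also have "\<dots> \<le> A * (norm w + 5) ^ 58"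
      unfolding A_def using C K by (intro mult_mono one_le_power) auto
    finally show ?thesis .
  qed
  moreover have "((\<lambda>x. E (of_real x)) \<longlongrightarrow> 0) at_bot"
  proof (rule Lim_null_comparison)
    show "\<forall>\<^sub>F x in at_bot. norm (E (of_real x)) \<le> C * (1 / sqrt (1 / 2 - x))"
      using eventually_le_at_bot[of 0]
    proof eventually_elim
      case (elim x)
      thus ?case using G[of "of_real x"] E(2)[of "of_real x"] by simp
    qed
    have "((\<lambda>x::real. 1 / sqrt (1 / 2 - x)) \<longlongrightarrow> 0) at_bot" by real_asymp
    thus "((\<lambda>x::real. C * (1 / sqrt (1 / 2 - x))) \<longlongrightarrow> 0) at_bot" by (rule tendsto_mult_right_zero)
  qed
  ultimately have "E 0 = 0" by (rule polynomial_growth_vanishing[OF E(1)])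
  hence "mellin g 1 = 0" using E(2)[of 0] by (simp add: G_def)
  thus ?thesis by (simp add: mellin_1)
qed

section \<open>Orthogonal projection in L2\<close>

definition square_integrable :: "'a measure \<Rightarrow> ('a \<Rightarrow> real) \<Rightarrow> bool" where
  "square_integrable M f \<longleftrightarrow> f \<in> borel_measurable M \<and> integrable M (\<lambda>x. (f x)\<^sup>2)"

lemma square_integrable_mult:
  assumes "square_integrable M f" "square_integrable M g"
  shows "integrable M (\<lambda>x. f x * g x)"
proof -
  have [measurable]: "f \<in> borel_measurable M" "g \<in> borel_measurable M"
    using assms by (auto simp: square_integrable_def)
  have "integrable M (\<lambda>x. (f x)\<^sup>2 + (g x)\<^sup>2)"
    using assms by (auto simp: square_integrable_def)
  thus ?thesis
  proof (rule Bochner_Integration.integrable_bound)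
    have "\<bar>f x * g x\<bar> \<le> (f x)\<^sup>2 + (g x)\<^sup>2" for x
    proof -
      have "0 \<le> (\<bar>f x\<bar> - \<bar>g x\<bar>)\<^sup>2" by simp
      hence "2 * (\<bar>f x\<bar> * \<bar>g x\<bar>) \<le> (f x)\<^sup>2 + (g x)\<^sup>2" by (simp add: power2_diff mult.assoc)
      moreover have "0 \<le> \<bar>f x\<bar> * \<bar>g x\<bar>" by simp
      ultimately show ?thesis by (simp only: abs_mult)
    qed
    thus "AE x in M. norm (f x * g x) \<le> norm ((f x)\<^sup>2 + (g x)\<^sup>2)" by simp
  qed measurable
qed

lemma square_integrable_lincomb:
  assumes "square_integrable M f" "square_integrable M g"
  shows "square_integrable M (\<lambda>x. s * f x + t * g x)"
    and "(\<integral>x. (s * f x + t * g x)\<^sup>2 \<partial>M) =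
      s\<^sup>2 * (\<integral>x. (f x)\<^sup>2 \<partial>M) + 2 * s * t * (\<integral>x. f x * g x \<partial>M) + t\<^sup>2 * (\<integral>x. (g x)\<^sup>2 \<partial>M)"
proof -
  have [measurable]: "f \<in> borel_measurable M" "g \<in> borel_measurable M"
    and i: "integrable M (\<lambda>x. (f x)\<^sup>2)" "integrable M (\<lambda>x. (g x)\<^sup>2)"
    using assms by (auto simp: square_integrable_def)
  note m = square_integrable_mult[OF assms]
  have eq: "(s * f x + t * g x)\<^sup>2 = s\<^sup>2 * (f x)\<^sup>2 + 2 * s * t * (f x * g x) + t\<^sup>2 * (g x)\<^sup>2" for x
    by (simp add: power2_eq_square algebra_simps)
  show "square_integrable M (\<lambda>x. s * f x + t * g x)"
    unfolding square_integrable_def eq using i m by auto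
  show "(\<integral>x. (s * f x + t * g x)\<^sup>2 \<partial>M) =
      s\<^sup>2 * (\<integral>x. (f x)\<^sup>2 \<partial>M) + 2 * s * t * (\<integral>x. f x * g x \<partial>M) + t\<^sup>2 * (\<integral>x. (g x)\<^sup>2 \<partial>M)"
    unfolding eq using i m by simp
qed

lemma square_integrable_diff:
  assumes "square_integrable M f" "square_integrable M g"
  shows "square_integrable M (\<lambda>x. f x - g x)"
  using square_integrable_lincomb(1)[OF assms, of 1 "-1"] by simp

text \<open>Cauchy-Schwarz with a free parameter, from the nonnegative integrals of the squares of f
  + \<delta> g and f - \<delta> g. Choosing \<delta> afterwards replaces work with square roots of
  the norms.\<close>

lemma abs_integral_mult_le:
  assumes "square_integrable M f" "square_integrable M g" "\<delta> > 0"
  shows "\<bar>\<integral>x. f x * g x \<partial>M\<bar> \<le> (\<integral>x. (f x)\<^sup>2 \<partial>M) / (2 * \<delta>) + (\<integral>x. (g x)\<^sup>2 \<partial>M) * \<delta> / 2"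
proof -
  have "0 \<le> (\<integral>x. (1 * f x + t * g x)\<^sup>2 \<partial>M)" for t by simp
  hence *: "0 \<le> (\<integral>x. (f x)\<^sup>2 \<partial>M) + 2 * t * (\<integral>x. f x * g x \<partial>M) + t\<^sup>2 * (\<integral>x. (g x)\<^sup>2 \<partial>M)" for t
    unfolding square_integrable_lincomb(2)[OF assms(1,2)] by simp
  have "2 * \<delta> * \<bar>\<integral>x. f x * g x \<partial>M\<bar> \<le> (\<integral>x. (f x)\<^sup>2 \<partial>M) + \<delta>\<^sup>2 * (\<integral>x. (g x)\<^sup>2 \<partial>M)"
    using *[of \<delta>] *[of "-\<delta>"] by (simp add: abs_if)
  hence "2 * \<delta> * \<bar>\<integral>x. f x * g x \<partial>M\<bar> / (2 * \<delta>) \<le> ((\<integral>x. (f x)\<^sup>2 \<partial>M) + \<delta>\<^sup>2 * (\<integral>x. (g x)\<^sup>2 \<partial>M)) / (2 * \<delta>)"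
    using assms(3) by (intro divide_right_mono) auto
  also have "\<dots> = (\<integral>x. (f x)\<^sup>2 \<partial>M) / (2 * \<delta>) + (\<integral>x. (g x)\<^sup>2 \<partial>M) * \<delta> / 2"
    using assms(3) by (simp add: add_divide_distrib power2_eq_square)
  finally show ?thesis using assms(3) by simp
qed

lemma (in finite_measure) square_integrable_imp_integrable:
  assumes "square_integrable M f"
  shows "integrable M f"
proof -
  have "square_integrable M (\<lambda>_. 1)" by (simp add: square_integrable_def)
  from square_integrable_mult[OF assms this] show ?thesis by simp
qed

text \<open>Completeness by way of L1: on a finite measure space an L2 Cauchy sequence is L1 Cauchy
  and so has a subsequence converging almost everywhere; Fatou's lemma carries the L2 estimate to
  the limit. The Cauchy bound \<open>a m + a n\<close> has the shape that a minimizing sequence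
  provides.\<close>

lemma (in finite_measure) square_integrable_complete:
  assumes G: "\<And>n. square_integrable M (G n)"
    and cauchy: "\<And>m n. (\<integral>x. (G m x - G n x)\<^sup>2 \<partial>M) \<le> a m + a n"
    and a: "a \<longlonglongrightarrow> 0" "decseq a"
  obtains g where "square_integrable M g" "\<And>n. (\<integral>x. (G n x - g x)\<^sup>2 \<partial>M) \<le> 2 * a n"
proof -
  have [measurable]: "G n \<in> borel_measurable M" for n using G by (simp add: square_integrable_def)
  have a0: "a n \<ge> 0" for n using a decseq_ge by blast
  have one: "square_integrable M (\<lambda>_. 1)" by (simp add: square_integrable_def)
  have sd: "square_integrable M (\<lambda>x. G m x - G n x)" for m n by (intro square_integrable_diff G)
  have "\<exists>N. \<forall>i\<ge>N. \<forall>j\<ge>N. (\<integral>x. norm (G i x - G j x) \<partial>M) < e" if e: "e > 0" for e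
  proof -
    define V where "V = measure M (space M)"
    \<comment> \<open>This makes the total mass times \<delta> smaller than \<open>e\<close>; the 1
      avoids division by zero on a null measure.\<close>
    define \<delta> where "\<delta> = e / (V + 1)"
    have V: "V \<ge> 0" by (simp add: V_def)
    have \<delta>: "\<delta> > 0" "V * \<delta> < e" using e V by (auto simp: \<delta>_def field_simps)
    have "(\<lambda>n. a n / \<delta>) \<longlonglongrightarrow> 0 / \<delta>" by (intro tendsto_intros a) (use \<delta> in auto)
    hence "\<forall>\<^sub>F n in sequentially. a n / \<delta> < e / 2" using e by (intro order_tendstoD(2)) auto
    then obtain N where N: "\<And>n. n \<ge> N \<Longrightarrow> a n / \<delta> < e / 2" by (auto simp: eventually_sequentially)
    have "(\<integral>x. norm (G i x - G j x) \<partial>M) < e" if ij: "i \<ge> N" "j \<ge> N" for i j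
    proof -
      have sa: "square_integrable M (\<lambda>x. \<bar>G i x - G j x\<bar>)"
        using sd[of i j] by (auto simp: square_integrable_def)
      have "\<bar>\<integral>x. \<bar>G i x - G j x\<bar> * 1 \<partial>M\<bar> \<le>
          (\<integral>x. \<bar>G i x - G j x\<bar>\<^sup>2 \<partial>M) / (2 * \<delta>) + (\<integral>x. 1\<^sup>2 \<partial>M) * \<delta> / 2"
        by (rule abs_integral_mult_le[OF sa one \<delta>(1)])
      also have "\<dots> = (\<integral>x. (G i x - G j x)\<^sup>2 \<partial>M) / (2 * \<delta>) + V * \<delta> / 2"
        by (simp add: V_def)
      also have "\<dots> \<le> (a i + a j) / (2 * \<delta>) + V * \<delta> / 2"
        using cauchy[of i j] \<delta> by (intro add_right_mono divide_right_mono) auto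
      also have "\<dots> = (a i / \<delta>) / 2 + (a j / \<delta>) / 2 + V * \<delta> / 2" by (simp add: add_divide_distrib)
      also have "\<dots> < e"
      proof -
        have "x < e / 2 \<Longrightarrow> y < e / 2 \<Longrightarrow> z < e \<Longrightarrow> x / 2 + y / 2 + z / 2 < e" for x y z by linarith
        from this[OF N[OF ij(1)] N[OF ij(2)] \<delta>(2)] show ?thesis .
      qed
      finally show ?thesis by simp
    qed
    thus ?thesis by blast
  qed
  then obtain r where r: "strict_mono r" "AE x in M. Cauchy (\<lambda>i. G (r i) x)"
    using cauchy_L1_AE_cauchy_subseq[of M G] square_integrable_imp_integrable[OF G] by metis
  define g where "g = (\<lambda>x. lim (\<lambda>i. G (r i) x))"
  have [measurable]: "g \<in> borel_measurable M" unfolding g_def by measurable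
  have lim: "AE x in M. (\<lambda>i. G (r i) x) \<longlonglongrightarrow> g x"
    using r(2) by eventually_elim (simp add: g_def Cauchy_convergent_iff convergent_LIMSEQ_iff)
  have le: "(\<integral>\<^sup>+x. ennreal ((G n x - g x)\<^sup>2) \<partial>M) \<le> ennreal (2 * a n)" for n
  proof -
    have "(\<integral>\<^sup>+x. ennreal ((G n x - g x)\<^sup>2) \<partial>M) = (\<integral>\<^sup>+x. liminf (\<lambda>k. ennreal ((G n x - G (r k) x)\<^sup>2)) \<partial>M)"
    proof (rule nn_integral_cong_AE)
      show "AE x in M. ennreal ((G n x - g x)\<^sup>2) = liminf (\<lambda>k. ennreal ((G n x - G (r k) x)\<^sup>2))"
        using lim
      proof eventually_elim
        case (elim x)
        have "(\<lambda>k. ennreal ((G n x - G (r k) x)\<^sup>2)) \<longlonglongrightarrow> ennreal ((G n x - g x)\<^sup>2)"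
          by (intro tendsto_ennrealI tendsto_intros elim)
        hence "liminf (\<lambda>k. ennreal ((G n x - G (r k) x)\<^sup>2)) = ennreal ((G n x - g x)\<^sup>2)"
          by (rule lim_imp_Liminf[rotated]) simp
        thus ?case by (rule sym)
      qed
    qed
    also have "\<dots> \<le> liminf (\<lambda>k. \<integral>\<^sup>+x. ennreal ((G n x - G (r k) x)\<^sup>2) \<partial>M)"
      by (rule nn_integral_liminf) measurable
    also have "\<dots> \<le> ennreal (2 * a n)"
    proof (rule Liminf_le)
      show "\<forall>\<^sub>F k in sequentially. (\<integral>\<^sup>+x. ennreal ((G n x - G (r k) x)\<^sup>2) \<partial>M) \<le> ennreal (2 * a n)"
        using eventually_ge_at_top[of n]
      proof eventually_elim
        case (elim k)
        have "n \<le> r k" using elim seq_suble[OF r(1), of k] by linarith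
        \<comment> \<open>Monotonicity replaces the second error term by the first, so the bound
          \<open>2 * a n\<close> no longer depends on k.\<close>
        hence "a (r k) \<le> a n" using a(2) by (simp add: decseq_def)
        hence "(\<integral>x. (G n x - G (r k) x)\<^sup>2 \<partial>M) \<le> 2 * a n" using cauchy[of n "r k"] by linarith
        moreover have "(\<integral>\<^sup>+x. ennreal ((G n x - G (r k) x)\<^sup>2) \<partial>M) = ennreal (\<integral>x. (G n x - G (r k) x)\<^sup>2 \<partial>M)"
          using sd[of n "r k"] by (intro nn_integral_eq_integral) (auto simp: square_integrable_def)
        ultimately show ?case by (simp add: ennreal_leI)
      qed
    qed simp
    finally show ?thesis .
  qed
  have int: "integrable M (\<lambda>x. (G n x - g x)\<^sup>2)" for n
    using le[of n] by (intro integrableI_bounded) (auto intro: le_less_trans)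
  hence "square_integrable M (\<lambda>x. G 0 x - g x)" by (simp add: square_integrable_def)
  hence "square_integrable M g" using square_integrable_diff[OF G[of 0]] by fastforce
  moreover have "(\<integral>x. (G n x - g x)\<^sup>2 \<partial>M) \<le> 2 * a n" for n
    using le[of n] a0[of n] by (subst (asm) nn_integral_eq_integral[OF int]) (auto simp: ennreal_le_iff)
  ultimately show ?thesis by (rule that)
qed

text \<open>The projection theorem for a subspace that need not be closed. The residuals of a
  minimizing sequence are Cauchy by the parallelogram law; their limit \<open>g\<close> is
  orthogonal to \<open>V\<close>, and u - g is approximated from \<open>V\<close>.\<close>

lemma (in finite_measure) L2_orthogonal_residual:
  assumes V: "\<And>f. f \<in> V \<Longrightarrow> square_integrable M f" "V \<noteq> {}"
    "\<And>f g s t. f \<in> V \<Longrightarrow> g \<in> V \<Longrightarrow> (\<lambda>x. s * f x + t * g x) \<in> V"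
    and u: "square_integrable M u"
  obtains g where "square_integrable M g" "\<And>f. f \<in> V \<Longrightarrow> (\<integral>x. g x * f x \<partial>M) = 0"
    "\<And>\<epsilon>. \<epsilon> > 0 \<Longrightarrow> \<exists>f\<in>V. (\<integral>x. (u x - f x - g x)\<^sup>2 \<partial>M) < \<epsilon>"
proof -
  define Q where "Q = (\<lambda>f. \<integral>x. (u x - f x)\<^sup>2 \<partial>M)"
  define d where "d = (INF f\<in>V. Q f)"
  \<comment> \<open>The parallelogram law yields 2(Q(F m) - d) + 2(Q(F n) - d), and each excess is
    below 1/(n+1); hence the numerator 2.\<close>
  define a where "a = (\<lambda>n. 2 / real (Suc n))"
  have bdd: "bdd_below (Q ` V)" by (rule bdd_belowI2[of _ 0]) (simp add: Q_def)
  have d: "d \<le> Q f" if "f \<in> V" for f unfolding d_def by (rule cINF_lower[OF bdd that])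
  have "\<exists>f\<in>V. Q f < d + 1 / real (Suc n)" for n
    using cINF_less_iff[OF V(2) bdd, of "d + 1 / real (Suc n)"] unfolding d_def by (simp del: of_nat_Suc)
  then obtain F where F: "\<And>n. F n \<in> V" "\<And>n. Q (F n) < d + 1 / real (Suc n)" by metis
  define G where "G = (\<lambda>n x. u x - F n x)"
  have G: "square_integrable M (G n)" for n unfolding G_def by (intro square_integrable_diff u V F)
  have QG: "(\<integral>x. (G n x)\<^sup>2 \<partial>M) = Q (F n)" for n by (simp add: G_def Q_def)
  obtain g where g: "square_integrable M g" "\<And>n. (\<integral>x. (G n x - g x)\<^sup>2 \<partial>M) \<le> 2 * a n"
  proof (rule square_integrable_complete[of G a])
    show "a \<longlonglongrightarrow> 0" unfolding a_def by real_asymp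
    show "decseq a" unfolding a_def decseq_def by (auto intro!: divide_left_mono)
    fix m n
    let ?p = "\<integral>x. G m x * G n x \<partial>M"
    have f1: "(\<integral>x. (1 * G m x + (-1) * G n x)\<^sup>2 \<partial>M) = Q (F m) - 2 * ?p + Q (F n)"
      unfolding square_integrable_lincomb(2)[OF G G] QG by simp
    have f2: "(\<integral>x. (1/2 * G m x + 1/2 * G n x)\<^sup>2 \<partial>M) = (Q (F m) + 2 * ?p + Q (F n)) / 4"
      unfolding square_integrable_lincomb(2)[OF G G] QG by (simp add: power2_eq_square)
    have f3: "d \<le> (\<integral>x. (1/2 * G m x + 1/2 * G n x)\<^sup>2 \<partial>M)"
    proof -
      have "1/2 * G m x + 1/2 * G n x = u x - (1/2 * F m x + 1/2 * F n x)" for x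
        by (simp add: G_def field_simps)
      thus ?thesis using d[OF V(3)[OF F(1)[of m] F(1)[of n], of "1/2" "1/2"]] by (simp add: Q_def)
    qed
    have f4: "(\<integral>x. (G m x - G n x)\<^sup>2 \<partial>M) = (\<integral>x. (1 * G m x + (-1) * G n x)\<^sup>2 \<partial>M)" by simp
    have f5: "a m + a n = 2 * (1 / real (Suc m)) + 2 * (1 / real (Suc n))" by (simp add: a_def)
    have "4 * (\<integral>x. (1/2 * G m x + 1/2 * G n x)\<^sup>2 \<partial>M) = Q (F m) + 2 * ?p + Q (F n)"
      unfolding f2 by simp
    hence "4 * d \<le> Q (F m) + 2 * ?p + Q (F n)" using f3 by linarith
    hence "(\<integral>x. (G m x - G n x)\<^sup>2 \<partial>M) \<le> 2 * (Q (F m) - d) + 2 * (Q (F n) - d)"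
      unfolding f4 f1 by (simp add: algebra_simps)
    also have "\<dots> \<le> a m + a n"
      unfolding f5 using F(2)[of m] F(2)[of n] by (intro add_mono mult_left_mono) auto
    finally show "(\<integral>x. (G m x - G n x)\<^sup>2 \<partial>M) \<le> a m + a n" .
  qed (use G in auto)
  \<comment> \<open>One inequality suffices, since it can be applied to -f too. It comes from
    minimality: subtracting t f from a nearly optimal residual cannot push the norm square below
    \<open>d\<close>.\<close>
  have le0: "(\<integral>x. g x * f x \<partial>M) \<le> 0" if f: "f \<in> V" for f
  proof -
    let ?N = "\<integral>x. (f x)\<^sup>2 \<partial>M"
    have sf: "square_integrable M f" by (rule V(1)[OF f])
    have 1: "2 * t * (\<integral>x. G n x * f x \<partial>M) \<le> 1 / real (Suc n) + t\<^sup>2 * ?N" for n t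
    proof -
      have "(\<integral>x. (1 * G n x + (-t) * f x)\<^sup>2 \<partial>M) = Q (F n) - 2 * t * (\<integral>x. G n x * f x \<partial>M) + t\<^sup>2 * ?N"
        unfolding square_integrable_lincomb(2)[OF G sf] QG by simp
      moreover have "d \<le> (\<integral>x. (1 * G n x + (-t) * f x)\<^sup>2 \<partial>M)"
      proof -
        have "1 * G n x + (-t) * f x = u x - (1 * F n x + t * f x)" for x by (simp add: G_def)
        thus ?thesis using d[OF V(3)[OF F(1)[of n] f, of 1 t]] by (simp add: Q_def diff_diff_eq)
      qed
      ultimately show ?thesis using F(2)[of n] by linarith
    qed
    have 2: "\<bar>\<integral>x. (G n x - g x) * f x \<partial>M\<bar> \<le> (2 + ?N / 2) / sqrt (real (Suc n))" for n
    proof -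
      \<comment> \<open>As \<open>a n\<close> has order 1/n, this choice gives both terms of the
        parametric Cauchy-Schwarz bound the order 1/sqrt n.\<close>
      let ?\<delta> = "1 / sqrt (real (Suc n))"
      have "\<bar>\<integral>x. (G n x - g x) * f x \<partial>M\<bar> \<le> (\<integral>x. (G n x - g x)\<^sup>2 \<partial>M) / (2 * ?\<delta>) + ?N * ?\<delta> / 2"
        by (intro abs_integral_mult_le square_integrable_diff G g sf) simp
      also have "(\<integral>x. (G n x - g x)\<^sup>2 \<partial>M) / (2 * ?\<delta>) \<le> (2 * a n) / (2 * ?\<delta>)"
        by (intro divide_right_mono g) simp
      also have "(2 * a n) / (2 * ?\<delta>) = 2 * (sqrt (real (Suc n)) / real (Suc n))" by (simp add: a_def del: of_nat_Suc)
      also have "sqrt (real (Suc n)) / real (Suc n) = 1 / sqrt (real (Suc n))"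
        by (simp add: sqrt_divide_self_eq inverse_eq_divide del: of_nat_Suc)
      finally show ?thesis by (simp add: add_divide_distrib)
    qed
    have "(\<lambda>n. \<integral>x. (G n x - g x) * f x \<partial>M) \<longlonglongrightarrow> 0"
    proof (rule Lim_null_comparison)
      show "\<forall>\<^sub>F n in sequentially. norm (\<integral>x. (G n x - g x) * f x \<partial>M) \<le> (2 + ?N / 2) * (1 / sqrt (real (Suc n)))"
        using 2 by (intro always_eventually allI) simp
      have "(\<lambda>n. 1 / sqrt (real (Suc n))) \<longlonglongrightarrow> 0" by real_asymp
      thus "(\<lambda>n. (2 + ?N / 2) * (1 / sqrt (real (Suc n)))) \<longlonglongrightarrow> 0" by (rule tendsto_mult_right_zero)
    qed
    hence "(\<lambda>n. (\<integral>x. (G n x - g x) * f x \<partial>M) + (\<integral>x. g x * f x \<partial>M)) \<longlonglongrightarrow> 0 + (\<integral>x. g x * f x \<partial>M)"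
      by (intro tendsto_intros)
    moreover have "(\<integral>x. (G n x - g x) * f x \<partial>M) + (\<integral>x. g x * f x \<partial>M) = (\<integral>x. G n x * f x \<partial>M)" for n
      using square_integrable_mult[OF G[of n] sf] square_integrable_mult[OF g(1) sf]
      by (simp add: left_diff_distrib)
    ultimately have 3: "(\<lambda>n. \<integral>x. G n x * f x \<partial>M) \<longlonglongrightarrow> (\<integral>x. g x * f x \<partial>M)" by simp
    have "2 * t * (\<integral>x. g x * f x \<partial>M) \<le> 0 + t\<^sup>2 * ?N" for t
    proof (rule LIMSEQ_le)
      show "(\<lambda>n. 2 * t * (\<integral>x. G n x * f x \<partial>M)) \<longlonglongrightarrow> 2 * t * (\<integral>x. g x * f x \<partial>M)"
        by (intro tendsto_intros 3)
      have "(\<lambda>n. 1 / real (Suc n)) \<longlonglongrightarrow> 0" by real_asymp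
      thus "(\<lambda>n. 1 / real (Suc n) + t\<^sup>2 * ?N) \<longlonglongrightarrow> 0 + t\<^sup>2 * ?N" by (intro tendsto_intros)
    qed (use 1 in blast)
    hence 4: "2 * t * (\<integral>x. g x * f x \<partial>M) \<le> t\<^sup>2 * ?N" for t by simp
    show ?thesis
    proof (rule ccontr)
      assume "\<not> ?thesis"
      hence p: "(\<integral>x. g x * f x \<partial>M) > 0" by simp
      \<comment> \<open>The minimizer of t^2 (N + 1) - 2 t <g,f>; the added 1 keeps the denominator
        positive when f is null.\<close>
      define t where "t = (\<integral>x. g x * f x \<partial>M) / (?N + 1)"
      have N: "?N \<ge> 0" by simp
      have N1: "?N + 1 > 0" using N by linarith
      have t: "t > 0" unfolding t_def by (rule divide_pos_pos[OF p N1])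
      have "2 * (\<integral>x. g x * f x \<partial>M) \<le> t * ?N" using 4[of t] t by (simp add: power2_eq_square)
      also have "\<dots> \<le> t * (?N + 1)" using t by simp
      also have "\<dots> = (\<integral>x. g x * f x \<partial>M)"
        unfolding t_def by (rule nonzero_eq_divide_eq[THEN iffD1, OF _ refl]) (use N1 in linarith)
      finally show False using p by simp
    qed
  qed
  have "(\<integral>x. g x * f x \<partial>M) = 0" if f: "f \<in> V" for f
    using le0[OF f] le0[OF V(3)[OF f f, of "-1" 0]] by simp
  moreover have "\<exists>f\<in>V. (\<integral>x. (u x - f x - g x)\<^sup>2 \<partial>M) < \<epsilon>" if "\<epsilon> > 0" for \<epsilon>
  proof -
    have "(\<lambda>n. 2 * (2 / real (Suc n))) \<longlonglongrightarrow> 0" by real_asymp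
    hence "\<forall>\<^sub>F n in sequentially. 2 * a n < \<epsilon>"
      unfolding a_def using that by (rule order_tendstoD(2))
    then obtain n where "2 * a n < \<epsilon>" by (auto simp: eventually_sequentially)
    hence "(\<integral>x. (u x - F n x - g x)\<^sup>2 \<partial>M) < \<epsilon>" using g(2)[of n] by (simp add: G_def)
    thus ?thesis using F(1)[of n] by blast
  qed
  ultimately show ?thesis using g(1) by (intro that)
qed

section \<open>The Riemann Hypothesis implies approximation\<close>

text \<open>Borel counterpart of the Lebesgue measure in \<open>L1_L2_pair\<close>. The L2 argument
  runs over this measure, and integrals of Borel functions transfer by
  \<open>lebesgue_on_unit_interval\<close>.\<close>

abbreviation unit_interval_measure :: "real measure" where
  "unit_interval_measure \<equiv> restrict_space lborel {0<..<1}"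

lemma finite_measure_unit_interval: "finite_measure unit_interval_measure"
  by (rule finite_measureI) (simp add: emeasure_restrict_space space_restrict_space)

lemma unit_interval_measure_integral:
  fixes f :: "real \<Rightarrow> 'a :: {banach, second_countable_topology}"
  shows "integrable unit_interval_measure f \<longleftrightarrow> set_integrable lborel {0<..<1} f"
    and "(\<integral>x. f x \<partial>unit_interval_measure) = (LBINT x:{0<..<1}. f x)"
  by (simp_all add: integrable_restrict_space integral_restrict_space set_integrable_def set_lebesgue_integral_def)

lemma lebesgue_on_unit_interval:
  fixes f :: "real \<Rightarrow> real"
  assumes [measurable]: "f \<in> borel_measurable borel"
  shows "integrable (lebesgue_on {0<..<1}) f \<longleftrightarrow> integrable unit_interval_measure f"
    and "(\<integral>x. f x \<partial>lebesgue_on {0<..<1}) = (\<integral>x. f x \<partial>unit_interval_measure)"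
    and "f \<in> borel_measurable (lebesgue_on {0<..<1})"
proof -
  have m: "(\<lambda>x. indicator {0<..<1} x *\<^sub>R f x) \<in> borel_measurable lborel" by measurable
  show "integrable (lebesgue_on {0<..<1}) f \<longleftrightarrow> integrable unit_interval_measure f"
    by (simp add: integrable_restrict_space integrable_completion[OF m, simplified])
  show "(\<integral>x. f x \<partial>lebesgue_on {0<..<1}) = (\<integral>x. f x \<partial>unit_interval_measure)"
    by (simp add: integral_restrict_space integral_completion[OF m, simplified])
  show "f \<in> borel_measurable (lebesgue_on {0<..<1})"
    by (intro measurable_restrict_space1 measurable_completion) simp
qed

lemma bounded_square_integrable:
  fixes f :: "real \<Rightarrow> real"
  assumes [measurable]: "f \<in> borel_measurable borel" and b: "\<And>x. \<bar>f x\<bar> \<le> C"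
  shows "square_integrable unit_interval_measure f"
proof -
  interpret finite_measure unit_interval_measure by (rule finite_measure_unit_interval)
  have m: "f \<in> borel_measurable unit_interval_measure"
    by (intro measurable_restrict_space1) simp
  have "integrable unit_interval_measure (\<lambda>x. (f x)\<^sup>2)"
  proof (rule integrable_const_bound[of _ "C\<^sup>2"])
    have "(f x)\<^sup>2 \<le> C\<^sup>2" for x using power_mono[OF b[of x], of 2] by simp
    thus "AE x in unit_interval_measure. norm ((f x)\<^sup>2) \<le> C\<^sup>2" by simp
  qed (use m in measurable)
  thus ?thesis using m by (simp add: square_integrable_def)
qed

section \<open>Linear structure of the Beurling functions\<close>

lemma sum_append:
  fixes p q :: "nat \<Rightarrow> 'a :: comm_monoid_add"
  shows "(\<Sum>k=1..n+m. if k \<le> n then p k else q (k - n)) = (\<Sum>k=1..n. p k) + (\<Sum>k=1..m. q k)"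
proof -
  have "(\<Sum>k=1..n+m. if k \<le> n then p k else q (k - n)) =
     (\<Sum>k=1..n. if k \<le> n then p k else q (k - n)) + (\<Sum>k=n+1..n+m. if k \<le> n then p k else q (k - n))"
    by (rule sum.ub_add_nat) simp
  also have "(\<Sum>k=n+1..n+m. if k \<le> n then p k else q (k - n)) = (\<Sum>k=1+n..m+n. if k \<le> n then p k else q (k - n))"
    by (simp add: add.commute)
  also have "\<dots> = (\<Sum>k=1..m. q k)"
    unfolding sum.shift_bounds_cl_nat_ivl by (intro sum.cong) auto
  finally show ?thesis by simp
qed

text \<open>Concatenate the two families of terms. The identity for an arbitrary function of the
  parameter settles both the constraint, with {1/a}, and the pointwise values, with
  {1/(ax)}.\<close>

lemma Beurling_lincomb:
  assumes "f \<in> Beurling_functions" "g \<in> Beurling_functions"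
  shows "(\<lambda>x. s * f x + t * g x) \<in> Beurling_functions"
proof -
  obtain n c a where f: "f = (\<lambda>x. \<Sum>k=1..n. c k * frac (1 / (a k * x)))"
    "\<forall>k\<in>{1..n::nat}. a k \<ge> (1::real)" "(\<Sum>k=1..n. c k * frac (1 / a k)) = (0::real)"
    using assms(1) unfolding Beurling_functions_def by blast
  obtain m d b where g: "g = (\<lambda>x. \<Sum>k=1..m. d k * frac (1 / (b k * x)))"
    "\<forall>k\<in>{1..m::nat}. b k \<ge> (1::real)" "(\<Sum>k=1..m. d k * frac (1 / b k)) = (0::real)"
    using assms(2) unfolding Beurling_functions_def by blast
  define e where "e = (\<lambda>k. if k \<le> n then s * c k else t * d (k - n))"
  define h where "h = (\<lambda>k. if k \<le> n then a k else b (k - n))"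
  have eq: "(\<Sum>k=1..n+m. e k * \<phi> (h k)) = s * (\<Sum>k=1..n. c k * \<phi> (a k)) + t * (\<Sum>k=1..m. d k * \<phi> (b k))"
    for \<phi> :: "real \<Rightarrow> real"
  proof -
    have "(\<Sum>k=1..n+m. e k * \<phi> (h k)) =
        (\<Sum>k=1..n+m. if k \<le> n then s * c k * \<phi> (a k) else (\<lambda>k. t * d k * \<phi> (b k)) (k - n))"
      by (intro sum.cong) (auto simp: e_def h_def)
    also have "\<dots> = (\<Sum>k=1..n. s * c k * \<phi> (a k)) + (\<Sum>k=1..m. t * d k * \<phi> (b k))"
      by (rule sum_append)
    finally show ?thesis by (simp add: sum_distrib_left mult.assoc)
  qed
  have "\<forall>k\<in>{1..n+m}. h k \<ge> 1"
  proof
    fix k assume "k \<in> {1..n+m}"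
    hence "k \<le> n \<and> k \<in> {1..n} \<or> \<not> k \<le> n \<and> k - n \<in> {1..m}" by auto
    thus "h k \<ge> 1" using f(2) g(2) by (auto simp only: h_def if_True if_False)
  qed
  moreover have "(\<Sum>k=1..n+m. e k * frac (1 / h k)) = 0"
    using eq[of "\<lambda>a. frac (1 / a)"] f(3) g(3) by simp
  moreover have "(\<lambda>x. s * f x + t * g x) = (\<lambda>x. \<Sum>k=1..n+m. e k * frac (1 / (h k * x)))"
    unfolding f(1) g(1) using eq[of "\<lambda>a. frac (1 / (a * x))" for x] by simp
  ultimately show ?thesis unfolding Beurling_functions_def by blast
qed

text \<open>For a > 1 the fractional part of 1/a is 1/a, so the two terms cancel in the constraint.
  Orthogonality to these functions says that a times \<open>frac_correlation\<close> is constant for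
  a > 1; the parameter 2 is merely a reference point that fixes the constant.\<close>

lemma Beurling_two_terms:
  assumes "a > 1"
  shows "(\<lambda>x. a * frac (1 / (a * x)) - 2 * frac (1 / (2 * x))) \<in> Beurling_functions"
proof -
  define c where "c = (\<lambda>k::nat. if k = 1 then a else -2)"
  define b where "b = (\<lambda>k::nat. if k = 1 then a else 2)"
  have eq: "(\<Sum>k=1..2. c k * \<phi> (b k)) = a * \<phi> a - 2 * \<phi> 2" for \<phi> :: "real \<Rightarrow> real"
  proof -
    have "{1..2::nat} = {1, 2}" by auto
    thus ?thesis by (simp add: c_def b_def)
  qed
  have "\<forall>k\<in>{1..2}. b k \<ge> 1" using assms by (simp add: b_def)
  moreover have "(\<Sum>k=1..2. c k * frac (1 / b k)) = 0"
    using eq[of "\<lambda>a. frac (1 / a)"] assms by (simp add: frac_eq)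
  moreover have "(\<lambda>x. a * frac (1 / (a * x)) - 2 * frac (1 / (2 * x))) = (\<lambda>x. \<Sum>k=1..2. c k * frac (1 / (b k * x)))"
    using eq[of "\<lambda>a. frac (1 / (a * x))" for x] by simp
  ultimately show ?thesis unfolding Beurling_functions_def by blast
qed

lemma Beurling_bounded:
  assumes "f \<in> Beurling_functions"
  shows "f \<in> borel_measurable borel" and "\<exists>C. \<forall>x. \<bar>f x\<bar> \<le> C"
proof -
  obtain n c a where f: "f = (\<lambda>x. \<Sum>k=1..n. c k * frac (1 / (a k * x)))"
    "\<forall>k\<in>{1..n::nat}. a k \<ge> (1::real)" "(\<Sum>k=1..n. c k * frac (1 / a k)) = (0::real)"
    using assms(1) unfolding Beurling_functions_def by blast
  show "f \<in> borel_measurable borel" unfolding f(1) by measurable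
  have "\<bar>f x\<bar> \<le> (\<Sum>k=1..n. \<bar>c k\<bar>)" for x
  proof -
    have "\<bar>f x\<bar> \<le> (\<Sum>k=1..n. \<bar>c k * frac (1 / (a k * x))\<bar>)" unfolding f(1) by (rule sum_abs)
    also have "\<dots> \<le> (\<Sum>k=1..n. \<bar>c k\<bar>)"
    proof (rule sum_mono)
      show "\<bar>c k * frac (1 / (a k * x))\<bar> \<le> \<bar>c k\<bar>" for k
        using mult_left_mono[OF frac_abs_le_1[of "1 / (a k * x)"], of "\<bar>c k\<bar>"] by (simp add: abs_mult)
    qed
    finally show ?thesis .
  qed
  thus "\<exists>C. \<forall>x. \<bar>f x\<bar> \<le> C" by blast
qed

lemma zero_in_Beurling: "(\<lambda>_. 0) \<in> Beurling_functions"
  unfolding Beurling_functions_def by (intro CollectI exI[of _ 0]) auto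

text \<open>The residual \<open>g\<close> of the constant 1 has integral 0, so it is orthogonal to 1
  and to every Beurling function. Replacing 1 - f - g by 1 - f therefore does not increase the norm,
  and f approximates 1 as well as it approximates 1 - g.\<close>

theorem RH_imp_L2_approximation:
  assumes RH: "Riemann_Hypothesis" and \<epsilon>: "\<epsilon> > 0"
  obtains f where "f \<in> Beurling_functions" "(\<integral>x. (1 - f x)\<^sup>2 \<partial>unit_interval_measure) < \<epsilon>"
proof -
  let ?U = unit_interval_measure
  interpret finite_measure ?U by (rule finite_measure_unit_interval)
  have sq: "square_integrable ?U f" if "f \<in> Beurling_functions" for f
    using Beurling_bounded[OF that] bounded_square_integrable by blast
  have one: "square_integrable ?U (\<lambda>_. 1)" by (simp add: square_integrable_def)
  obtain g where g: "square_integrable ?U g"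
    and orth: "\<And>f. f \<in> Beurling_functions \<Longrightarrow> (\<integral>x. g x * f x \<partial>?U) = 0"
    and approx: "\<And>\<epsilon>. \<epsilon> > 0 \<Longrightarrow> \<exists>f\<in>Beurling_functions. (\<integral>x. (1 - f x - g x)\<^sup>2 \<partial>?U) < \<epsilon>"
    by (rule L2_orthogonal_residual[of Beurling_functions "\<lambda>_. 1"])
       (use sq one zero_in_Beurling Beurling_lincomb in auto)
  \<comment> \<open>\<open>g\<close> is measurable only on the restricted space; extension by zero
    gives a Borel function on the line.\<close>
  define G where "G = (\<lambda>x. indicator {0<..<1} x * g x)"
  have [measurable]: "G \<in> borel_measurable borel"
    using g by (auto simp: square_integrable_def borel_measurable_restrict_space_iff G_def)
  have "set_integrable lborel {0<..<1} (\<lambda>x. (g x)\<^sup>2)"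
    using g by (simp add: square_integrable_def unit_interval_measure_integral)
  moreover have "set_integrable lborel {0<..<1} (\<lambda>x. (G x)\<^sup>2) \<longleftrightarrow> set_integrable lborel {0<..<1} (\<lambda>x. (g x)\<^sup>2)"
    by (rule set_integrable_cong) (auto simp: G_def)
  ultimately have G2: "set_integrable lborel {0<..<1} (\<lambda>x. (G x)\<^sup>2)" by simp
  have g1: "integrable ?U g" by (rule square_integrable_imp_integrable[OF g])
  have "set_integrable lborel {0<..<1} G \<longleftrightarrow> set_integrable lborel {0<..<1} g"
    by (rule set_integrable_cong) (auto simp: G_def)
  hence G1: "set_integrable lborel {0<..<1} G" using g1 by (simp add: unit_interval_measure_integral)
  have fc: "frac_correlation G a = (\<integral>x. g x * frac (1 / (a * x)) \<partial>?U)" for a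
    unfolding unit_interval_measure_integral frac_correlation_def
    by (rule set_lebesgue_integral_cong) (auto simp: G_def)
  have "frac_correlation G a = 2 * frac_correlation G 2 / a" if a: "a > 1" for a
  proof -
    have i: "integrable ?U (\<lambda>x. g x * frac (1 / (b * x)))" for b
    proof -
      have "(\<lambda>x. frac (1 / (b * x))) \<in> borel_measurable borel" by measurable
      from square_integrable_mult[OF g bounded_square_integrable[OF this frac_abs_le_1]] show ?thesis .
    qed
    have "(\<integral>x. g x * (a * frac (1 / (a * x)) - 2 * frac (1 / (2 * x))) \<partial>?U) = 0"
      by (rule orth[OF Beurling_two_terms[OF a]])
    also have "(\<lambda>x. g x * (a * frac (1 / (a * x)) - 2 * frac (1 / (2 * x)))) =
        (\<lambda>x. a * (g x * frac (1 / (a * x))) - 2 * (g x * frac (1 / (2 * x))))"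
      by (simp add: fun_eq_iff algebra_simps)
    finally have "a * frac_correlation G a - 2 * frac_correlation G 2 = 0"
      unfolding fc using i by simp
    thus ?thesis using a by (simp add: field_simps)
  qed
  from integral_eq_0_of_orthogonal[OF RH _ G2 G1 this]
  have "(LBINT x:{0<..<1}. G x) = 0" by measurable
  also have "(LBINT x:{0<..<1}. G x) = (LBINT x:{0<..<1}. g x)"
    by (rule set_lebesgue_integral_cong) (auto simp: G_def)
  finally have int0: "(\<integral>x. g x \<partial>?U) = 0" by (simp add: unit_interval_measure_integral)
  obtain f where f: "f \<in> Beurling_functions" "(\<integral>x. (1 - f x - g x)\<^sup>2 \<partial>?U) < \<epsilon>"
    using approx[OF \<epsilon>] by blast
  define h where "h = (\<lambda>x. 1 - f x - g x)"
  have h: "square_integrable ?U h" unfolding h_def by (intro square_integrable_diff one g sq f)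
  have "(\<integral>x. h x * g x \<partial>?U) = (\<integral>x. g x - g x * f x - g x * g x \<partial>?U)"
    by (simp add: h_def algebra_simps)
  also have "\<dots> = 0 - 0 - (\<integral>x. (g x)\<^sup>2 \<partial>?U)"
    using g1 square_integrable_mult[OF g sq[OF f(1)]] square_integrable_mult[OF g g] int0 orth[OF f(1)]
    by (simp add: power2_eq_square)
  \<comment> \<open>With this inner product, expanding the square of h + g gives the norm square of
    h minus that of g.\<close>
  finally have hg: "(\<integral>x. h x * g x \<partial>?U) = - (\<integral>x. (g x)\<^sup>2 \<partial>?U)" by simp
  have "(\<integral>x. (1 - f x)\<^sup>2 \<partial>?U) = (\<integral>x. (1 * h x + 1 * g x)\<^sup>2 \<partial>?U)" by (simp add: h_def)
  also have "\<dots> = (\<integral>x. (h x)\<^sup>2 \<partial>?U) - (\<integral>x. (g x)\<^sup>2 \<partial>?U)"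
    unfolding square_integrable_lincomb(2)[OF h g] hg by simp
  also have "\<dots> \<le> (\<integral>x. (h x)\<^sup>2 \<partial>?U)" by simp
  also have "\<dots> < \<epsilon>" using f(2) by (simp add: h_def)
  finally show ?thesis using f(1) that by blast
qed

section \<open>Interpolation norms are bounded by the L2 norm\<close>

lemma Lp_norm_zero: "p > 0 \<Longrightarrow> Lp_norm p M 0 = 0"
  by (simp add: Lp_norm_def zero_fun_def)

lemma Lp_norm_bounded:
  fixes h :: "real \<Rightarrow> real"
  assumes [measurable]: "h \<in> borel_measurable borel" and b: "\<And>x. \<bar>h x\<bar> \<le> C"
  shows "Lp_norm 1 (lebesgue_on {0<..<1}) h \<le> ennreal (sqrt (\<integral>x. (h x)\<^sup>2 \<partial>unit_interval_measure))"
    and "Lp_norm 2 (lebesgue_on {0<..<1}) h = ennreal (sqrt (\<integral>x. (h x)\<^sup>2 \<partial>unit_interval_measure))"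
proof -
  let ?U = unit_interval_measure
  interpret finite_measure ?U by (rule finite_measure_unit_interval)
  have h: "square_integrable ?U h" by (rule bounded_square_integrable[OF assms])
  have ha: "square_integrable ?U (\<lambda>x. \<bar>h x\<bar>)" by (rule bounded_square_integrable[of _ C]) (use b in auto)
  have one: "square_integrable ?U (\<lambda>_. 1)" by (simp add: square_integrable_def)
  have hm: "h \<in> borel_measurable (lebesgue_on {0<..<1})" by (rule lebesgue_on_unit_interval) measurable
  have e2: "(\<lambda>x. \<bar>h x\<bar> powr 2) = (\<lambda>x. (h x)\<^sup>2)" by (auto simp: fun_eq_iff powr_numeral)
  have i2: "integrable (lebesgue_on {0<..<1}) (\<lambda>x. (h x)\<^sup>2)"
    "(\<integral>x. (h x)\<^sup>2 \<partial>lebesgue_on {0<..<1}) = (\<integral>x. (h x)\<^sup>2 \<partial>?U)"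
    using lebesgue_on_unit_interval(1,2)[of "\<lambda>x. (h x)\<^sup>2"] h by (auto simp: square_integrable_def)
  show "Lp_norm 2 (lebesgue_on {0<..<1}) h = ennreal (sqrt (\<integral>x. (h x)\<^sup>2 \<partial>?U))"
    unfolding Lp_norm_def e2 using hm i2 by (simp add: powr_half_sqrt)
  have e1: "(\<lambda>x. \<bar>h x\<bar> powr 1) = (\<lambda>x. \<bar>h x\<bar>)" by simp
  have i1: "integrable (lebesgue_on {0<..<1}) (\<lambda>x. \<bar>h x\<bar>)"
    "(\<integral>x. \<bar>h x\<bar> \<partial>lebesgue_on {0<..<1}) = (\<integral>x. \<bar>h x\<bar> \<partial>?U)"
    using lebesgue_on_unit_interval(1,2)[of "\<lambda>x. \<bar>h x\<bar>"] square_integrable_imp_integrable[OF ha] by auto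
  let ?m = "\<integral>x. \<bar>h x\<bar> \<partial>?U"
  \<comment> \<open>Nonnegativity of the variance of |h|; the interval has mass 1, so the L1 norm is
    at most the L2 norm.\<close>
  have "0 \<le> (\<integral>x. (1 * \<bar>h x\<bar> + (- ?m) * 1)\<^sup>2 \<partial>?U)" by simp
  also have "\<dots> = (\<integral>x. (h x)\<^sup>2 \<partial>?U) - ?m\<^sup>2"
    unfolding square_integrable_lincomb(2)[OF ha one]
    by (simp add: power2_eq_square measure_restrict_space space_restrict_space)
  finally have "?m \<le> sqrt (\<integral>x. (h x)\<^sup>2 \<partial>?U)" by (intro real_le_rsqrt) simp
  thus "Lp_norm 1 (lebesgue_on {0<..<1}) h \<le> ennreal (sqrt (\<integral>x. (h x)\<^sup>2 \<partial>?U))"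
    unfolding Lp_norm_def e1 using hm i1 by (simp add: ennreal_leI)
qed

text \<open>The decompositions h + 0 and 0 + h bound the K-functional by A min(1, t), and
  t^(-\<theta>) min(1, t) \<le> 1 for 0 < \<theta> < 1.\<close>

lemma interp_norm_le:
  assumes h0: "fst X h \<le> A" and h1: "snd X h \<le> A" and A: "A < \<infinity>"
    and z: "fst X 0 = 0" "snd X 0 = 0" and \<theta>: "0 < \<theta>" "\<theta> < 1"
  shows "interp_norm X \<theta> h \<le> A"
  unfolding interp_norm_def
proof (rule SUP_least)
  fix t :: real assume "t \<in> {0<..}"
  hence t: "t > 0" by simp
  have fin: "fst X h < \<infinity>" "snd X h < \<infinity>" using h0 h1 A by (auto intro: le_less_trans)
  have "K_functional t h (fst X) (snd X) \<le> fst X h"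
    unfolding K_functional_def using fin z by (intro INF_lower2[of "(h, 0)"]) auto
  hence K0: "K_functional t h (fst X) (snd X) \<le> A" using h0 by (rule order_trans)
  have "K_functional t h (fst X) (snd X) \<le> ennreal t * snd X h"
    unfolding K_functional_def using fin z by (intro INF_lower2[of "(0, h)"]) auto
  also have "\<dots> \<le> ennreal t * A" using h1 by (rule mult_left_mono) simp
  finally have K1: "K_functional t h (fst X) (snd X) \<le> ennreal t * A" .
  show "ennreal (t powr (- \<theta>)) * K_functional t h (fst X) (snd X) \<le> A"
  proof (cases "t \<ge> 1")
    case True
    have "t powr (- \<theta>) \<le> t powr 0" using True \<theta> by (intro powr_mono) auto
    hence "ennreal (t powr (- \<theta>)) \<le> 1" using t by (simp add: ennreal_le_1)
    thus ?thesis using mult_mono[OF _ K0, of "ennreal (t powr (- \<theta>))" 1] by simp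
  next
    case False
    have "ennreal (t powr (- \<theta>)) * K_functional t h (fst X) (snd X) \<le> ennreal (t powr (- \<theta>)) * (ennreal t * A)"
      using K1 by (rule mult_left_mono) simp
    also have "\<dots> = ennreal (t powr (- \<theta>) * t) * A" by (simp add: ennreal_mult' mult.assoc)
    also have "t powr (- \<theta>) * t = t powr (1 - \<theta>)" using t by (simp add: powr_diff powr_minus field_simps)
    also have "ennreal (t powr (1 - \<theta>)) * A \<le> 1 * A"
    proof (rule mult_right_mono)
      have "t powr (1 - \<theta>) \<le> 1" using False t \<theta> by (intro powr_le1) auto
      thus "ennreal (t powr (1 - \<theta>)) \<le> 1" by (simp add: ennreal_le_1)
    qed simp
    finally show ?thesis by simp
  qed
qed

theorem RH_imp_interp_approximation:
  assumes "Riemann_Hypothesis"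
  shows "(INF f\<in>Beurling_functions. Delta_norm {0<..<1} (\<lambda>\<theta>. scaled_norm 1 (interp_norm L1_L2_pair \<theta>))
           (\<lambda>x. indicator {0<..<1} x - f x)) = 0"
proof -
  let ?I = "INF f\<in>Beurling_functions. Delta_norm {0<..<1} (\<lambda>\<theta>. scaled_norm 1 (interp_norm L1_L2_pair \<theta>))
           (\<lambda>x. indicator {0<..<1} x - f x)"
  have "?I \<le> 0 + ennreal e" if e: "e > 0" for e
  proof -
    have "e\<^sup>2 > 0" using e by simp
    then obtain f where f: "f \<in> Beurling_functions" "(\<integral>x. (1 - f x)\<^sup>2 \<partial>unit_interval_measure) < e\<^sup>2"
      using RH_imp_L2_approximation[OF assms] by metis
    define h where "h = (\<lambda>x. indicator {0<..<1} x - f x)"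
    note [measurable] = Beurling_bounded(1)[OF f(1)]
    obtain C where C: "\<And>x. \<bar>f x\<bar> \<le> C" using Beurling_bounded(2)[OF f(1)] by blast
    have hm: "h \<in> borel_measurable borel" unfolding h_def by measurable
    have hb: "\<bar>h x\<bar> \<le> 1 + C" for x
      using C[of x] by (auto simp: h_def indicator_def)
    have "(\<integral>x. (h x)\<^sup>2 \<partial>unit_interval_measure) = (\<integral>x. (1 - f x)\<^sup>2 \<partial>unit_interval_measure)"
      by (intro Bochner_Integration.integral_cong) (auto simp: h_def space_restrict_space)
    hence "sqrt (\<integral>x. (h x)\<^sup>2 \<partial>unit_interval_measure) \<le> e"
      using f(2) e by (intro real_le_lsqrt) auto
    hence le: "ennreal (sqrt (\<integral>x. (h x)\<^sup>2 \<partial>unit_interval_measure)) \<le> ennreal e" by (rule ennreal_leI)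
    have "interp_norm L1_L2_pair \<theta> h \<le> ennreal e" if "\<theta> \<in> {0<..<1}" for \<theta>
      using Lp_norm_bounded[OF hm hb] le that
      by (intro interp_norm_le) (auto simp: L1_L2_pair_def Lp_norm_zero)
    hence "Delta_norm {0<..<1} (\<lambda>\<theta>. scaled_norm 1 (interp_norm L1_L2_pair \<theta>)) h \<le> ennreal e"
      unfolding Delta_norm_def scaled_norm_def by (intro SUP_least) simp
    thus ?thesis using f(1) unfolding h_def by (intro INF_lower2[OF f(1)]) simp
  qed
  hence "?I \<le> 0" by (rule ennreal_le_epsilon)
  thus ?thesis by simp
qed

section \<open>Approximation implies the Riemann Hypothesis\<close>

text \<open>\<open>f0\<close> contributes at most its L1 norm, and Cauchy-Schwarz on an interval of
  length \<delta> contributes sqrt \<delta> times the L2 norm of \<open>f1\<close>. Hence the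
  K-functional at t = sqrt \<delta> controls the mass of the sum near 0.\<close>

lemma nn_integral_L1_L2_decomposition:
  fixes f0 f1 :: "real \<Rightarrow> real"
  assumes \<delta>: "0 < \<delta>" "\<delta> \<le> 1"
    and f0: "Lp_norm 1 (lebesgue_on {0<..<1}) f0 < \<infinity>" and f1: "Lp_norm 2 (lebesgue_on {0<..<1}) f1 < \<infinity>"
  shows "(\<integral>\<^sup>+x. ennreal (\<bar>f0 x + f1 x\<bar> * indicator {0<..\<delta>} x) \<partial>lebesgue_on {0<..<1}) \<le>
    Lp_norm 1 (lebesgue_on {0<..<1}) f0 + ennreal (sqrt \<delta>) * Lp_norm 2 (lebesgue_on {0<..<1}) f1"
proof -
  let ?L = "lebesgue_on {0<..<1::real}"
  have 0: "f0 \<in> borel_measurable ?L" "integrable ?L (\<lambda>x. \<bar>f0 x\<bar>)"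
    "Lp_norm 1 ?L f0 = ennreal (\<integral>x. \<bar>f0 x\<bar> \<partial>?L)"
    using f0 by (auto simp: Lp_norm_def split: if_splits)
  have 1: "f1 \<in> borel_measurable ?L" "integrable ?L (\<lambda>x. (f1 x)\<^sup>2)"
    "Lp_norm 2 ?L f1 = ennreal (sqrt (\<integral>x. (f1 x)\<^sup>2 \<partial>?L))"
    using f1 by (auto simp: Lp_norm_def powr_numeral powr_half_sqrt split: if_splits)
  note [measurable] = 0(1) 1(1)
  let ?i = "indicator {0<..\<delta>} :: real \<Rightarrow> real"
  have im [measurable]: "?i \<in> borel_measurable ?L" by (rule lebesgue_on_unit_interval) measurable
  have ii: "integrable ?L ?i" "(\<integral>x. ?i x \<partial>?L) \<le> \<delta>"
  proof -
    have li: "integrable lborel ?i" by (rule integrable_real_indicator) (use \<delta> in auto)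
    hence si: "set_integrable lborel {0<..<1} ?i"
      unfolding set_integrable_def by (intro integrable_mult_indicator) auto
    thus "integrable ?L ?i" by (simp add: lebesgue_on_unit_interval unit_interval_measure_integral)
    have bi: "?i \<in> borel_measurable borel" by measurable
    have "(\<integral>x. ?i x \<partial>?L) = (LBINT x:{0<..<1}. ?i x)"
      by (simp only: lebesgue_on_unit_interval(2)[OF bi] unit_interval_measure_integral)
    also have "\<dots> \<le> (\<integral>x. ?i x \<partial>lborel)"
      unfolding set_lebesgue_integral_def
      by (rule integral_mono[OF si[unfolded set_integrable_def] li]) (simp add: indicator_def)
    also have "\<dots> = \<delta>" using \<delta> by simp
    finally show "(\<integral>x. ?i x \<partial>?L) \<le> \<delta>" .
  qed
  have sqa: "square_integrable ?L (\<lambda>x. \<bar>f1 x\<bar>)" using 1 by (simp add: square_integrable_def)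
  have i2: "(?i x)\<^sup>2 = ?i x" for x by (auto simp: indicator_def)
  have sqi: "square_integrable ?L ?i" using ii by (simp add: square_integrable_def i2)
  let ?P = "\<integral>x. \<bar>f1 x\<bar> * ?i x \<partial>?L" and ?A = "\<integral>x. (f1 x)\<^sup>2 \<partial>?L"
  have A0: "?A \<ge> 0" by simp
  have "?P \<le> sqrt \<delta> * sqrt ?A"
  proof -
    \<comment> \<open>The coefficient -P/\<delta> is the minimizer for an indicator of integral
      \<delta>; it turns nonnegativity into P^2 \<le> \<delta> A.\<close>
    have "0 \<le> (\<integral>x. (1 * \<bar>f1 x\<bar> + (- ?P / \<delta>) * ?i x)\<^sup>2 \<partial>?L)" by simp
    also have "\<dots> = ?A - 2 * ?P\<^sup>2 / \<delta> + (?P / \<delta>)\<^sup>2 * (\<integral>x. ?i x \<partial>?L)"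
      unfolding square_integrable_lincomb(2)[OF sqa sqi] i2 by (simp add: power2_eq_square)
    also have "\<dots> \<le> ?A - 2 * ?P\<^sup>2 / \<delta> + (?P / \<delta>)\<^sup>2 * \<delta>"
      using ii by (intro add_left_mono mult_left_mono) auto
    also have "(?P / \<delta>)\<^sup>2 * \<delta> = ?P\<^sup>2 / \<delta>" using \<delta> by (simp add: power2_eq_square)
    finally have "?P\<^sup>2 / \<delta> \<le> ?A" by simp
    hence "?P\<^sup>2 \<le> \<delta> * ?A" using \<delta> by (simp add: field_simps)
    hence "?P \<le> sqrt (\<delta> * ?A)" by (rule real_le_rsqrt)
    thus ?thesis by (simp add: real_sqrt_mult)
  qed
  hence P: "ennreal ?P \<le> ennreal (sqrt \<delta>) * Lp_norm 2 ?L f1"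
    unfolding 1(3) using \<delta> A0 by (subst ennreal_mult[symmetric]) (auto intro: ennreal_leI)
  have "(\<integral>\<^sup>+x. ennreal (\<bar>f0 x + f1 x\<bar> * ?i x) \<partial>?L) \<le>
      (\<integral>\<^sup>+x. ennreal \<bar>f0 x\<bar> + ennreal (\<bar>f1 x\<bar> * ?i x) \<partial>?L)"
  proof (rule nn_integral_mono)
    fix x
    have "\<bar>f0 x + f1 x\<bar> * ?i x \<le> \<bar>f0 x\<bar> + \<bar>f1 x\<bar> * ?i x" by (auto simp: indicator_def)
    hence "ennreal (\<bar>f0 x + f1 x\<bar> * ?i x) \<le> ennreal (\<bar>f0 x\<bar> + \<bar>f1 x\<bar> * ?i x)" by (rule ennreal_leI)
    thus "ennreal (\<bar>f0 x + f1 x\<bar> * ?i x) \<le> ennreal \<bar>f0 x\<bar> + ennreal (\<bar>f1 x\<bar> * ?i x)"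
      by (subst (asm) ennreal_plus) auto
  qed
  also have "\<dots> = (\<integral>\<^sup>+x. ennreal \<bar>f0 x\<bar> \<partial>?L) + (\<integral>\<^sup>+x. ennreal (\<bar>f1 x\<bar> * ?i x) \<partial>?L)"
    by (rule nn_integral_add) measurable
  also have "(\<integral>\<^sup>+x. ennreal \<bar>f0 x\<bar> \<partial>?L) = Lp_norm 1 ?L f0"
    unfolding 0(3) using 0(2) by (intro nn_integral_eq_integral) auto
  also have "(\<integral>\<^sup>+x. ennreal (\<bar>f1 x\<bar> * ?i x) \<partial>?L) = ennreal ?P"
    using square_integrable_mult[OF sqa sqi] by (intro nn_integral_eq_integral) auto
  finally show ?thesis using P by (meson add_left_mono order_trans)
qed

text \<open>Take t = sqrt \<delta> in the supremum defining the norm: the K-functional there is at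
  most t^\<theta> times the norm, and t^\<theta> = \<delta>^(\<theta>/2).\<close>

lemma nn_integral_le_interp_norm:
  fixes h :: "real \<Rightarrow> real"
  assumes \<delta>: "0 < \<delta>" "\<delta> \<le> 1"
  shows "(\<integral>\<^sup>+x. ennreal (\<bar>h x\<bar> * indicator {0<..\<delta>} x) \<partial>lebesgue_on {0<..<1}) \<le>
    ennreal (\<delta> powr (\<theta> / 2)) * interp_norm L1_L2_pair \<theta> h"
proof -
  let ?K = "K_functional (sqrt \<delta>) h (fst L1_L2_pair) (snd L1_L2_pair)"
  have "(\<integral>\<^sup>+x. ennreal (\<bar>h x\<bar> * indicator {0<..\<delta>} x) \<partial>lebesgue_on {0<..<1}) \<le> ?K"
    unfolding K_functional_def
  proof (rule INF_greatest, clarify)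
    fix f0 f1 assume h: "h = f0 + f1" "fst L1_L2_pair f0 < \<infinity>" "snd L1_L2_pair f1 < \<infinity>"
    show "(\<integral>\<^sup>+x. ennreal (\<bar>(f0 + f1) x\<bar> * indicator {0<..\<delta>} x) \<partial>lebesgue_on {0<..<1}) \<le>
        fst L1_L2_pair f0 + ennreal (sqrt \<delta>) * snd L1_L2_pair f1"
      using nn_integral_L1_L2_decomposition[OF \<delta>, of f0 f1] h by (simp add: L1_L2_pair_def)
  qed
  also have "?K = ennreal (sqrt \<delta> powr \<theta>) * (ennreal (sqrt \<delta> powr (- \<theta>)) * ?K)"
    using \<delta> by (simp add: ennreal_mult[symmetric] mult.assoc[symmetric] powr_add[symmetric])
  also have "\<dots> \<le> ennreal (sqrt \<delta> powr \<theta>) * interp_norm L1_L2_pair \<theta> h"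
    unfolding interp_norm_def using \<delta> by (intro mult_left_mono SUP_upper) auto
  also have "sqrt \<delta> powr \<theta> = \<delta> powr (\<theta> / 2)"
    using \<delta> by (simp add: powr_half_sqrt[symmetric] powr_powr)
  finally show ?thesis .
qed

lemma dyadic_interval:
  fixes x :: real
  assumes "0 < x" "x \<le> 1"
  obtains j :: nat where "(1 / 2) ^ Suc j < x" "x \<le> (1 / 2) ^ j"
proof -
  have ex: "\<exists>j. (1 / 2) ^ j < x" using real_arch_pow_inv[OF assms(1), of "1 / 2"] by auto
  define m where "m = (LEAST j. (1 / 2 :: real) ^ j < x)"
  have m: "(1 / 2) ^ m < x" unfolding m_def by (rule LeastI_ex[OF ex])
  hence "m \<noteq> 0" using assms by (intro notI) simp
  then obtain j where j: "m = Suc j" by (cases m) auto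
  have "\<not> (1 / 2) ^ j < x" by (rule not_less_Least) (use j in \<open>simp add: m_def\<close>)
  thus ?thesis using that[of j] m j by simp
qed

text \<open>Split \<open>(0,1)\<close> dyadically and estimate the piece near \<open>2\<^bsup>-j\<^esup>\<close> by the \<open>K\<close>-functional
  at \<open>t = 2\<^bsup>-j/2\<^esup>\<close>.\<close>

lemma weighted_integral_le_interp_norm:
  assumes \<sigma>: "\<sigma> < 1" and \<theta>: "\<theta> / 2 > 1 - \<sigma>"
  obtains C where "C > 0"
    "\<And>h. h \<in> borel_measurable borel \<Longrightarrow> (\<integral>\<^sup>+x. ennreal (\<bar>h x\<bar> * x powr (\<sigma> - 1)) \<partial>lebesgue_on {0<..<1}) \<le>
       ennreal C * interp_norm L1_L2_pair \<theta> h"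
proof -
  let ?L = "lebesgue_on {0<..<1::real}"
  \<comment> \<open>\<open>w j\<close> bounds the weight on (2^(-j-1), 2^(-j)] by its value at the
    left end. Together with the factor 2^(-j\<theta>/2) for the mass of (0, 2^(-j)] it gives c q^j,
    and q < 1 is exactly the condition \<theta>/2 > 1 - \<sigma>.\<close>
  define c where "c = (1 / 2 :: real) powr (\<sigma> - 1)"
  define q where "q = (1 / 2 :: real) powr (\<sigma> - 1 + \<theta> / 2)"
  define w where "w = (\<lambda>j. ((1 / 2) ^ Suc j) powr (\<sigma> - 1))"
  have c: "c > 0" by (simp add: c_def)
  have q: "0 < q" "q < 1" using \<theta> by (auto simp: q_def powr01_less_one)
  have wq: "w j * ((1 / 2) ^ j) powr (\<theta> / 2) = c * q ^ j" for j
  proof -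
    have pw: "((1 / 2) ^ j) powr a = ((1 / 2 :: real) powr a) ^ j" for a
      by (simp add: powr_realpow[symmetric] powr_powr mult.commute)
    have "w j = c * ((1 / 2) ^ j) powr (\<sigma> - 1)"
      unfolding w_def c_def power_Suc by (subst powr_mult) auto
    thus ?thesis by (simp add: pw q_def powr_add power_mult_distrib)
  qed
  define C where "C = c * (1 / (1 - q))"
  have sumC: "(\<lambda>j. c * q ^ j) sums C" unfolding C_def
    by (intro sums_mult geometric_sums) (use q in auto)
  have "(\<integral>\<^sup>+x. ennreal (\<bar>h x\<bar> * x powr (\<sigma> - 1)) \<partial>?L) \<le> ennreal C * interp_norm L1_L2_pair \<theta> h"
    if [measurable]: "h \<in> borel_measurable borel" for h
  proof -
    let ?N = "interp_norm L1_L2_pair \<theta> h"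
    let ?t = "\<lambda>j x. ennreal (w j) * ennreal (\<bar>h x\<bar> * indicator {0<..(1 / 2) ^ j} x)"
    have m: "(\<lambda>x. \<bar>h x\<bar> * indicator {0<..(1 / 2) ^ j} x) \<in> borel_measurable ?L" for j
      by (rule lebesgue_on_unit_interval) measurable
    have "(\<integral>\<^sup>+x. ennreal (\<bar>h x\<bar> * x powr (\<sigma> - 1)) \<partial>?L) \<le> (\<integral>\<^sup>+x. (\<Sum>j. ?t j x) \<partial>?L)"
    proof (rule nn_integral_mono)
      fix x assume "x \<in> space ?L"
      hence x: "0 < x" "x < 1" by (auto simp: space_restrict_space)
      then obtain j where j: "(1 / 2) ^ Suc j < x" "x \<le> (1 / 2) ^ j" using dyadic_interval[of x] by auto
      have "x powr (\<sigma> - 1) \<le> w j"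
        unfolding w_def using j \<sigma> by (intro powr_mono2') auto
      hence "\<bar>h x\<bar> * x powr (\<sigma> - 1) \<le> \<bar>h x\<bar> * w j" by (rule mult_left_mono) simp
      also have "\<bar>h x\<bar> * w j = w j * (\<bar>h x\<bar> * indicator {0<..(1 / 2) ^ j} x)" using j x by simp
      finally have "\<bar>h x\<bar> * x powr (\<sigma> - 1) \<le> w j * (\<bar>h x\<bar> * indicator {0<..(1 / 2) ^ j} x)" .
      hence "ennreal (\<bar>h x\<bar> * x powr (\<sigma> - 1)) \<le> ?t j x"
        by (subst ennreal_mult[symmetric]) (auto simp: w_def intro: ennreal_leI)
      also have "\<dots> \<le> (\<Sum>j. ?t j x)"
        using sum_le_suminf[of "\<lambda>j. ?t j x" "{j}"] by simp
      finally show "ennreal (\<bar>h x\<bar> * x powr (\<sigma> - 1)) \<le> (\<Sum>j. ?t j x)" .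
    qed
    also have "\<dots> = (\<Sum>j. \<integral>\<^sup>+x. ?t j x \<partial>?L)"
      using m by (intro nn_integral_suminf) auto
    also have "\<dots> = (\<Sum>j. ennreal (w j) * (\<integral>\<^sup>+x. ennreal (\<bar>h x\<bar> * indicator {0<..(1 / 2) ^ j} x) \<partial>?L))"
      using m by (intro suminf_cong nn_integral_cmult) auto
    also have "\<dots> \<le> (\<Sum>j. ennreal (c * q ^ j) * ?N)"
    proof (rule suminf_le)
      fix j
      have "(\<integral>\<^sup>+x. ennreal (\<bar>h x\<bar> * indicator {0<..(1 / 2) ^ j} x) \<partial>?L) \<le> ennreal (((1 / 2) ^ j) powr (\<theta> / 2)) * ?N"
        by (rule nn_integral_le_interp_norm) (auto intro: power_le_one)
      hence "ennreal (w j) * (\<integral>\<^sup>+x. ennreal (\<bar>h x\<bar> * indicator {0<..(1 / 2) ^ j} x) \<partial>?L) \<le>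
          ennreal (w j) * (ennreal (((1 / 2) ^ j) powr (\<theta> / 2)) * ?N)"
        by (rule mult_left_mono) simp
      also have "\<dots> = ennreal (c * q ^ j) * ?N"
        unfolding wq[symmetric] by (simp add: ennreal_mult mult.assoc w_def)
      finally show "ennreal (w j) * (\<integral>\<^sup>+x. ennreal (\<bar>h x\<bar> * indicator {0<..(1 / 2) ^ j} x) \<partial>?L) \<le>
          ennreal (c * q ^ j) * ?N" .
    qed auto
    also have "\<dots> = (\<Sum>j. ennreal (c * q ^ j)) * ?N" by (rule ennreal_suminf_multc)
    also have "(\<Sum>j. ennreal (c * q ^ j)) = ennreal C"
      using c q sumC by (subst suminf_ennreal2) (auto simp: sums_iff)
    finally show ?thesis .
  qed
  moreover have "C > 0" using c q by (simp add: C_def)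
  ultimately show ?thesis using that by blast
qed

text \<open>At a zero the half-line transform vanishes for every dilation, so the part over (0,1) is
  minus the part over (1,\<infinity>). The latter is explicit, because ax > 1 there when a >=
  1.\<close>

lemma mellin_frac_inverse_scaled_at_zero:
  assumes s: "0 < Re s" "Re s < 1" "zeta_reg s = 0" and a: "a \<ge> 1"
  shows "mellin (\<lambda>x. frac (1 / (a * x))) s = 1 / (of_real a * (s - 1))"
proof -
  let ?f = "\<lambda>x. complex_of_real (frac (1 / (a * x))) * of_real x powr (s - 1)"
  have m: "(\<lambda>x. frac (1 / (a * x))) \<in> borel_measurable borel" by measurable
  have 1: "set_integrable lborel {0<..<1} ?f"
    by (rule mellin_integrand_integrable[OF m bounded_mellin_integrable(1)[OF m frac_abs_le_1 s(1)]]) simp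
  have eq: "?f x = of_real (1 / a) * of_real x powr ((s - 1) - 1)" if "x > 1" for x
  proof -
    have "a * x > 1" using a that by (metis less_1_mult less_eq_real_def mult_1 order_less_le_trans)
    hence "frac (1 / (a * x)) = 1 / (a * x)" by (simp add: frac_eq)
    moreover have "complex_of_real x powr ((s - 1) - 1) = of_real x powr (s - 1) / of_real x powr 1"
      by (rule powr_diff)
    ultimately show ?thesis using that by (simp add: powr_to_1)
  qed
  have e2: "set_integrable lborel {1<..} ?f \<longleftrightarrow>
      set_integrable lborel {1<..} (\<lambda>x. of_real (1 / a) * complex_of_real x powr ((s - 1) - 1))"
    by (rule set_integrable_cong[OF refl refl]) (rule eq, simp)
  have e3: "(LBINT x:{1<..}. ?f x) = (LBINT x:{1<..}. of_real (1 / a) * complex_of_real x powr ((s - 1) - 1))"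
    by (rule set_lebesgue_integral_cong) (simp, intro allI impI eq, simp)
  have 2: "set_integrable lborel {1<..} ?f" "(LBINT x:{1<..}. ?f x) = of_real (1 / a) * (- 1 / (s - 1))"
    unfolding e2 e3 using powr_set_integral_infinity_complex[of "s - 1"] s by auto
  have "(LBINT x:{0<..}. ?f x) = mellin (\<lambda>x. frac (1 / (a * x))) s + of_real (1 / a) * (- 1 / (s - 1))"
    unfolding mellin_def 2(2)[symmetric] by (rule set_integral_halfline_split(2)[OF 1 2(1)]) measurable
  moreover have "(LBINT x:{0<..}. ?f x) = 0"
    using halfline_mellin_frac_inverse_scaled(2)[OF s(1,2), of a] s(3) a by simp
  ultimately show ?thesis by (simp add: add_eq_0_iff2)
qed

text \<open>The value is \<sigma> + \<sigma>(1-\<sigma>) j with j the integral of a nonnegative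
  function, hence positive. A zero in the strip is thus not real, and Im (-1/s) is nonzero.\<close>

lemma zeta_reg_real_nonzero:
  assumes "0 < \<sigma>" "\<sigma> < 1"
  shows "zeta_reg (of_real \<sigma>) \<noteq> 0"
proof -
  have "mellin frac_inverse (of_real \<sigma>) = (LBINT x:{0<..<1}. complex_of_real (frac (1 / x) * x powr (\<sigma> - 1)))"
    unfolding mellin_def
  proof (rule set_lebesgue_integral_cong)
    show "\<forall>x. x \<in> {0<..<1::real} \<longrightarrow> complex_of_real (frac (1 / x)) * complex_of_real x powr (complex_of_real \<sigma> - 1) =
        complex_of_real (frac (1 / x) * x powr (\<sigma> - 1))"
      using powr_of_real[of _ "\<sigma> - 1"] by simp
  qed auto
  also have "\<dots> = of_real (LBINT x:{0<..<1}. frac (1 / x) * x powr (\<sigma> - 1))"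
    by (rule set_integral_complex_of_real)
  finally have J: "mellin frac_inverse (of_real \<sigma>) = of_real (LBINT x:{0<..<1}. frac (1 / x) * x powr (\<sigma> - 1))" .
  define j where "j = (LBINT x:{0<..<1}. frac (1 / x) * x powr (\<sigma> - 1))"
  have "j \<ge> 0" unfolding j_def set_lebesgue_integral_def by (rule integral_nonneg_AE) (simp add: frac_ge_0)
  hence "0 \<le> \<sigma> * (1 - \<sigma>) * j" using assms by simp
  have "\<sigma> - \<sigma> * (\<sigma> - 1) * j > 0"
  proof -
    have "\<sigma> - \<sigma> * (\<sigma> - 1) * j = \<sigma> + \<sigma> * (1 - \<sigma>) * j" by (simp add: algebra_simps)
    thus ?thesis using \<open>0 \<le> \<sigma> * (1 - \<sigma>) * j\<close> assms by linarith
  qed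
  moreover have "zeta_reg (of_real \<sigma>) = of_real (\<sigma> - \<sigma> * (\<sigma> - 1) * j)"
    unfolding zeta_reg_def J by (simp add: j_def)
  ultimately show ?thesis by (simp only: of_real_eq_0_iff)
qed

text \<open>Each Beurling term contributes the real number c_k/a_k to (s-1) times the transform, so
  the imaginary part retains only (s-1)/s = 1 - 1/s from the constant function.\<close>

lemma mellin_one_minus_Beurling:
  assumes s: "0 < Re s" "Re s < 1" "zeta_reg s = 0" and f: "f \<in> Beurling_functions"
  shows "Im ((s - 1) * mellin (\<lambda>x. indicator {0<..<1} x - f x) s) = Im (- 1 / s)"
proof -
  obtain n c a where f: "f = (\<lambda>x. \<Sum>k=1..n. c k * frac (1 / (a k * x)))"
    "\<forall>k\<in>{1..n::nat}. a k \<ge> (1::real)" "(\<Sum>k=1..n. c k * frac (1 / a k)) = (0::real)"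
    using f unfolding Beurling_functions_def by blast
  have s1: "s \<noteq> 1" using s by auto
  define P where "P = (\<lambda>x. indicator {0<..<1} x *\<^sub>R complex_of_real x powr (s - 1))"
  define G where "G = (\<lambda>k x. indicator {0<..<1} x *\<^sub>R
      (complex_of_real (frac (1 / (a k * x))) * complex_of_real x powr (s - 1)))"
  have ip: "integrable lborel P" "(\<integral>x. P x \<partial>lborel) = 1 / s"
    using powr_set_integral_0_complex[of s 1] s
    by (auto simp: P_def set_integrable_def set_lebesgue_integral_def)
  have m: "(\<lambda>x. frac (1 / (a k * x))) \<in> borel_measurable borel" for k by measurable
  have ig: "integrable lborel (G k)" for k
    using mellin_integrand_integrable[OF m bounded_mellin_integrable(1)[OF m frac_abs_le_1 s(1)], of s k]
    unfolding set_integrable_def G_def by simp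
  have "mellin (\<lambda>x. indicator {0<..<1} x - f x) s = (\<integral>x. P x - (\<Sum>k=1..n. of_real (c k) * G k x) \<partial>lborel)"
    unfolding mellin_def set_lebesgue_integral_def
  proof (intro Bochner_Integration.integral_cong refl)
    fix x :: real
    show "indicator {0<..<1} x *\<^sub>R (complex_of_real (indicator {0<..<1} x - f x) * complex_of_real x powr (s - 1)) =
        P x - (\<Sum>k=1..n. of_real (c k) * G k x)"
      by (cases "x \<in> {0<..<1}")
         (auto simp: f(1) P_def G_def sum_distrib_right left_diff_distrib mult.assoc)
  qed
  also have "\<dots> = 1 / s - (\<Sum>k=1..n. of_real (c k) * (\<integral>x. G k x \<partial>lborel))"
    using ip ig by simp
  also have "(\<Sum>k=1..n. of_real (c k) * (\<integral>x. G k x \<partial>lborel)) =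
      (\<Sum>k=1..n. of_real (c k) * (1 / (of_real (a k) * (s - 1))))"
  proof (intro sum.cong refl arg_cong2[of _ _ _ _ "(*)"])
    fix k assume "k \<in> {1..n}"
    thus "(\<integral>x. G k x \<partial>lborel) = 1 / (of_real (a k) * (s - 1))"
      using mellin_frac_inverse_scaled_at_zero[OF s, of "a k"] f(2)
      by (simp add: mellin_def set_lebesgue_integral_def G_def)
  qed
  also have "\<dots> = (\<Sum>k=1..n. of_real (c k / a k)) / (s - 1)"
    by (simp add: sum_divide_distrib)
  also have "\<dots> = of_real (\<Sum>k=1..n. c k / a k) / (s - 1)" by simp
  finally have "(s - 1) * mellin (\<lambda>x. indicator {0<..<1} x - f x) s = (s - 1) / s - of_real (\<Sum>k=1..n. c k / a k)"
    using s1 by (simp add: right_diff_distrib)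
  moreover have "s \<noteq> 0" using s by auto
  hence "(s - 1) / s = 1 + - 1 / s" by (simp add: diff_divide_distrib)
  ultimately show ?thesis by simp
qed

text \<open>A single index \<theta> already obstructs: the norm of 1 - f at \<theta> is at least d/C
  for every Beurling f, so the infimum is at least M(\<theta>) d/C > 0 for any positive
  weight.\<close>

theorem interp_approximation_imp_RH:
  fixes M :: "real \<Rightarrow> real"
  assumes M: "\<And>\<theta>. \<theta> \<in> {0<..<1} \<Longrightarrow> M \<theta> > 0"
    and inf: "(INF f\<in>Beurling_functions. Delta_norm {0<..<1} (\<lambda>\<theta>. scaled_norm (M \<theta>) (interp_norm L1_L2_pair \<theta>))
           (\<lambda>x. indicator {0<..<1} x - f x)) = 0"
  shows "Riemann_Hypothesis"
  unfolding Riemann_Hypothesis_def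
proof (intro allI impI notI)
  fix s assume s: "1 / 2 < Re s \<and> Re s < 1" and z: "zeta s = 0"
  define \<sigma> where "\<sigma> = Re s"
  \<comment> \<open>The midpoint of 2(1-\<sigma>) and 1; it lies strictly between them because
    \<sigma> > 1/2.\<close>
  define \<theta> where "\<theta> = 3 / 2 - \<sigma>"
  have \<sigma>: "1 / 2 < \<sigma>" "\<sigma> < 1" using s by (auto simp: \<sigma>_def)
  have \<theta>: "\<theta> \<in> {0<..<1}" "\<theta> / 2 > 1 - \<sigma>" using \<sigma> by (auto simp: \<theta>_def)
  have s1: "s \<noteq> 1" using s by auto
  have zr: "zeta_reg s = 0" using zeta_reg_eq[of s] s z s1 by simp
  have "Im s \<noteq> 0"
  proof
    assume "Im s = 0"
    hence "s = of_real \<sigma>" by (simp add: complex_eq_iff \<sigma>_def)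
    thus False using zeta_reg_real_nonzero[of \<sigma>] \<sigma> zr by simp
  qed
  hence im: "Im (- 1 / s) \<noteq> 0" by (simp add: Im_divide)
  obtain C where C: "C > 0" "\<And>h. h \<in> borel_measurable borel \<Longrightarrow>
      (\<integral>\<^sup>+x. ennreal (\<bar>h x\<bar> * x powr (\<sigma> - 1)) \<partial>lebesgue_on {0<..<1}) \<le> ennreal C * interp_norm L1_L2_pair \<theta> h"
    using weighted_integral_le_interp_norm[OF \<sigma>(2) \<theta>(2)] by metis
  define d where "d = \<bar>Im (- 1 / s)\<bar> / norm (s - 1)"
  have d: "d > 0" using im s1 by (simp add: d_def)
  have low: "ennreal d \<le> ennreal C * interp_norm L1_L2_pair \<theta> (\<lambda>x. indicator {0<..<1} x - f x)"
    if f: "f \<in> Beurling_functions" for f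
  proof -
    define h where "h = (\<lambda>x. indicator {0<..<1} x - f x)"
    note [measurable] = Beurling_bounded(1)[OF f]
    obtain B where B: "\<And>x. \<bar>f x\<bar> \<le> B" using Beurling_bounded(2)[OF f] by blast
    have hm [measurable]: "h \<in> borel_measurable borel" unfolding h_def by measurable
    have hb: "\<bar>h x\<bar> \<le> 1 + B" for x using B[of x] by (auto simp: h_def indicator_def)
    have \<sigma>0: "\<sigma> > 0" using \<sigma> by simp
    note hi = bounded_mellin_integrable(1)[OF hm hb \<sigma>0]
    have "\<bar>Im (- 1 / s)\<bar> = \<bar>Im ((s - 1) * mellin h s)\<bar>"
      using mellin_one_minus_Beurling[of s f] s zr f by (simp add: h_def)
    also have "\<dots> \<le> norm ((s - 1) * mellin h s)" by (rule abs_Im_le_cmod)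
    finally have "\<bar>Im (- 1 / s)\<bar> \<le> norm (s - 1) * norm (mellin h s)" by (simp add: norm_mult)
    hence "d \<le> norm (mellin h s)" using s1 by (simp add: d_def field_simps)
    also have "\<dots> \<le> (LBINT x:{0<..<1}. \<bar>h x\<bar> * x powr (\<sigma> - 1))"
      by (rule norm_mellin_le[OF hm hi]) (simp add: \<sigma>_def)
    also have "\<dots> = (\<integral>x. \<bar>h x\<bar> * x powr (\<sigma> - 1) \<partial>lebesgue_on {0<..<1})"
      using lebesgue_on_unit_interval(2)[of "\<lambda>x. \<bar>h x\<bar> * x powr (\<sigma> - 1)"]
      by (simp add: unit_interval_measure_integral)
    finally have "ennreal d \<le> ennreal (\<integral>x. \<bar>h x\<bar> * x powr (\<sigma> - 1) \<partial>lebesgue_on {0<..<1})"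
      by (rule ennreal_leI)
    also have "\<dots> = (\<integral>\<^sup>+x. ennreal (\<bar>h x\<bar> * x powr (\<sigma> - 1)) \<partial>lebesgue_on {0<..<1})"
      using hi lebesgue_on_unit_interval(1)[of "\<lambda>x. \<bar>h x\<bar> * x powr (\<sigma> - 1)"]
      by (intro nn_integral_eq_integral[symmetric]) (auto simp: unit_interval_measure_integral)
    also have "\<dots> \<le> ennreal C * interp_norm L1_L2_pair \<theta> h" by (rule C(2)[OF hm])
    finally show ?thesis by (simp add: h_def)
  qed
  define b where "b = M \<theta> * (d / C)"
  have b: "b > 0" using M[OF \<theta>(1)] d C by (simp add: b_def)
  have "ennreal b \<le> (INF f\<in>Beurling_functions. Delta_norm {0<..<1} (\<lambda>\<theta>. scaled_norm (M \<theta>) (interp_norm L1_L2_pair \<theta>))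
           (\<lambda>x. indicator {0<..<1} x - f x))"
  proof (rule INF_greatest)
    fix f assume f: "f \<in> Beurling_functions"
    let ?N = "interp_norm L1_L2_pair \<theta> (\<lambda>x. indicator {0<..<1} x - f x)"
    have "ennreal (1 / C) * ennreal d \<le> ennreal (1 / C) * (ennreal C * ?N)"
      using low[OF f] by (rule mult_left_mono) simp
    also have "\<dots> = ?N" using C(1) by (simp add: mult.assoc[symmetric] ennreal_mult[symmetric])
    finally have "ennreal (d / C) \<le> ?N" using C(1) d by (simp add: ennreal_mult[symmetric])
    hence "ennreal (M \<theta>) * ennreal (d / C) \<le> ennreal (M \<theta>) * ?N" by (rule mult_left_mono) simp
    have "ennreal b \<le> scaled_norm (M \<theta>) (interp_norm L1_L2_pair \<theta>) (\<lambda>x. indicator {0<..<1} x - f x)"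
    proof -
      have "ennreal b = ennreal (M \<theta>) * ennreal (d / C)"
        unfolding b_def using M[OF \<theta>(1)] d C(1) by (intro ennreal_mult) auto
      thus ?thesis using \<open>ennreal (M \<theta>) * ennreal (d / C) \<le> ennreal (M \<theta>) * ?N\<close> by (simp add: scaled_norm_def)
    qed
    also have "\<dots> \<le> Delta_norm {0<..<1} (\<lambda>\<theta>. scaled_norm (M \<theta>) (interp_norm L1_L2_pair \<theta>))
           (\<lambda>x. indicator {0<..<1} x - f x)"
      unfolding Delta_norm_def by (rule SUP_upper[OF \<theta>(1)])
    finally show "ennreal b \<le> Delta_norm {0<..<1} (\<lambda>\<theta>. scaled_norm (M \<theta>) (interp_norm L1_L2_pair \<theta>))
           (\<lambda>x. indicator {0<..<1} x - f x)" .
  qed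
  thus False using inf b by simp
qed

text \<open>The map p -> 2/p' = 2 - 2/p sends (1,2) onto (0,1), with inverse \<theta> ->
  2/(2-\<theta>), and a supremum depends only on the set of values. This identifies (b') with
  (b).\<close>

lemma Delta_norm_reparametrize:
  "Delta_norm {1<..<2} (\<lambda>p. A (2 / conjugate_exponent p)) = Delta_norm {0<..<1} A"
proof -
  have "(\<lambda>p. 2 / conjugate_exponent p) ` {1<..<2} = {0<..<1}"
  proof (intro equalityI subsetI)
    fix \<theta> :: real assume \<theta>: "\<theta> \<in> {0<..<1}"
    have "\<theta> = 2 / conjugate_exponent (2 / (2 - \<theta>))" "2 / (2 - \<theta>) \<in> {1<..<2}"
      using \<theta> by (auto simp: conjugate_exponent(2) field_simps)
    thus "\<theta> \<in> (\<lambda>p. 2 / conjugate_exponent p) ` {1<..<2}" by blast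
  qed (auto simp: conjugate_exponent(2) field_simps)
  hence "(\<lambda>\<theta>. A \<theta> f) ` {0<..<1} = (\<lambda>p. A (2 / conjugate_exponent p) f) ` {1<..<2}" for f
    using image_image[of "\<lambda>\<theta>. A \<theta> f" "\<lambda>p. 2 / conjugate_exponent p" "{1<..<2}"] by simp
  thus ?thesis unfolding Delta_norm_def by (intro ext) simp
qed

theorem mainTheorem1:
  shows
    "(Riemann_Hypothesis \<longleftrightarrow>
       (\<exists>M :: real \<Rightarrow> real. (\<forall>\<theta>\<in>{0<..<1}. M \<theta> > 0) \<and> tempered_at_1 M \<and>
          M \<in> O[at_left 1](\<lambda>_. 1) \<and>
          (INF f\<in>Beurling_functions.
             Delta_norm {0<..<1} (\<lambda>\<theta>. scaled_norm (M \<theta>) (interp_norm L1_L2_pair \<theta>))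
               (\<lambda>x. indicator {0<..<1} x - f x)) = 0))
   \<and> (Riemann_Hypothesis \<longleftrightarrow>
       (\<exists>M :: real \<Rightarrow> real. (\<forall>\<theta>\<in>{0<..<1}. M \<theta> > 0) \<and> tempered_at_1 M \<and>
          M \<in> O[at_left 1](\<lambda>_. 1) \<and>
          (let \<omega> = (\<lambda>p. M (2 / conjugate_exponent p)) in
          (INF f\<in>Beurling_functions.
             Delta_norm {1<..<2}
               (\<lambda>p. scaled_norm (\<omega> p) (interp_norm L1_L2_pair (2 / conjugate_exponent p)))
               (\<lambda>x. indicator {0<..<1} x - f x)) = 0)))"
proof -
  have reparam: "Delta_norm {1<..<2} (\<lambda>p. scaled_norm (M (2 / conjugate_exponent p))
      (interp_norm L1_L2_pair (2 / conjugate_exponent p))) =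
      Delta_norm {0<..<1} (\<lambda>\<theta>. scaled_norm (M \<theta>) (interp_norm L1_L2_pair \<theta>))" for M :: "real \<Rightarrow> real"
    by (rule Delta_norm_reparametrize[of "\<lambda>\<theta>. scaled_norm (M \<theta>) (interp_norm L1_L2_pair \<theta>)"])
  have t: "tempered_at_1 (\<lambda>_. 1)"
    unfolding tempered_at_1_def by (intro exI[of _ 1] bexI[of _ "1/2"] conjI) auto
  have O: "(\<lambda>_::real. 1::real) \<in> O[at_left 1](\<lambda>_. 1)" by simp
  have "Riemann_Hypothesis \<longleftrightarrow>
       (\<exists>M :: real \<Rightarrow> real. (\<forall>\<theta>\<in>{0<..<1}. M \<theta> > 0) \<and> tempered_at_1 M \<and>
          M \<in> O[at_left 1](\<lambda>_. 1) \<and>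
          (INF f\<in>Beurling_functions.
             Delta_norm {0<..<1} (\<lambda>\<theta>. scaled_norm (M \<theta>) (interp_norm L1_L2_pair \<theta>))
               (\<lambda>x. indicator {0<..<1} x - f x)) = 0)" (is "_ \<longleftrightarrow> (\<exists>M. ?Q M)")
  proof (intro iffI)
    assume "Riemann_Hypothesis"
    show "\<exists>M. ?Q M"
      by (rule exI[of _ "\<lambda>_. 1"]) (intro conjI ballI t O RH_imp_interp_approximation \<open>Riemann_Hypothesis\<close> zero_less_one)
  next
    assume "\<exists>M. ?Q M"
    then obtain M where "?Q M" ..
    thus "Riemann_Hypothesis" using interp_approximation_imp_RH[of M] by blast
  qed
  thus ?thesis unfolding Let_def reparam by (intro conjI)
qed

end
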